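(* Assume that $p(\cdot\,|x,a)$ is continuous in $(x,a)\in\mathsf X\times\mathsf A$ with respect to total variation distance, and that there exist a probability measure $\lambda$ on $\mathsf X$, a constant $\alpha\in(0,1)$ and a bounded measurable $\phi:\mathsf X\times\mathsf A\to\mathbb R$ such that $p(D|x,a)\ge\lambda(D)\phi(x,a)$ for all Borel $D\subset\mathsf X$ and $1-\alpha\le\phi(x,a)$, for all $(x,a)\in\mathsf X\times\mathsf A$. Consider the average cost criterion. For any given $\kappa>0$, there exist $\varepsilon>0$ and $n\ge1$ such that if $\overline\varphi_n$ is an optimal policy for $(\overline{\mathbf{CP}}_n^{\mathbf k-\varepsilon\mathbf 1})$ obtained by extending to $\mathsf X$ an optimal policy $\varphi_n\in\Phi_n$ for $(\mathbf{CP}_n^{\mathbf k-\varepsilon\mathbf 1})$, then $\overline\varphi_n\in\Phi$ is feasible for $(\mathbf{CP}^{\mathbf k})$ and the true cost $V(\overline\varphi_n,\gamma)$ of $\overline\varphi_n$ is within $\kappa$ of the optimal value of $(\mathbf{CP}^{\mathbf k})$.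
   Context: **Model.** $\mathsf X$ (states) and $\mathsf A$ (actions) are compact metric spaces with their Borel $\sigma$-algebras; $d_{\mathsf X}$ is the metric of $\mathsf X$; every action is admissible in every state. $p(\cdot\,|x,a)$ is a stochastic kernel on $\mathsf X$ given $\mathsf X\times\mathsf A$ (transition probability); $c,d_1,\dots,d_q:\mathsf X\times\mathsf A\to[0,\infty)$ are continuous; $\gamma$ is a probability measure on $\mathsf X$ (initial distribution); $\mathbf k=(k_1,\dots,k_q)\in[0,\infty)^q$; $\mathbf 1=(1,\dots,1)\in\mathbb R^q$. A policy $\pi=\{\pi_t\}$ is a sequence of stochastic kernels on $\mathsf A$ given the history spaces $\mathsf H_t=(\mathsf X\times\mathsf A)^t\times\mathsf X$; $\Pi$ is the set of all policies; $\Phi$ is the set of stochastic kernels on $\mathsf A$ given $\mathsf X$, identified with the randomized stationary policies. $\mathbb E_\gamma^\pi$ is expectation under the law of $(X_t,A_t)_{t\ge0}$ determined by $\gamma$, $\pi$, $p$. **Average criterion.** $V(\pi,\gamma)=\limsup_{T\to\infty}\frac1T\mathbb E_\gamma^\pi[\sum_{t=0}^{T-1}c(X_t,A_t)]$, and $V_l(\pi,\gamma)$ is the same with $d_l$ in place of $c$. For $\mathbf m\in\mathbb R^q$, $(\mathbf{CP}^{\mathbf m})$: minimize $V(\pi,\gamma)$ over $\pi\in\Pi$ subject to $V_l(\pi,\gamma)\le m_l$, $l=1,\dots,q$. Standing assumption: there is $\pi\in\Pi$ with $V_l(\pi,\gamma)<k_l$ for all $l$. **Finite models.** For each $n\ge1$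 let $\mathsf X_n=\{x_{n,1},\dots,x_{n,k_n}\}\subset\mathsf X$ be finite with $\min_i d_{\mathsf X}(x,x_{n,i})<1/n$ for all $x\in\mathsf X$; $Q_n:\mathsf X\to\mathsf X_n$ is a nearest-point map (ties broken so that $Q_n$ is measurable); $\mathcal S_{n,i}=Q_n^{-1}(x_{n,i})$; $i_n(x)$ is the index with $x\in\mathcal S_{n,i_n(x)}$. Let $\nu_n$ be a measure on $\mathsf X$ with $\nu_n(\mathcal S_{n,i})>0$ for all $i$, and let $\nu_{n,i}(\cdot)=\nu_n(\cdot)/\nu_n(\mathcal S_{n,i})$ be the probability measure on $\mathcal S_{n,i}$ obtained by restricting and normalizing $\nu_n$. MDP$_n$ has state space $\mathsf X_n$, action space $\mathsf A$, initial distribution $\gamma_n=\gamma\circ Q_n^{-1}$, and $p_n(x_{n,j}|x_{n,i},a)=\int_{\mathcal S_{n,i}}p(\mathcal S_{n,j}|x,a)\,\nu_{n,i}(dx)$, $c_n(x_{n,i},a)=\int_{\mathcal S_{n,i}}c(x,a)\,\nu_{n,i}(dx)$, $d_{l,n}(x_{n,i},a)=\int_{\mathcal S_{n,i}}d_l(x,a)\,\nu_{n,i}(dx)$. Its policies $\Pi_n$, randomized stationary policies $\Phi_n$ and average costs $V_n,V_{l,n}$ are defined as for the original model. $(\mathbf{CP}_n^{\mathbf m})$: minimize $V_n(\pi,\gamma_n)$ over $\pi\in\Pi_n$ subject to $V_{l,n}(\pi,\gamma_n)\le m_l$ for all $l$. The extension of $\varphi\in\Phi_n$ to $\mathsf X$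 is $\overline\varphi\in\Phi$, $\overline\varphi(\cdot|x)=\varphi(\cdot|Q_n(x))$. **The model $\overline{\text{MDP}}_n$** has state space $\mathsf X$, action space $\mathsf A$, initial distribution $\gamma$, transition kernel $q_n(\cdot|x,a)=\int p(\cdot|z,a)\,\nu_{n,i_n(x)}(dz)$, cost $b_n(x,a)=\int c(z,a)\,\nu_{n,i_n(x)}(dz)$ and constraint functions $r_{l,n}(x,a)=\int d_l(z,a)\,\nu_{n,i_n(x)}(dz)$. $(\overline{\mathbf{CP}}_n^{\mathbf m})$: minimize over $\pi\in\Pi$ the average cost of $b_n$ in $\overline{\text{MDP}}_n$ subject to the average cost of $r_{l,n}$ in $\overline{\text{MDP}}_n$ being at most $m_l$ for all $l$. *)

theory Defs
  imports "HOL-Analysis.Analysis" "HOL-Probability.Probability"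
begin

section \<open>Markov decision processes and the average cost\<close>

text \<open>
  A controlled Markov chain without its cost functions. The action space is the Borel space of the
  type \<open>'a\<close>; the state space is the measurable space \<open>states M\<close>, so that the same notions cover
  models on all of \<open>'x\<close> and models on a finite subset of \<open>'x\<close>.
\<close>

record ('x, 'a) mdp =
  states :: "'x measure"
  initial :: "'x measure"
  trans :: "'x \<times> 'a \<Rightarrow> 'x measure"

type_synonym ('x, 'a) policy = "nat \<Rightarrow> (nat \<Rightarrow> 'x \<times> 'a) \<times> 'x \<Rightarrow> 'a measure"

definition hist_space :: "'x measure \<Rightarrow> nat \<Rightarrow> ((nat \<Rightarrow> 'x \<times> 'a::topological_space) \<times> 'x) measure" where
  "hist_space S t = (\<Pi>\<^sub>M i\<in>{0..<t}. S \<Otimes>\<^sub>M borel) \<Otimes>\<^sub>M S"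

definition policies :: "'x measure \<Rightarrow> ('x, 'a::topological_space) policy set" where
  "policies S = {\<pi>. \<forall>t. \<pi> t \<in> hist_space S t \<rightarrow>\<^sub>M prob_algebra borel}"

definition stationary_kernels :: "'x measure \<Rightarrow> ('x \<Rightarrow> 'a::topological_space measure) set" where
  "stationary_kernels S = S \<rightarrow>\<^sub>M prob_algebra borel"

definition stationary :: "('x \<Rightarrow> 'a measure) \<Rightarrow> ('x, 'a) policy" where
  "stationary \<phi> = (\<lambda>t (h, x). \<phi> x)"

text \<open>
  The conditional law of \<open>(X\<^sub>t, A\<^sub>t)\<close> given the past \<open>h = (X\<^sub>0, A\<^sub>0, \<dots>, X\<^bsub>t-1\<^esub>, A\<^bsub>t-1\<^esub>)\<close>. The law of the
  whole process is the measure that the Ionescu-Tulcea theorem attaches to these kernels.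
\<close>

definition stage_kernel ::
  "('x, 'a::topological_space) mdp \<Rightarrow> ('x, 'a) policy \<Rightarrow> nat \<Rightarrow> (nat \<Rightarrow> 'x \<times> 'a) \<Rightarrow> ('x \<times> 'a) measure"
where
  "stage_kernel M \<pi> t h =
     (case t of 0 \<Rightarrow> initial M | Suc s \<Rightarrow> trans M (h s)) \<bind>
       (\<lambda>x. \<pi> t (h, x) \<bind> (\<lambda>a. return (states M \<Otimes>\<^sub>M borel) (x, a)))"

lemma stage_kernel_measurable:
  assumes init: "initial M \<in> space (prob_algebra (states M))"
    and trans: "trans M \<in> states M \<Otimes>\<^sub>M borel \<rightarrow>\<^sub>M prob_algebra (states M)"
    and pol: "\<pi> \<in> policies (states M)"
  shows "stage_kernel M \<pi> t \<in> (\<Pi>\<^sub>M i\<in>{0..<t}. states M \<Otimes>\<^sub>M borel) \<rightarrow>\<^sub>M prob_algebra (states M \<Otimes>\<^sub>M borel)"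
proof -
  have 1: "(\<lambda>h. case t of 0 \<Rightarrow> initial M | Suc s \<Rightarrow> trans M (h s))
      \<in> (\<Pi>\<^sub>M i\<in>{0..<t}. states M \<Otimes>\<^sub>M borel) \<rightarrow>\<^sub>M prob_algebra (states M)"
    using init by (cases t) (auto intro!: measurable_compose[OF _ trans] measurable_component_singleton)
  have pi: "\<pi> t \<in> ((\<Pi>\<^sub>M i\<in>{0..<t}. states M \<Otimes>\<^sub>M borel) \<Otimes>\<^sub>M states M) \<rightarrow>\<^sub>M prob_algebra borel"
    using pol by (auto simp: policies_def hist_space_def)
  have "(\<lambda>(h, x). \<pi> t (h, x) \<bind> (\<lambda>a. return (states M \<Otimes>\<^sub>M borel) (x, a)))
      \<in> (\<Pi>\<^sub>M i\<in>{0..<t}. states M \<Otimes>\<^sub>M borel) \<Otimes>\<^sub>M states M \<rightarrow>\<^sub>M prob_algebra (states M \<Otimes>\<^sub>M borel)"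
    unfolding split_beta'
  proof (rule measurable_bind_prob_space2[where N = borel])
    show "(\<lambda>w. \<pi> t (fst w, snd w))
        \<in> (\<Pi>\<^sub>M i\<in>{0..<t}. states M \<Otimes>\<^sub>M borel) \<Otimes>\<^sub>M states M \<rightarrow>\<^sub>M prob_algebra borel"
      using pi by simp
    show "(\<lambda>(w, a). return (states M \<Otimes>\<^sub>M borel) (snd w, a))
        \<in> ((\<Pi>\<^sub>M i\<in>{0..<t}. states M \<Otimes>\<^sub>M borel) \<Otimes>\<^sub>M states M) \<Otimes>\<^sub>M borel
          \<rightarrow>\<^sub>M prob_algebra (states M \<Otimes>\<^sub>M borel)"
      unfolding split_beta' by (rule measurable_compose[OF _ measurable_return_prob_space]) measurable
  qed
  with 1 show ?thesis
    unfolding stage_kernel_def by (rule measurable_bind_prob_space2)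
qed

lemma Ionescu_Tulcea_stage_kernel:
  fixes M :: "('x, 'b::topological_space) mdp"
  assumes "initial M \<in> space (prob_algebra (states M))"
    and "trans M \<in> states M \<Otimes>\<^sub>M borel \<rightarrow>\<^sub>M prob_algebra (states M)"
    and "\<pi> \<in> policies (states M)"
  shows "Ionescu_Tulcea (stage_kernel M \<pi>) (\<lambda>_. states M \<Otimes>\<^sub>M borel)"
proof (rule Ionescu_Tulcea.intro)
  show "stage_kernel M \<pi> t \<in> (\<Pi>\<^sub>M i\<in>{0..<t}. states M \<Otimes>\<^sub>M borel) \<rightarrow>\<^sub>M subprob_algebra (states M \<Otimes>\<^sub>M borel)"
    for t
    by (rule measurable_prob_algebraD[OF stage_kernel_measurable[OF assms]])
next
  fix t :: nat and h :: "nat \<Rightarrow> 'x \<times> 'b"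
  assume "h \<in> space (\<Pi>\<^sub>M i\<in>{0..<t}. states M \<Otimes>\<^sub>M borel)"
  from measurable_space[OF stage_kernel_measurable[OF assms] this]
  show "prob_space (stage_kernel M \<pi> t h)"
    by (simp add: space_prob_algebra)
qed

definition process_law ::
  "('x, 'a::topological_space) mdp \<Rightarrow> ('x, 'a) policy \<Rightarrow> (nat \<Rightarrow> 'x \<times> 'a) measure"
where
  "process_law M \<pi> =
     projective_family.lim UNIV
       (Ionescu_Tulcea.CI (stage_kernel M \<pi>) (\<lambda>_. states M \<Otimes>\<^sub>M borel))
       (\<lambda>_. states M \<Otimes>\<^sub>M borel)"

definition avg_cost ::
  "('x, 'a::topological_space) mdp \<Rightarrow> ('x \<times> 'a \<Rightarrow> real) \<Rightarrow> ('x, 'a) policy \<Rightarrow> ereal"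
where
  "avg_cost M g \<pi> =
     limsup (\<lambda>T. ereal (1 / real T * (\<integral>\<omega>. (\<Sum>t<T. g (\<omega> t)) \<partial>process_law M \<pi>)))"

section \<open>Constrained problems\<close>

definition feasible ::
  "('x, 'a::topological_space) mdp \<Rightarrow> ('q::finite \<Rightarrow> 'x \<times> 'a \<Rightarrow> real) \<Rightarrow> real ^ 'q \<Rightarrow> ('x, 'a) policy \<Rightarrow> bool"
where
  "feasible M d m \<pi> \<longleftrightarrow>
     \<pi> \<in> policies (states M) \<and> (\<forall>l. avg_cost M (d l) \<pi> \<le> ereal (m $ l))"

definition optimal_policy ::
  "('x, 'a::topological_space) mdp \<Rightarrow> ('x \<times> 'a \<Rightarrow> real) \<Rightarrow> ('q::finite \<Rightarrow> 'x \<times> 'a \<Rightarrow> real) \<Rightarrow> real ^ 'q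
    \<Rightarrow> ('x, 'a) policy \<Rightarrow> bool"
where
  "optimal_policy M c d m \<pi> \<longleftrightarrow>
     feasible M d m \<pi> \<and> (\<forall>\<pi>'. feasible M d m \<pi>' \<longrightarrow> avg_cost M c \<pi> \<le> avg_cost M c \<pi>')"

definition optimal_value ::
  "('x, 'a::topological_space) mdp \<Rightarrow> ('x \<times> 'a \<Rightarrow> real) \<Rightarrow> ('q::finite \<Rightarrow> 'x \<times> 'a \<Rightarrow> real) \<Rightarrow> real ^ 'q
    \<Rightarrow> ereal"
where
  "optimal_value M c d m = (INF \<pi> \<in> {\<pi>. feasible M d m \<pi>}. avg_cost M c \<pi>)"

section \<open>The original model and its approximations\<close>

definition orig_mdp ::
  "('x::topological_space \<times> 'a \<Rightarrow> 'x measure) \<Rightarrow> 'x measure \<Rightarrow> ('x, 'a) mdp"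
where
  "orig_mdp p \<gamma> = \<lparr>states = borel, initial = \<gamma>, trans = p\<rparr>"

text \<open>
  Grid points serve as their own indices: the cell of a grid point \<open>y\<close> is \<open>Q -` {y}\<close>, and
  \<open>cell_measure \<nu> Q y\<close> is \<open>\<nu>\<close> restricted to that cell and normalized, regarded as a measure on
  all of \<open>'x\<close> that gives no mass to the complement of the cell.
\<close>

definition cell_measure :: "'x measure \<Rightarrow> ('x \<Rightarrow> 'x) \<Rightarrow> 'x \<Rightarrow> 'x measure" where
  "cell_measure \<nu> Q y = uniform_measure \<nu> (Q -` {y})"

definition fin_mdp ::
  "'x set \<Rightarrow> ('x \<Rightarrow> 'x) \<Rightarrow> 'x measure \<Rightarrow> ('x \<times> 'a \<Rightarrow> 'x measure) \<Rightarrow> 'x measure \<Rightarrow> ('x, 'a) mdp"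
where
  "fin_mdp Y Q \<nu> p \<gamma> =
     \<lparr>states = count_space Y,
      initial = distr \<gamma> (count_space Y) Q,
      trans = (\<lambda>(y, a). point_measure Y
        (\<lambda>y'. ennreal (\<integral>z. measure (p (z, a)) (Q -` {y'}) \<partial>cell_measure \<nu> Q y)))\<rparr>"

definition fin_cost :: "('x \<Rightarrow> 'x) \<Rightarrow> 'x measure \<Rightarrow> ('x \<times> 'a \<Rightarrow> real) \<Rightarrow> 'x \<times> 'a \<Rightarrow> real" where
  "fin_cost Q \<nu> g = (\<lambda>(y, a). \<integral>z. g (z, a) \<partial>cell_measure \<nu> Q y)"

definition bar_mdp ::
  "('x::topological_space \<Rightarrow> 'x) \<Rightarrow> 'x measure \<Rightarrow> ('x \<times> 'a \<Rightarrow> 'x measure) \<Rightarrow> 'x measure \<Rightarrow> ('x, 'a) mdp"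
where
  "bar_mdp Q \<nu> p \<gamma> =
     \<lparr>states = borel,
      initial = \<gamma>,
      trans = (\<lambda>(x, a). cell_measure \<nu> Q (Q x) \<bind> (\<lambda>z. p (z, a)))\<rparr>"

definition bar_cost :: "('x \<Rightarrow> 'x) \<Rightarrow> 'x measure \<Rightarrow> ('x \<times> 'a \<Rightarrow> real) \<Rightarrow> 'x \<times> 'a \<Rightarrow> real" where
  "bar_cost Q \<nu> g = (\<lambda>(x, a). \<integral>z. g (z, a) \<partial>cell_measure \<nu> Q (Q x))"

section \<open>Total variation\<close>

text \<open>
  For probability measures this is half the total variation norm of the difference; the factor
  does not affect continuity.
\<close>

definition tv_dist :: "'x measure \<Rightarrow> 'x measure \<Rightarrow> real" where
  "tv_dist \<mu> \<nu> = (SUP D \<in> sets \<mu>. \<bar>measure \<mu> D - measure \<nu> D\<bar>)"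

definition tv_continuous :: "('z::topological_space \<Rightarrow> 'x measure) \<Rightarrow> bool" where
  "tv_continuous p \<longleftrightarrow> (\<forall>z. ((\<lambda>w. tv_dist (p w) (p z)) \<longlongrightarrow> 0) (at z))"


section \<open>The approximating models are well-formed\<close>

lemma cell_measure_prob:
  assumes "sets \<nu> = sets borel" "finite_measure \<nu>" "measure \<nu> (Q -` {y}) > 0"
  shows "cell_measure \<nu> Q y \<in> space (prob_algebra borel)"
proof -
  interpret finite_measure \<nu> by fact
  show ?thesis
    using assms unfolding cell_measure_def space_prob_algebra
    by (auto intro!: prob_space_uniform_measure simp: emeasure_eq_measure)
qed

lemma fin_mdp_trans:
  fixes p :: "'x::polish_space \<times> 'a::polish_space \<Rightarrow> 'x measure"
  assumes p: "p \<in> borel \<Otimes>\<^sub>M borel \<rightarrow>\<^sub>M prob_algebra borel"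
    and Q: "Q \<in> borel \<rightarrow>\<^sub>M borel" "\<And>x. Q x \<in> Y" and Y: "finite Y"
    and nu: "\<And>y. y \<in> Y \<Longrightarrow> cell_measure \<nu> Q y \<in> space (prob_algebra borel)"
  shows "trans (fin_mdp Y Q \<nu> p \<gamma>) \<in> count_space Y \<Otimes>\<^sub>M borel \<rightarrow>\<^sub>M prob_algebra (count_space Y)"
proof -
  define K where "K = (\<lambda>y a. distr (cell_measure \<nu> Q y \<bind> (\<lambda>z. p (z, a))) (count_space Y) Q)"
  have Q': "Q \<in> borel \<rightarrow>\<^sub>M count_space Y"
    using Q Y by (subst measurable_count_space_eq2) (auto intro!: measurable_sets[of Q borel borel, simplified])
  have Kb: "(\<lambda>a. cell_measure \<nu> Q y \<bind> (\<lambda>z. p (z, a))) \<in> borel \<rightarrow>\<^sub>M prob_algebra borel" if "y \<in> Y" for y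
    apply (rule measurable_bind_prob_space2[where N = borel])
    using nu[OF that] apply simp
    unfolding split_beta'
    apply (rule measurable_compose[OF _ p])
    apply measurable
    done
  have Km: "K y \<in> borel \<rightarrow>\<^sub>M prob_algebra (count_space Y)" if "y \<in> Y" for y
    unfolding K_def by (rule measurable_compose[OF Kb[OF that] measurable_distr_prob_space[OF Q']])
  have eq: "point_measure Y (\<lambda>y'. ennreal (\<integral>z. measure (p (z, a)) (Q -` {y'}) \<partial>cell_measure \<nu> Q y)) = K y a"
    if y: "y \<in> Y" for y a
  proof (rule measure_eqI_finite[of _ Y])
    show "sets (point_measure Y (\<lambda>y'. ennreal (\<integral>z. measure (p (z, a)) (Q -` {y'}) \<partial>cell_measure \<nu> Q y))) = Pow Y"
      by (simp add: sets_point_measure)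
    show "sets (K y a) = Pow Y" by (simp add: K_def)
    show "finite Y" by fact
    fix y' assume y': "y' \<in> Y"
    have cm: "cell_measure \<nu> Q y \<in> space (prob_algebra borel)" by (rule nu[OF y])
    interpret prob_space "cell_measure \<nu> Q y" using cm by (simp add: space_prob_algebra)
    have s: "sets (cell_measure \<nu> Q y) = sets borel" using cm by (simp add: space_prob_algebra)
    have A: "Q -` {y'} \<in> sets borel" using measurable_sets[OF Q(1), of "{y'}"] by simp
    have pm: "(\<lambda>z. p (z, a)) \<in> cell_measure \<nu> Q y \<rightarrow>\<^sub>M prob_algebra borel"
      unfolding measurable_cong_sets[OF s refl] by (rule measurable_compose[OF _ p]) measurable
    have pp: "prob_space (p (z, a))" "sets (p (z,a)) = sets borel" for z
      using measurable_space[OF p, of "(z, a)"] by (auto simp: space_prob_algebra space_pair_measure)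
    have "emeasure (K y a) {y'} = emeasure (cell_measure \<nu> Q y \<bind> (\<lambda>z. p (z, a))) (Q -` {y'})"
    proof -
      have "cell_measure \<nu> Q y \<bind> (\<lambda>z. p (z, a)) \<in> space (prob_algebra borel)"
        using measurable_space[OF Kb[OF y]] by simp
      then have sb: "sets (cell_measure \<nu> Q y \<bind> (\<lambda>z. p (z, a))) = sets borel"
        by (simp add: space_prob_algebra)
      show ?thesis unfolding K_def using y'
        by (subst emeasure_distr) (auto simp: measurable_cong_sets[OF sb refl] Q' sets_eq_imp_space_eq[OF sb])
    qed
    also have "\<dots> = (\<integral>\<^sup>+z. emeasure (p (z, a)) (Q -` {y'}) \<partial>cell_measure \<nu> Q y)"
      by (rule emeasure_bind[OF not_empty measurable_prob_algebraD[OF pm] A])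
    also have "\<dots> = (\<integral>\<^sup>+z. ennreal (measure (p (z, a)) (Q -` {y'})) \<partial>cell_measure \<nu> Q y)"
      using pp by (simp add: finite_measure.emeasure_eq_measure prob_space.finite_measure)
    also have "\<dots> = ennreal (\<integral>z. measure (p (z, a)) (Q -` {y'}) \<partial>cell_measure \<nu> Q y)"
      apply (rule nn_integral_eq_integral)
      apply (rule integrable_const_bound[where B = 1])
      using pp apply (simp add: prob_space.prob_le_1)
      using measurable_compose[OF pm measurable_measure_prob_algebra[OF A]] apply simp
      apply simp
      done
    finally show "emeasure (point_measure Y (\<lambda>y'. ennreal (\<integral>z. measure (p (z, a)) (Q -` {y'}) \<partial>cell_measure \<nu> Q y))) {y'}
      = emeasure (K y a) {y'}"
      using y' Y by (simp add: emeasure_point_measure_finite)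
  qed
  have "(\<lambda>(y, a). K y a) \<in> count_space Y \<Otimes>\<^sub>M borel \<rightarrow>\<^sub>M prob_algebra (count_space Y)"
    using Km by (intro measurable_pair_measure_countable1) (auto simp: Y countable_finite)
  then show ?thesis
    by (rule iffD1[OF measurable_cong, rotated]) (auto simp: fin_mdp_def eq space_pair_measure)
qed

lemma bar_mdp_trans:
  fixes p :: "'x::polish_space \<times> 'a::polish_space \<Rightarrow> 'x measure"
  assumes p: "p \<in> borel \<Otimes>\<^sub>M borel \<rightarrow>\<^sub>M prob_algebra borel"
    and Q: "Q \<in> borel \<rightarrow>\<^sub>M borel" "\<And>x. Q x \<in> Y" and Y: "finite Y"
    and nu: "\<And>y. y \<in> Y \<Longrightarrow> cell_measure \<nu> Q y \<in> space (prob_algebra borel)"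
  shows "trans (bar_mdp Q \<nu> p \<gamma>) \<in> borel \<Otimes>\<^sub>M borel \<rightarrow>\<^sub>M prob_algebra borel"
proof -
  have Q': "Q \<in> borel \<rightarrow>\<^sub>M count_space Y"
    using Q Y by (subst measurable_count_space_eq2) (auto intro!: measurable_sets[of Q borel borel, simplified])
  have cm: "cell_measure \<nu> Q \<in> count_space Y \<rightarrow>\<^sub>M prob_algebra borel"
    using nu by simp
  have "(\<lambda>w. cell_measure \<nu> Q (Q (fst w)) \<bind> (\<lambda>z. p (z, snd w))) \<in> borel \<Otimes>\<^sub>M borel \<rightarrow>\<^sub>M prob_algebra borel"
    apply (rule measurable_bind_prob_space2[where N = borel])
    apply (rule measurable_compose[OF measurable_compose[OF measurable_fst Q'] cm])
    unfolding split_beta'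
    apply (rule measurable_compose[OF _ p])
    apply measurable
    done
  then show ?thesis by (simp add: bar_mdp_def split_beta)
qed

end

theory Submission
  imports Defs
begin

text \<open>
  Everything is read off from one finite decision problem per grid: the states are the grid points and
  the data \<open>P y a y'\<close>, \<open>C i (y, a)\<close> are the cell averages of \<open>p\<close> and of the cost functions, where the
  index \<open>i\<close> runs over the objective and all constraints at once. The Doeblin minorization passes to these
  averages. It makes the average cost of a randomized stationary kernel \<open>\<phi>\<close> on the grid a single vector
  \<open>perf \<phi>\<close> that does not depend on the initial law, namely the vector of constants \<open>g\<close> in the Poisson
  equations \<open>g + h y = v y + (\<Sum>y'. R y y' * h y')\<close>, whose solutions \<open>h\<close> are bounded by a constant that
  depends neither on the grid nor on the policy.

  Two facts carry the proof. The set of vectors \<open>perf \<phi>\<close> contains a compact convex set \<open>achievable\<close>, the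
  convex hull of the vectors of deterministic selectors: the selectors form a compact space
  (Tychonoff) on which \<open>perf\<close> is continuous, and a convex combination of stationary performances is again
  the performance of a stationary kernel, whose weights at each state are dictated by the invariant
  distributions (\<open>convex_perf\<close>). On the other hand no policy, however dependent on the past, does better
  than \<open>achievable\<close>: for each direction \<open>u\<close> the average cost optimality equation of the scalar cost
  \<open>u \<bullet> C\<close> bounds \<open>u \<bullet> z\<close> from below by the performance of a selector, where \<open>z\<close> is any limit point of the
  vector of expected time averages; the separation of points from closed convex sets turns these scalar
  bounds into a point of \<open>achievable\<close> that is componentwise no larger (\<open>averages_near_achievable\<close>).

  Both facts transfer to any model whose costs and transitions agree with the finite data along a map
  \<open>\<sigma>\<close> of its states to the grid (locale \<open>approximation\<close>): its policies are dominated by points of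
  \<open>achievable\<close>, and kernels on the grid, composed with \<open>\<sigma>\<close>, keep their performance. The finite model and its extension to \<open>'x\<close>
  agree with the data exactly; the original model agrees with them up to an error \<open>\<eta>\<close> that is uniform in
  the policies and tends to \<open>0\<close> with the mesh, because the costs and, in total variation, \<open>p\<close> are
  uniformly continuous on the compact space \<open>'x \<times> 'a\<close>. Exactness gives the existence of an optimal
  kernel: minimize one coordinate over a compact subset of \<open>achievable\<close>; the same kernel is optimal in the
  extended model.

  The rest is an exchange of errors. A nearly optimal policy and a Slater policy of the original problem
  are dominated, up to \<open>\<eta>\<close>, by points of \<open>achievable\<close>; mixing a small weight \<open>\<theta>\<close> of the Slater
  point into the other gains \<open>2 * \<epsilon>\<close> in every constraint, of which \<open>\<epsilon>\<close> pays for the tightened bound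
  \<open>k - \<epsilon>\<close> and \<open>\<epsilon> \<ge> \<eta>\<close> for the discretization, while the objective rises only by a
  fraction of \<open>\<kappa>\<close>. So the tightened finite problem has a value close to the original one, and its
  optimal kernels, moved back to the original model, violate the tightened constraints by at most
  \<open>\<eta> \<le> \<epsilon>\<close>.
\<close>

section \<open>Finite Markov chains with a Doeblin minorant\<close>

text \<open>Banach's theorem for the sup seminorm over \<open>Y\<close>: the hypothesis makes \<open>U h\<close> on \<open>Y\<close> depend only on \<open>h\<close> on \<open>Y\<close>.
  The bound on the fixed point is the geometric series of the increments of the iteration from \<open>0\<close>.\<close>

lemma contraction_fixpoint:
  fixes U :: "('y \<Rightarrow> real) \<Rightarrow> 'y \<Rightarrow> real"
  assumes Y: "finite Y" and \<alpha>: "0 \<le> \<alpha>" "\<alpha> < 1"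
    and contr: "\<And>h h' e. (\<And>y. y \<in> Y \<Longrightarrow> \<bar>h y - h' y\<bar> \<le> e) \<Longrightarrow> (\<And>y. y \<in> Y \<Longrightarrow> \<bar>U h y - U h' y\<bar> \<le> \<alpha> * e)"
    and U0: "\<And>y. y \<in> Y \<Longrightarrow> \<bar>U (\<lambda>_. 0) y\<bar> \<le> B"
  obtains h where "\<And>y. y \<in> Y \<Longrightarrow> U h y = h y" "\<And>y. y \<in> Y \<Longrightarrow> \<bar>h y\<bar> \<le> B / (1 - \<alpha>)"
proof -
  define F where "F n = (U ^^ n) (\<lambda>_. 0)" for n
  have step: "\<bar>F (Suc n) y - F n y\<bar> \<le> \<alpha> ^ n * B" if "y \<in> Y" for n y
    using that
  proof (induction n arbitrary: y)
    case 0
    then show ?case using U0 by (simp add: F_def)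
  next
    case (Suc n)
    have "\<bar>U (F (Suc n)) y - U (F n) y\<bar> \<le> \<alpha> * (\<alpha> ^ n * B)"
      by (rule contr[OF Suc.IH Suc.prems])
    then show ?case by (simp add: F_def mult.assoc)
  qed
  define h where "h y = (\<Sum>n. F (Suc n) y - F n y)" for y
  have geo: "summable (\<lambda>n. \<alpha> ^ n * B)"
    using \<alpha> by (intro summable_mult2 summable_geometric) auto
  have sm: "summable (\<lambda>n. F (Suc n) y - F n y)" if "y \<in> Y" for y
    by (rule summable_comparison_test'[OF geo]) (use step[OF that] in simp)
  have lim: "(\<lambda>n. F n y) \<longlonglongrightarrow> h y" if "y \<in> Y" for y
  proof -
    have "(\<lambda>n. \<Sum>i<n. F (Suc i) y - F i y) \<longlonglongrightarrow> h y"
      unfolding h_def by (rule summable_LIMSEQ[OF sm[OF that]])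
    moreover have "(\<Sum>i<n. F (Suc i) y - F i y) = F n y" for n
      by (subst sum_lessThan_telescope) (simp add: F_def)
    ultimately show ?thesis by simp
  qed
  have bound: "\<bar>h y\<bar> \<le> B / (1 - \<alpha>)" if "y \<in> Y" for y
  proof -
    have "\<bar>h y\<bar> \<le> (\<Sum>n. \<alpha> ^ n * B)"
      unfolding h_def real_norm_def[symmetric]
      by (rule norm_suminf_le) (use step[OF that] geo in auto)
    also have "\<dots> = (\<Sum>n. \<alpha> ^ n) * B"
      using \<alpha> by (intro suminf_mult2[symmetric] summable_geometric) auto
    also have "\<dots> = B / (1 - \<alpha>)"
      using \<alpha> by (subst suminf_geometric) auto
    finally show ?thesis .
  qed
  have "U h y = h y" if y: "y \<in> Y" for y
  proof -
    have lim0: "(\<lambda>n. \<Sum>y'\<in>Y. \<bar>F n y' - h y'\<bar>) \<longlonglongrightarrow> (\<Sum>y'\<in>Y. \<bar>h y' - h y'\<bar>)"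
      by (intro tendsto_sum tendsto_rabs tendsto_diff lim tendsto_const)
    have "\<bar>U (F n) y - U h y\<bar> \<le> \<alpha> * (\<Sum>y'\<in>Y. \<bar>F n y' - h y'\<bar>)" for n
      by (rule contr[OF _ y]) (use Y in \<open>auto intro!: member_le_sum[of _ Y "\<lambda>y'. \<bar>F n y' - h y'\<bar>"]\<close>)
    then have le: "\<bar>F (Suc n) y - U h y\<bar> \<le> \<alpha> * (\<Sum>y'\<in>Y. \<bar>F n y' - h y'\<bar>)" for n
      by (simp add: F_def)
    have "(\<lambda>n. F (Suc n) y - U h y) \<longlonglongrightarrow> 0"
    proof (rule Lim_null_comparison)
      show "\<forall>\<^sub>F n in sequentially. norm (F (Suc n) y - U h y) \<le> \<alpha> * (\<Sum>y'\<in>Y. \<bar>F n y' - h y'\<bar>)"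
        using le by simp
      show "(\<lambda>n. \<alpha> * (\<Sum>y'\<in>Y. \<bar>F n y' - h y'\<bar>)) \<longlonglongrightarrow> 0"
        using tendsto_mult_left[OF lim0, of \<alpha>] by simp
    qed
    moreover have "(\<lambda>n. F (Suc n) y - U h y) \<longlonglongrightarrow> h y - U h y"
      by (intro tendsto_diff tendsto_const LIMSEQ_Suc lim y)
    ultimately show ?thesis
      using LIMSEQ_unique by fastforce
  qed
  with bound that show thesis by blast
qed

definition poisson_pair :: "'y set \<Rightarrow> ('y \<Rightarrow> 'y \<Rightarrow> real) \<Rightarrow> ('y \<Rightarrow> real) \<Rightarrow> real \<Rightarrow> ('y \<Rightarrow> real) \<Rightarrow> bool"
  where "poisson_pair Y R v g h \<longleftrightarrow> (\<forall>y\<in>Y. g + h y = v y + (\<Sum>y'\<in>Y. R y y' * h y'))"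

text \<open>The long-run average of \<open>v\<close> along the chain \<open>R\<close>. Taking it as the constant of the Poisson equation gives
  a description without a time parameter; \<open>gain_eqI\<close> below shows that the choice is
  unambiguous, and the error estimates along a process recover it as a limit of time averages.\<close>

definition gain :: "'y set \<Rightarrow> ('y \<Rightarrow> 'y \<Rightarrow> real) \<Rightarrow> ('y \<Rightarrow> real) \<Rightarrow> real"
  where "gain Y R v = (SOME g. \<exists>h. poisson_pair Y R v g h)"

locale doeblin =
  fixes Y :: "'y set" and m :: "'y \<Rightarrow> real" and \<alpha> :: real
  assumes finite_Y: "finite Y"
    and m_nonneg: "\<And>y. y \<in> Y \<Longrightarrow> 0 \<le> m y"
    and m_sum: "(\<Sum>y\<in>Y. m y) = 1"
    and \<alpha>_pos: "0 < \<alpha>" and \<alpha>_less: "\<alpha> < 1"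
begin

definition minorized :: "('y \<Rightarrow> real) \<Rightarrow> bool"
  where "minorized r \<longleftrightarrow> (\<Sum>y\<in>Y. r y) = 1 \<and> (\<forall>y\<in>Y. (1 - \<alpha>) * m y \<le> r y)"

definition doeblin_kernel :: "('y \<Rightarrow> 'y \<Rightarrow> real) \<Rightarrow> bool"
  where "doeblin_kernel R \<longleftrightarrow> (\<forall>y\<in>Y. minorized (R y))"

lemma doeblin_kernelD: "doeblin_kernel R \<Longrightarrow> y \<in> Y \<Longrightarrow> minorized (R y)"
  by (simp add: doeblin_kernel_def)

lemma Y_nonempty: "Y \<noteq> {}"
  using m_sum by auto

lemma minorized_nonneg: "minorized r \<Longrightarrow> y \<in> Y \<Longrightarrow> 0 \<le> r y"
  unfolding minorized_def using m_nonneg \<alpha>_less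
  by (meson diff_ge_0_iff_ge less_le_not_le mult_nonneg_nonneg order_trans)

text \<open>What remains of \<open>r\<close> after removal of the common part \<open>(1 - \<alpha>) * m\<close> is nonnegative and has
  mass \<open>\<alpha>\<close>. This is the contraction that every fixed point argument below rests on.\<close>

lemma residual_sum_le:
  assumes r: "minorized r" and w: "\<And>y. y \<in> Y \<Longrightarrow> \<bar>w y\<bar> \<le> e"
  shows "\<bar>\<Sum>y\<in>Y. (r y - (1 - \<alpha>) * m y) * w y\<bar> \<le> \<alpha> * e"
proof -
  have "\<bar>\<Sum>y\<in>Y. (r y - (1 - \<alpha>) * m y) * w y\<bar> \<le> (\<Sum>y\<in>Y. (r y - (1 - \<alpha>) * m y) * e)"
    using r by (intro sum_abs[THEN order_trans] sum_mono)
      (auto simp: abs_mult minorized_def intro!: mult_left_mono w)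
  also have "\<dots> = \<alpha> * e"
    using r m_sum by (simp add: minorized_def sum_subtractf sum_distrib_right[symmetric]
        sum_distrib_left[symmetric])
  finally show ?thesis .
qed

text \<open>With the residual kernel in place of \<open>R\<close> the equation for \<open>h\<close> has no constant and is a contraction; the
  removed part contributes the same number \<open>(1 - \<alpha>) * (\<Sum>y. m y * h y)\<close> at each state, and this is \<open>g\<close>.\<close>

lemma poisson_exists:
  assumes R: "doeblin_kernel R" and v: "\<forall>y\<in>Y. \<bar>v y\<bar> \<le> B"
  obtains g h where "poisson_pair Y R v g h" "\<And>y. y \<in> Y \<Longrightarrow> \<bar>h y\<bar> \<le> B / (1 - \<alpha>)"
proof -
  define U where "U h y = v y + (\<Sum>y'\<in>Y. (R y y' - (1 - \<alpha>) * m y') * h y')" for h y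
  obtain h where h: "\<And>y. y \<in> Y \<Longrightarrow> U h y = h y" "\<And>y. y \<in> Y \<Longrightarrow> \<bar>h y\<bar> \<le> B / (1 - \<alpha>)"
  proof (rule contraction_fixpoint[where U = U, OF finite_Y less_imp_le[OF \<alpha>_pos] \<alpha>_less])
    fix h h' :: "'y \<Rightarrow> real" and e y
    assume hh: "\<And>y. y \<in> Y \<Longrightarrow> \<bar>h y - h' y\<bar> \<le> e" and y: "y \<in> Y"
    have "U h y - U h' y = (\<Sum>y'\<in>Y. (R y y' - (1 - \<alpha>) * m y') * (h y' - h' y'))"
      by (simp add: U_def sum_subtractf right_diff_distrib)
    then show "\<bar>U h y - U h' y\<bar> \<le> \<alpha> * e"
      using residual_sum_le[OF doeblin_kernelD[OF R y] hh] by simp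
  qed (use v \<alpha>_pos in \<open>auto simp: U_def\<close>)
  have "poisson_pair Y R v ((1 - \<alpha>) * (\<Sum>y\<in>Y. m y * h y)) h"
    unfolding poisson_pair_def
  proof
    fix y assume "y \<in> Y"
    from h(1)[OF this] show "(1 - \<alpha>) * (\<Sum>y\<in>Y. m y * h y) + h y = v y + (\<Sum>y'\<in>Y. R y y' * h y')"
      by (simp add: U_def left_diff_distrib sum_subtractf sum_distrib_left mult.assoc)
  qed
  with h(2) that show thesis by blast
qed

text \<open>A maximum principle: at a state where \<open>h - h'\<close> is largest, averaging over the next state cannot
  increase the difference, so the one-step inequalities there compare the constants directly.\<close>

lemma gain_compare:
  assumes R: "doeblin_kernel R"
    and sub: "\<And>y. y \<in> Y \<Longrightarrow> g + h y \<le> v y + (\<Sum>y'\<in>Y. R y y' * h y') + e"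
    and super: "\<And>y. y \<in> Y \<Longrightarrow> g' + h' y \<ge> v y + (\<Sum>y'\<in>Y. R y y' * h' y')"
  shows "g \<le> g' + e"
proof -
  define w where "w y = h y - h' y" for y
  obtain y where y: "y \<in> Y" "\<And>y'. y' \<in> Y \<Longrightarrow> w y' \<le> w y"
    using finite_Y Y_nonempty Max_in[of "w ` Y"] Max_ge[of "w ` Y"]
    by (smt (verit, ccfv_threshold) finite_imageI image_iff image_is_empty)
  have "(\<Sum>y'\<in>Y. R y y' * w y') \<le> (\<Sum>y'\<in>Y. R y y' * w y)"
    using y R by (intro sum_mono mult_left_mono) (auto intro: minorized_nonneg doeblin_kernelD)
  also have "\<dots> = w y"
    using doeblin_kernelD[OF R y(1)] by (simp add: sum_distrib_right[symmetric] minorized_def)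
  finally have "(\<Sum>y'\<in>Y. R y y' * h y') - (\<Sum>y'\<in>Y. R y y' * h' y') \<le> h y - h' y"
    by (simp add: w_def right_diff_distrib sum_subtractf)
  with sub[OF y(1)] super[OF y(1)] show ?thesis by linarith
qed

lemma gain_eqI:
  assumes R: "doeblin_kernel R" and "poisson_pair Y R v g h"
  shows "gain Y R v = g"
proof -
  have "\<exists>h. poisson_pair Y R v (gain Y R v) h"
    unfolding gain_def by (rule someI2_ex) (use assms in blast)+
  then obtain h' where h': "poisson_pair Y R v (gain Y R v) h'" ..
  have "gain Y R v \<le> g + 0"
    by (rule gain_compare[OF R, where v = v and h = h' and h' = h])
      (use h' assms(2) in \<open>auto simp: poisson_pair_def\<close>)
  moreover have "g \<le> gain Y R v + 0"
    by (rule gain_compare[OF R, where v = v and h = h and h' = h'])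
      (use h' assms(2) in \<open>auto simp: poisson_pair_def\<close>)
  ultimately show ?thesis by simp
qed

lemma gain_poisson:
  assumes R: "doeblin_kernel R" and v: "\<forall>y\<in>Y. \<bar>v y\<bar> \<le> B"
  obtains h where "poisson_pair Y R v (gain Y R v) h" "\<And>y. y \<in> Y \<Longrightarrow> \<bar>h y\<bar> \<le> B / (1 - \<alpha>)"
proof -
  obtain g h where gh: "poisson_pair Y R v g h" "\<And>y. y \<in> Y \<Longrightarrow> \<bar>h y\<bar> \<le> B / (1 - \<alpha>)"
    using poisson_exists[OF assms] by blast
  have "gain Y R v = g" by (rule gain_eqI[OF R gh(1)])
  with gh that show thesis by blast
qed

lemma gain_poisson':
  assumes R: "doeblin_kernel R"
  obtains h where "poisson_pair Y R v (gain Y R v) h"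
proof -
  have "\<forall>y\<in>Y. \<bar>v y\<bar> \<le> (\<Sum>y\<in>Y. \<bar>v y\<bar>)"
    using member_le_sum[of _ Y "\<lambda>y. \<bar>v y\<bar>"] finite_Y by simp
  from gain_poisson[OF R this] show thesis using that by blast
qed

lemma gain_sum:
  assumes R: "doeblin_kernel R" and I: "finite I"
  shows "gain Y R (\<lambda>y. \<Sum>i\<in>I. a i * v i y) = (\<Sum>i\<in>I. a i * gain Y R (v i))"
proof -
  have "\<forall>i. \<exists>h. poisson_pair Y R (v i) (gain Y R (v i)) h"
    using gain_poisson'[OF R] by metis
  then obtain h where h: "\<And>i. poisson_pair Y R (v i) (gain Y R (v i)) (h i)" by metis
  show ?thesis
  proof (rule gain_eqI[OF R])
    show "poisson_pair Y R (\<lambda>y. \<Sum>i\<in>I. a i * v i y) (\<Sum>i\<in>I. a i * gain Y R (v i)) (\<lambda>y. \<Sum>i\<in>I. a i * h i y)"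
      unfolding poisson_pair_def
    proof
      fix y assume y: "y \<in> Y"
      have "(\<Sum>i\<in>I. a i * gain Y R (v i)) + (\<Sum>i\<in>I. a i * h i y) = (\<Sum>i\<in>I. a i * (gain Y R (v i) + h i y))"
        by (simp add: sum.distrib distrib_left)
      also have "\<dots> = (\<Sum>i\<in>I. a i * (v i y + (\<Sum>y'\<in>Y. R y y' * h i y')))"
        using h y by (simp add: poisson_pair_def)
      also have "\<dots> = (\<Sum>i\<in>I. a i * v i y) + (\<Sum>y'\<in>Y. R y y' * (\<Sum>i\<in>I. a i * h i y'))"
        unfolding distrib_left sum.distrib sum_distrib_left
        by (subst sum.swap) (simp add: mult_ac)
      finally show "(\<Sum>i\<in>I. a i * gain Y R (v i)) + (\<Sum>i\<in>I. a i * h i y)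
        = (\<Sum>i\<in>I. a i * v i y) + (\<Sum>y'\<in>Y. R y y' * (\<Sum>i\<in>I. a i * h i y'))" .
    qed
  qed
qed

lemma gain_nonneg:
  assumes R: "doeblin_kernel R" and v: "\<forall>y\<in>Y. 0 \<le> v y"
  shows "0 \<le> gain Y R v"
proof -
  obtain h where h: "poisson_pair Y R v (gain Y R v) h" using gain_poisson'[OF R] .
  have "0 \<le> gain Y R v + 0"
    by (rule gain_compare[OF R, where h = "\<lambda>_. 0" and v = v and h' = h]) (use v h in \<open>auto simp: poisson_pair_def\<close>)
  then show ?thesis by simp
qed

lemma gain_const: "doeblin_kernel R \<Longrightarrow> gain Y R (\<lambda>_. b) = b"
  by (rule gain_eqI[where h = "\<lambda>_. 0"]) (auto simp: poisson_pair_def)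

text \<open>Averaging over the next state does not change the gain: if \<open>h\<close> solves the Poisson equation for \<open>v\<close>,
  then \<open>R h\<close> solves it for \<open>R v\<close> with the same constant. This is the invariance of the functional \<open>gain\<close>.\<close>

lemma gain_shift:
  assumes R: "doeblin_kernel R"
  shows "gain Y R (\<lambda>y. \<Sum>y'\<in>Y. R y y' * v y') = gain Y R v"
proof -
  obtain h where h: "poisson_pair Y R v (gain Y R v) h" using gain_poisson'[OF R] .
  show ?thesis
  proof (rule gain_eqI[OF R, where h = "\<lambda>y. \<Sum>y'\<in>Y. R y y' * h y'"])
    show "poisson_pair Y R (\<lambda>y. \<Sum>y'\<in>Y. R y y' * v y') (gain Y R v) (\<lambda>y. \<Sum>y'\<in>Y. R y y' * h y')"
      unfolding poisson_pair_def
    proof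
      fix y assume y: "y \<in> Y"
      have "(\<Sum>y'\<in>Y. R y y' * v y') + (\<Sum>y'\<in>Y. R y y' * (\<Sum>y''\<in>Y. R y' y'' * h y''))
        = (\<Sum>y'\<in>Y. R y y' * (gain Y R v + h y'))"
        using h by (simp add: poisson_pair_def distrib_left sum.distrib[symmetric])
      also have "\<dots> = gain Y R v + (\<Sum>y'\<in>Y. R y y' * h y')"
        using doeblin_kernelD[OF R y] by (simp add: distrib_left sum.distrib sum_distrib_right[symmetric] minorized_def)
      finally show "gain Y R v + (\<Sum>y'\<in>Y. R y y' * h y')
        = (\<Sum>y'\<in>Y. R y y' * v y') + (\<Sum>y'\<in>Y. R y y' * (\<Sum>y''\<in>Y. R y' y'' * h y''))" by simp
    qed
  qed
qed

definition invariant :: "('y \<Rightarrow> 'y \<Rightarrow> real) \<Rightarrow> ('y \<Rightarrow> real) \<Rightarrow> bool"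
  where "invariant R \<rho> \<longleftrightarrow> (\<forall>y\<in>Y. 0 \<le> \<rho> y) \<and> (\<Sum>y\<in>Y. \<rho> y) = 1 \<and>
    (\<forall>y'\<in>Y. (\<Sum>y\<in>Y. \<rho> y * R y y') = \<rho> y')"

text \<open>\<open>gain\<close> is a positive normalized linear functional of the cost, hence integration
  against a distribution \<open>\<rho>\<close>, and \<open>gain_shift\<close> says that \<open>\<rho>\<close> is invariant.\<close>

lemma invariant_exists:
  assumes R: "doeblin_kernel R"
  obtains \<rho> where "invariant R \<rho>"
proof -
  define \<rho> where "\<rho> z = gain Y R (\<lambda>y. if y = z then 1 else 0)" for z
  have lin: "gain Y R v = (\<Sum>z\<in>Y. \<rho> z * v z)" for v
  proof -
    obtain h where h: "poisson_pair Y R v (gain Y R v) h" using gain_poisson'[OF R] .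
    have "gain Y R (\<lambda>y. \<Sum>z\<in>Y. v z * (if y = z then 1 else 0)) = (\<Sum>z\<in>Y. v z * \<rho> z)"
      unfolding \<rho>_def by (rule gain_sum[OF R finite_Y])
    moreover have "gain Y R (\<lambda>y. \<Sum>z\<in>Y. v z * (if y = z then 1 else 0)) = gain Y R v"
      by (rule gain_eqI[OF R, where h = h])
        (use h finite_Y in \<open>auto simp: poisson_pair_def if_distrib cong: if_cong\<close>)
    ultimately show ?thesis by (simp add: mult.commute)
  qed
  have "invariant R \<rho>"
    unfolding invariant_def
  proof (intro conjI ballI)
    show "0 \<le> \<rho> z" for z unfolding \<rho>_def by (rule gain_nonneg[OF R]) auto
    show "sum \<rho> Y = 1" using lin[of "\<lambda>_. 1"] gain_const[OF R, of "1"] by simp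
    fix z assume z: "z \<in> Y"
    have "(\<Sum>y\<in>Y. \<rho> y * R y z) = gain Y R (\<lambda>y. \<Sum>y'\<in>Y. R y y' * (if y' = z then 1 else 0))"
      unfolding lin using z finite_Y by (simp add: if_distrib cong: if_cong)
    also have "\<dots> = \<rho> z"
      unfolding \<rho>_def by (rule gain_shift[OF R])
    finally show "(\<Sum>y\<in>Y. \<rho> y * R y z) = \<rho> z" .
  qed
  then show thesis by (rule that)
qed

lemma gain_invariant:
  assumes R: "doeblin_kernel R" and \<rho>: "invariant R \<rho>"
  shows "gain Y R v = (\<Sum>y\<in>Y. \<rho> y * v y)"
proof -
  obtain h where h: "poisson_pair Y R v (gain Y R v) h" using gain_poisson'[OF R] .
  have "(\<Sum>y\<in>Y. \<rho> y * (gain Y R v + h y)) = (\<Sum>y\<in>Y. \<rho> y * v y) + (\<Sum>y\<in>Y. \<Sum>y'\<in>Y. \<rho> y * R y y' * h y')"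
    using h by (simp add: poisson_pair_def distrib_left sum.distrib sum_distrib_left mult.assoc)
  also have "(\<Sum>y\<in>Y. \<Sum>y'\<in>Y. \<rho> y * R y y' * h y') = (\<Sum>y'\<in>Y. \<rho> y' * h y')"
    using \<rho> by (subst sum.swap) (simp add: invariant_def sum_distrib_right[symmetric])
  finally show ?thesis
    using \<rho> by (simp add: distrib_left sum.distrib sum_distrib_right[symmetric] invariant_def)
qed

end

section \<open>Expected averages along a controlled process\<close>

lemma integral_bind_bounded:
  fixes f :: "'b \<Rightarrow> real"
  assumes M: "M \<in> space (prob_algebra L)" and K: "K \<in> L \<rightarrow>\<^sub>M prob_algebra N"
    and f: "f \<in> borel_measurable N" and bound: "\<And>x. x \<in> space N \<Longrightarrow> \<bar>f x\<bar> \<le> B"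
  shows "integral\<^sup>L (M \<bind> K) f = (\<integral>x. integral\<^sup>L (K x) f \<partial>M)"
proof (rule integral_bind[where B' = 1 and B = B, OF f bound])
  have sets: "sets M = sets L" and "prob_space M"
    using M by (auto simp: space_prob_algebra)
  then interpret prob_space M by simp
  show "K \<in> M \<rightarrow>\<^sub>M subprob_algebra N"
    using measurable_prob_algebraD[OF K] by (simp cong: measurable_cong_sets add: sets)
  show "finite_measure M" by unfold_locales
  show "AE x in M. emeasure (K x) (space (K x)) \<le> ennreal 1"
  proof (rule AE_I2)
    fix x assume "x \<in> space M"
    then have "x \<in> space L" using sets_eq_imp_space_eq[OF sets] by simp
    then have "prob_space (K x)"
      using measurable_space[OF K] by (simp add: space_prob_algebra)
    then show "emeasure (K x) (space (K x)) \<le> ennreal 1"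
      by (simp add: prob_space.emeasure_space_1)
  qed
qed

lemma integrable_prob_algebra:
  fixes f :: "'b \<Rightarrow> real"
  assumes M: "M \<in> space (prob_algebra N)"
    and f: "f \<in> borel_measurable N" and bound: "\<And>x. x \<in> space N \<Longrightarrow> \<bar>f x\<bar> \<le> B"
  shows "integrable M f"
proof -
  have s: "sets M = sets N" and "prob_space M" using M by (auto simp: space_prob_algebra)
  then interpret prob_space M by simp
  show ?thesis
    using f bound by (intro integrable_const_bound[where B = B])
      (auto simp: sets_eq_imp_space_eq[OF s] measurable_cong_sets[OF s refl])
qed

lemma integral_prob_algebra_bound:
  fixes f :: "'b \<Rightarrow> real"
  assumes M: "M \<in> space (prob_algebra N)"
    and f: "f \<in> borel_measurable N" and bound: "\<And>x. x \<in> space N \<Longrightarrow> \<bar>f x\<bar> \<le> B"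
  shows "\<bar>integral\<^sup>L M f\<bar> \<le> B"
proof -
  have s: "sets M = sets N" and "prob_space M" using M by (auto simp: space_prob_algebra)
  then interpret prob_space M by simp
  have "\<bar>integral\<^sup>L M f\<bar> \<le> (\<integral>x. \<bar>f x\<bar> \<partial>M)" by (rule integral_abs_bound)
  also have "\<dots> \<le> B"
    using integrable_prob_algebra[OF assms] bound
    by (intro integral_le_const) (auto simp: sets_eq_imp_space_eq[OF s])
  finally show ?thesis .
qed

text \<open>The integral of a section against a kernel is the integral of one fixed function against the law of the
  pair \<open>(z, x)\<close>, which depends measurably on \<open>z\<close>.\<close>

lemma integral_prob_algebra_measurable:
  fixes f :: "'z \<Rightarrow> 'b \<Rightarrow> real"
  assumes K: "K \<in> L \<rightarrow>\<^sub>M prob_algebra N" and f: "(\<lambda>(z, x). f z x) \<in> borel_measurable (L \<Otimes>\<^sub>M N)"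
  shows "(\<lambda>z. integral\<^sup>L (K z) (f z)) \<in> borel_measurable L"
proof -
  have f': "(\<lambda>w. f (fst w) (snd w)) \<in> borel_measurable (L \<Otimes>\<^sub>M N)"
    using f by (simp add: split_beta')
  have "(\<lambda>z. distr (K z) (L \<Otimes>\<^sub>M N) (Pair z)) \<in> L \<rightarrow>\<^sub>M prob_algebra (L \<Otimes>\<^sub>M N)"
    by (rule measurable_distr_prob_space2[OF K]) simp
  from measurable_compose[OF measurable_prob_algebraD[OF this] integral_measurable_subprob_algebra[OF f']]
  have "(\<lambda>z. \<integral>w. f (fst w) (snd w) \<partial>distr (K z) (L \<Otimes>\<^sub>M N) (Pair z)) \<in> borel_measurable L" .
  also have "?this \<longleftrightarrow> ?thesis"
  proof (rule measurable_cong)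
    fix z assume z: "z \<in> space L"
    then have "K z \<in> space (prob_algebra N)" by (rule measurable_space[OF K])
    then have s: "sets (K z) = sets N" by (simp add: space_prob_algebra)
    have "Pair z \<in> K z \<rightarrow>\<^sub>M L \<Otimes>\<^sub>M N"
      using z by (simp add: measurable_cong_sets[OF s refl])
    then show "(\<integral>w. f (fst w) (snd w) \<partial>distr (K z) (L \<Otimes>\<^sub>M N) (Pair z)) = integral\<^sup>L (K z) (f z)"
      by (subst integral_distr[OF _ f']) auto
  qed
  finally show ?thesis .
qed

locale controlled_process =
  fixes M :: "('x, 'a::topological_space) mdp" and \<pi> :: "('x, 'a) policy"
  assumes init: "initial M \<in> space (prob_algebra (states M))"
    and trans: "trans M \<in> states M \<Otimes>\<^sub>M borel \<rightarrow>\<^sub>M prob_algebra (states M)"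
    and pol: "\<pi> \<in> policies (states M)"
begin

abbreviation N :: "('x \<times> 'a) measure" where "N \<equiv> states M \<Otimes>\<^sub>M borel"

abbreviation hist :: "nat \<Rightarrow> (nat \<Rightarrow> 'x \<times> 'a) measure" where "hist t \<equiv> \<Pi>\<^sub>M i\<in>{0..<t}. N"

definition law :: "(nat \<Rightarrow> 'x \<times> 'a) measure" where "law = process_law M \<pi>"

definition next_state :: "nat \<Rightarrow> (nat \<Rightarrow> 'x \<times> 'a) \<Rightarrow> 'x measure"
  where "next_state t h = (case t of 0 \<Rightarrow> initial M | Suc s \<Rightarrow> trans M (h s))"

sublocale IT: Ionescu_Tulcea "stage_kernel M \<pi>" "\<lambda>_. N"
  by (rule Ionescu_Tulcea_stage_kernel[OF init trans pol])

lemma law_eq: "law = IT.PF.lim"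
  by (simp add: law_def process_law_def)

lemma sets_law [measurable_cong]: "sets law = sets (\<Pi>\<^sub>M i\<in>UNIV. N)"
  unfolding law_eq by simp

text \<open>The law of the whole process is constructed as a projective limit; its restriction to the times before \<open>t\<close>
  is the iterated composition of the stage kernels, which is the form suited to computations.\<close>

lemma prefix_law: "distr law (hist t) (\<lambda>\<omega>. restrict \<omega> {0..<t}) = IT.C 0 t (\<lambda>_. undefined)"
proof -
  have up: "IT.up_to {0..<t} = t"
    by (metis IT.up_to_iff_Ico dual_order.antisym finite_atLeastLessThan ivl_subset le_eq_less_or_eq
        le_zero_eq not_less order_refl zero_le)
  have u: "(\<lambda>_. undefined) \<in> space (\<Pi>\<^sub>M i\<in>{0..<0::nat}. N)" by (simp add: space_PiM)
  have "distr law (hist t) (\<lambda>\<omega>. restrict \<omega> {0..<t}) = IT.CI {0..<t}"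
    unfolding law_eq by (rule IT.distr_lim) simp
  also have "\<dots> = IT.C 0 t (\<lambda>_. undefined)"
    unfolding IT.CI_def up using IT.distr_C[of t t, OF _ u] by simp
  finally show ?thesis .
qed

lemma prefix_law_prob: "IT.C 0 t (\<lambda>_. undefined) \<in> space (prob_algebra (hist t))"
proof -
  have "(\<lambda>_. undefined) \<in> space (\<Pi>\<^sub>M i\<in>{0..<0::nat}. N)" by (simp add: space_PiM)
  from IT.prob_space_C[OF this, of t] IT.sets_C[OF this, of t] show ?thesis
    by (simp add: space_prob_algebra)
qed

lemma prefix_measurable: "(\<lambda>\<omega>. restrict \<omega> {0..<t}) \<in> law \<rightarrow>\<^sub>M hist t"
  by (simp add: measurable_cong_sets[OF sets_law refl] measurable_restrict_subset)

lemma coordinate_measurable: "(\<lambda>\<omega>. \<omega> t) \<in> law \<rightarrow>\<^sub>M N"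
  by (simp add: measurable_cong_sets[OF sets_law refl])

lemma prob_space_law: "prob_space law"
proof (rule prob_space_distrD[OF prefix_measurable[of 0]])
  show "prob_space (distr law (hist 0) (\<lambda>\<omega>. restrict \<omega> {0..<0}))"
    unfolding prefix_law using prefix_law_prob[of 0] by (simp add: space_prob_algebra del: IT.C.simps)
qed

sublocale law: prob_space law by (rule prob_space_law)

lemma integrable_coordinate:
  fixes f :: "'x \<times> 'a \<Rightarrow> real"
  assumes "f \<in> borel_measurable N" "\<And>z. z \<in> space N \<Longrightarrow> \<bar>f z\<bar> \<le> B"
  shows "integrable law (\<lambda>\<omega>. f (\<omega> t))"
  using measurable_compose[OF coordinate_measurable assms(1)]
    measurable_space[OF coordinate_measurable, of _ t] assms(2)
  by (intro law.integrable_const_bound[where B = B]) auto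

lemma expectation_coordinate:
  fixes f :: "'x \<times> 'a \<Rightarrow> real"
  assumes f: "f \<in> borel_measurable N" and bound: "\<And>z. z \<in> space N \<Longrightarrow> \<bar>f z\<bar> \<le> B"
  shows "(\<integral>\<omega>. f (\<omega> t) \<partial>law) = (\<integral>\<omega>. integral\<^sup>L (stage_kernel M \<pi> t (restrict \<omega> {0..<t})) f \<partial>law)"
proof -
  note K = stage_kernel_measurable[OF init trans pol]
  let ?C = "\<lambda>t. IT.C 0 t (\<lambda>_. undefined)"
  have ft: "(\<lambda>h. f (h t)) \<in> borel_measurable (hist (Suc t))"
    by (rule measurable_compose[OF measurable_component_singleton[of t "{0..<Suc t}" "\<lambda>_. N"] f]) simp
  have ft_bound: "\<bar>f (h t)\<bar> \<le> B" if "h \<in> space (hist (Suc t))" for h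
    using that by (auto simp: space_PiM intro!: bound)
  have upd: "fun_upd h t \<in> N \<rightarrow>\<^sub>M hist (Suc t)" if "h \<in> space (hist t)" for h
    using that by (intro measurable_fun_upd[where J = "{0..<t}"]) auto
  have eP: "IT.eP t \<in> hist t \<rightarrow>\<^sub>M prob_algebra (hist (Suc t))"
    by (rule measurable_prob_algebraI[OF IT.prob_space_eP IT.measurable_eP])
  have "(\<integral>\<omega>. f (\<omega> t) \<partial>law) = (\<integral>\<omega>. f ((restrict \<omega> {0..<Suc t}) t) \<partial>law)" by simp
  also have "\<dots> = (\<integral>h. f (h t) \<partial>distr law (hist (Suc t)) (\<lambda>\<omega>. restrict \<omega> {0..<Suc t}))"
    by (rule integral_distr[OF prefix_measurable ft, symmetric])
  also have "\<dots> = (\<integral>h. f (h t) \<partial>(?C t \<bind> IT.eP t))"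
    unfolding prefix_law by simp
  also have "\<dots> = (\<integral>h. (\<integral>h'. f (h' t) \<partial>IT.eP t h) \<partial>?C t)"
    by (rule integral_bind_bounded[where f = "\<lambda>h. f (h t)" and N = "hist (Suc t)", OF prefix_law_prob eP ft])
      (rule ft_bound)
  also have "\<dots> = (\<integral>h. integral\<^sup>L (stage_kernel M \<pi> t h) f \<partial>?C t)"
  proof (rule Bochner_Integration.integral_cong[OF refl])
    fix h assume "h \<in> space (?C t)"
    then have h: "h \<in> space (hist t)"
      using IT.space_C[of "\<lambda>_. undefined" 0 t] by (simp add: space_PiM)
    then have s: "sets (stage_kernel M \<pi> t h) = sets N" by (rule IT.sets_P)
    show "(\<integral>h'. f (h' t) \<partial>IT.eP t h) = integral\<^sup>L (stage_kernel M \<pi> t h) f"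
      unfolding IT.eP_def
      by (subst integral_distr[OF _ ft]) (use upd[OF h] in \<open>auto simp: measurable_cong_sets[OF s refl]\<close>)
  qed
  also have "\<dots> = (\<integral>\<omega>. integral\<^sup>L (stage_kernel M \<pi> t (restrict \<omega> {0..<t})) f \<partial>law)"
    unfolding prefix_law[symmetric]
    by (rule integral_distr[OF prefix_measurable])
      (rule measurable_compose[OF measurable_prob_algebraD[OF K] integral_measurable_subprob_algebra[OF f]])
  finally show ?thesis .
qed

lemma next_state_prob:
  assumes "h \<in> space (hist t)" shows "next_state t h \<in> space (prob_algebra (states M))"
proof (cases t)
  case (Suc s)
  have "h s \<in> space N" using assms unfolding Suc space_PiM by (rule PiE_mem) simp
  from measurable_space[OF trans this] show ?thesis by (simp add: Suc next_state_def)
qed (simp add: next_state_def init)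

lemma integral_stage_kernel:
  fixes f :: "'x \<times> 'a \<Rightarrow> real"
  assumes f: "f \<in> borel_measurable N" and bound: "\<And>z. z \<in> space N \<Longrightarrow> \<bar>f z\<bar> \<le> B"
    and h: "h \<in> space (hist t)"
  shows "integral\<^sup>L (stage_kernel M \<pi> t h) f = (\<integral>x. (\<integral>a. f (x, a) \<partial>\<pi> t (h, x)) \<partial>next_state t h)"
proof -
  have pol': "\<pi> t \<in> hist t \<Otimes>\<^sub>M states M \<rightarrow>\<^sub>M prob_algebra borel"
    using pol by (auto simp: policies_def hist_space_def)
  have act: "(\<lambda>x. \<pi> t (h, x)) \<in> states M \<rightarrow>\<^sub>M prob_algebra borel"
    by (rule measurable_compose[OF measurable_Pair1'[OF h] pol'])
  have ret: "(\<lambda>a. return N (x, a)) \<in> borel \<rightarrow>\<^sub>M prob_algebra N" if "x \<in> space (states M)" for x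
    by (rule measurable_compose[OF measurable_Pair1'[OF that] measurable_return_prob_space])
  have pair: "(\<lambda>x. \<pi> t (h, x) \<bind> (\<lambda>a. return N (x, a))) \<in> states M \<rightarrow>\<^sub>M prob_algebra N"
    by (rule measurable_bind_prob_space2[OF act])
      (simp add: split_beta' measurable_return_prob_space)
  note ns = next_state_prob[OF h]
  then have s: "sets (next_state t h) = sets (states M)" by (simp add: space_prob_algebra)
  have "integral\<^sup>L (stage_kernel M \<pi> t h) f
      = (\<integral>x. integral\<^sup>L (\<pi> t (h, x) \<bind> (\<lambda>a. return N (x, a))) f \<partial>next_state t h)"
    unfolding stage_kernel_def next_state_def[symmetric]
    by (rule integral_bind_bounded[OF ns pair f bound])
  also have "\<dots> = (\<integral>x. (\<integral>a. f (x, a) \<partial>\<pi> t (h, x)) \<partial>next_state t h)"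
  proof (rule Bochner_Integration.integral_cong[OF refl])
    fix x assume "x \<in> space (next_state t h)"
    then have x: "x \<in> space (states M)" using sets_eq_imp_space_eq[OF s] by simp
    have "integral\<^sup>L (\<pi> t (h, x) \<bind> (\<lambda>a. return N (x, a))) f = (\<integral>a. integral\<^sup>L (return N (x, a)) f \<partial>\<pi> t (h, x))"
      by (rule integral_bind_bounded[OF measurable_space[OF act x] ret[OF x] f bound])
    also have "\<dots> = (\<integral>a. f (x, a) \<partial>\<pi> t (h, x))"
      using x f by (intro Bochner_Integration.integral_cong refl integral_return) (auto simp: space_pair_measure)
    finally show "integral\<^sup>L (\<pi> t (h, x) \<bind> (\<lambda>a. return N (x, a))) f = (\<integral>a. f (x, a) \<partial>\<pi> t (h, x))" .
  qed
  finally show ?thesis .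
qed

text \<open>Given the past, the next state has law \<open>trans\<close> at the current pair, whatever the policy; integrating out the action
  that the policy then chooses leaves a function of the state unchanged.\<close>

lemma expectation_next_state:
  fixes f :: "'x \<Rightarrow> real"
  assumes f: "f \<in> borel_measurable (states M)" and bound: "\<And>x. x \<in> space (states M) \<Longrightarrow> \<bar>f x\<bar> \<le> B"
  shows "(\<integral>\<omega>. f (fst (\<omega> (Suc t))) \<partial>law) = (\<integral>\<omega>. integral\<^sup>L (trans M (\<omega> t)) f \<partial>law)"
proof -
  have fm: "(\<lambda>z. f (fst z)) \<in> borel_measurable N"
    by (rule measurable_compose[OF measurable_fst f])
  have fb: "\<bar>f (fst z)\<bar> \<le> B" if "z \<in> space N" for z
    using that by (auto simp: space_pair_measure intro: bound)
  have pol': "\<pi> (Suc t) \<in> hist (Suc t) \<Otimes>\<^sub>M states M \<rightarrow>\<^sub>M prob_algebra borel"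
    using pol by (auto simp: policies_def hist_space_def)
  have "(\<integral>\<omega>. f (fst (\<omega> (Suc t))) \<partial>law)
      = (\<integral>\<omega>. (\<integral>z. f (fst z) \<partial>stage_kernel M \<pi> (Suc t) (restrict \<omega> {0..<Suc t})) \<partial>law)"
    by (rule expectation_coordinate[where f = "\<lambda>z. f (fst z)", OF fm fb])
  also have "\<dots> = (\<integral>\<omega>. integral\<^sup>L (trans M (\<omega> t)) f \<partial>law)"
  proof (rule Bochner_Integration.integral_cong[OF refl])
    fix \<omega> assume "\<omega> \<in> space law"
    then have h: "restrict \<omega> {0..<Suc t} \<in> space (hist (Suc t))"
      by (rule measurable_space[OF prefix_measurable])
    have "integral\<^sup>L (stage_kernel M \<pi> (Suc t) (restrict \<omega> {0..<Suc t})) (\<lambda>z. f (fst z))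
      = (\<integral>x. (\<integral>a. f x \<partial>\<pi> (Suc t) (restrict \<omega> {0..<Suc t}, x)) \<partial>next_state (Suc t) (restrict \<omega> {0..<Suc t}))"
      by (subst integral_stage_kernel[OF fm fb h]) auto
    also have "\<dots> = (\<integral>x. f x \<partial>next_state (Suc t) (restrict \<omega> {0..<Suc t}))"
    proof (rule Bochner_Integration.integral_cong[OF refl])
      fix x assume x: "x \<in> space (next_state (Suc t) (restrict \<omega> {0..<Suc t}))"
      have "sets (next_state (Suc t) (restrict \<omega> {0..<Suc t})) = sets (states M)"
        using next_state_prob[OF h] by (simp add: space_prob_algebra)
      with x have "x \<in> space (states M)" using sets_eq_imp_space_eq by blast
      with h have "(restrict \<omega> {0..<Suc t}, x) \<in> space (hist (Suc t) \<Otimes>\<^sub>M states M)"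
        by (simp add: space_pair_measure)
      from measurable_space[OF pol' this]
      have "prob_space (\<pi> (Suc t) (restrict \<omega> {0..<Suc t}, x))"
        by (simp add: space_prob_algebra)
      then show "(\<integral>a. f x \<partial>\<pi> (Suc t) (restrict \<omega> {0..<Suc t}, x)) = f x"
        by (simp add: prob_space.prob_space)
    qed
    also have "next_state (Suc t) (restrict \<omega> {0..<Suc t}) = trans M (\<omega> t)"
      by (simp add: next_state_def)
    finally show "integral\<^sup>L (stage_kernel M \<pi> (Suc t) (restrict \<omega> {0..<Suc t})) (\<lambda>z. f (fst z))
      = integral\<^sup>L (trans M (\<omega> t)) f" .
  qed
  finally show ?thesis .
qed

text \<open>Given the past and the current state, the action is drawn from \<open>\<phi>\<close>; so the cost and its average over \<open>\<phi>\<close>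
  have the same expectation at each time.\<close>

lemma expectation_stationary:
  fixes f :: "'x \<times> 'a \<Rightarrow> real"
  assumes \<pi>: "\<pi> = stationary \<phi>" and \<phi>: "\<phi> \<in> stationary_kernels (states M)"
    and f: "f \<in> borel_measurable N" and bound: "\<And>z. z \<in> space N \<Longrightarrow> \<bar>f z\<bar> \<le> B"
  shows "(\<integral>\<omega>. f (\<omega> t) \<partial>law) = (\<integral>\<omega>. (\<integral>a. f (fst (\<omega> t), a) \<partial>\<phi> (fst (\<omega> t))) \<partial>law)"
proof -
  have \<phi>m: "\<phi> \<in> states M \<rightarrow>\<^sub>M prob_algebra borel"
    using \<phi> by (simp add: stationary_kernels_def)
  define F where "F x = (\<integral>a. f (x, a) \<partial>\<phi> x)" for x
  have Fm: "F \<in> borel_measurable (states M)"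
    unfolding F_def by (rule integral_prob_algebra_measurable[OF \<phi>m]) (use f in simp)
  have Fb: "\<bar>F x\<bar> \<le> B" if x: "x \<in> space (states M)" for x
    unfolding F_def
    by (rule integral_prob_algebra_bound[OF measurable_space[OF \<phi>m x]])
      (use f x bound in \<open>auto simp: space_pair_measure\<close>)
  have F1: "(\<lambda>z. F (fst z)) \<in> borel_measurable N"
    by (rule measurable_compose[OF measurable_fst Fm])
  have F2: "\<bar>F (fst z)\<bar> \<le> B" if "z \<in> space N" for z
    using that by (auto simp: space_pair_measure intro: Fb)
  have "(\<integral>\<omega>. f (\<omega> t) \<partial>law) = (\<integral>\<omega>. integral\<^sup>L (stage_kernel M \<pi> t (restrict \<omega> {0..<t})) f \<partial>law)"
    by (rule expectation_coordinate[OF f bound])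
  also have "\<dots> = (\<integral>\<omega>. (\<integral>z. F (fst z) \<partial>stage_kernel M \<pi> t (restrict \<omega> {0..<t})) \<partial>law)"
  proof (rule Bochner_Integration.integral_cong[OF refl])
    fix \<omega> assume "\<omega> \<in> space law"
    then have h: "restrict \<omega> {0..<t} \<in> space (hist t)"
      by (rule measurable_space[OF prefix_measurable])
    let ?ns = "next_state t (restrict \<omega> {0..<t})"
    have "(\<integral>x. (\<integral>a. F x \<partial>\<phi> x) \<partial>?ns) = (\<integral>x. F x \<partial>?ns)"
    proof (rule Bochner_Integration.integral_cong[OF refl])
      fix x assume x: "x \<in> space ?ns"
      have "sets ?ns = sets (states M)"
        using next_state_prob[OF h] by (simp add: space_prob_algebra)
      with x have "x \<in> space (states M)" using sets_eq_imp_space_eq by blast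
      from measurable_space[OF \<phi>m this] have "prob_space (\<phi> x)" by (simp add: space_prob_algebra)
      then show "(\<integral>a. F x \<partial>\<phi> x) = F x" by (simp add: prob_space.prob_space)
    qed
    moreover have "integral\<^sup>L (stage_kernel M \<pi> t (restrict \<omega> {0..<t})) f = (\<integral>x. F x \<partial>?ns)"
      by (rule HOL.trans[OF integral_stage_kernel[OF f bound h]]) (simp_all add: \<pi> stationary_def F_def)
    moreover have "(\<integral>z. F (fst z) \<partial>stage_kernel M \<pi> t (restrict \<omega> {0..<t})) = (\<integral>x. (\<integral>a. F x \<partial>\<phi> x) \<partial>?ns)"
      by (subst integral_stage_kernel[where f = "\<lambda>z. F (fst z)", OF F1 F2 h]) (simp_all add: \<pi> stationary_def)
    ultimately show "integral\<^sup>L (stage_kernel M \<pi> t (restrict \<omega> {0..<t})) f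
      = (\<integral>z. F (fst z) \<partial>stage_kernel M \<pi> t (restrict \<omega> {0..<t}))" by simp
  qed
  also have "\<dots> = (\<integral>\<omega>. F (fst (\<omega> t)) \<partial>law)"
    by (rule expectation_coordinate[where f = "\<lambda>z. F (fst z)", OF F1 F2, symmetric])
  finally show ?thesis by (simp add: F_def)
qed

text \<open>In Dynkin's formula \<open>drift v g h\<close> is the one-step defect in the Poisson equation. If the defect is
  small, so is the difference of the time average of \<open>v\<close> and \<open>g\<close>, up to a boundary term of order \<open>1 / T\<close>. A
  lower bound on the defect that holds for all actions gives a lower bound on the averages
  for all policies.\<close>

definition drift :: "('x \<times> 'a \<Rightarrow> real) \<Rightarrow> real \<Rightarrow> ('x \<Rightarrow> real) \<Rightarrow> 'x \<times> 'a \<Rightarrow> real"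
  where "drift v g h z = v z + integral\<^sup>L (trans M z) h - g - h (fst z)"

definition mean_cost :: "('x \<times> 'a \<Rightarrow> real) \<Rightarrow> nat \<Rightarrow> real"
  where "mean_cost v T = 1 / real T * (\<integral>\<omega>. (\<Sum>t<T. v (\<omega> t)) \<partial>law)"

lemma avg_cost_eq: "avg_cost M v \<pi> = limsup (\<lambda>T. ereal (mean_cost v T))"
  by (simp add: avg_cost_def mean_cost_def law_def)

context
  fixes v :: "'x \<times> 'a \<Rightarrow> real" and B :: real
  assumes v: "v \<in> borel_measurable N" and v_bound: "\<And>z. z \<in> space N \<Longrightarrow> \<bar>v z\<bar> \<le> B"
begin

lemma mean_cost_bound:
  assumes "0 < T"
  shows "\<bar>mean_cost v T\<bar> \<le> B"
proof -
  have E: "\<bar>\<integral>\<omega>. v (\<omega> t) \<partial>law\<bar> \<le> B" for t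
    using measurable_compose[OF coordinate_measurable v] v_bound measurable_space[OF coordinate_measurable]
    by (intro integral_prob_algebra_bound[where N = law]) (auto simp: space_prob_algebra prob_space_law)
  have "(\<integral>\<omega>. (\<Sum>t<T. v (\<omega> t)) \<partial>law) = (\<Sum>t<T. \<integral>\<omega>. v (\<omega> t) \<partial>law)"
    by (rule Bochner_Integration.integral_sum) (rule integrable_coordinate[OF v v_bound])
  also have "\<bar>\<dots>\<bar> \<le> (\<Sum>t<T. B)"
    by (rule order_trans[OF sum_abs sum_mono]) (rule E)
  finally show ?thesis
    using assms by (simp add: mean_cost_def abs_mult field_simps)
qed

context
  fixes h :: "'x \<Rightarrow> real" and H :: real
  assumes h: "h \<in> borel_measurable (states M)" and h_bound: "\<And>x. x \<in> space (states M) \<Longrightarrow> \<bar>h x\<bar> \<le> H"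
begin

lemma drift_measurable: "drift v g h \<in> borel_measurable N"
  and drift_bound: "z \<in> space N \<Longrightarrow> \<bar>drift v g h z\<bar> \<le> B + H + \<bar>g\<bar> + H"
  and next_mean_measurable: "(\<lambda>z. integral\<^sup>L (trans M z) h) \<in> borel_measurable N"
  and next_mean_bound: "z \<in> space N \<Longrightarrow> \<bar>integral\<^sup>L (trans M z) h\<bar> \<le> H"
proof -
  show 1: "(\<lambda>z. integral\<^sup>L (trans M z) h) \<in> borel_measurable N"
    by (rule measurable_compose[OF measurable_prob_algebraD[OF trans] integral_measurable_subprob_algebra[OF h]])
  then show "drift v g h \<in> borel_measurable N"
    unfolding drift_def
    by (intro borel_measurable_diff borel_measurable_add v borel_measurable_const
        measurable_compose[OF measurable_fst h])
  show 2: "\<bar>integral\<^sup>L (trans M z) h\<bar> \<le> H" if "z \<in> space N" for z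
    by (rule integral_prob_algebra_bound[OF measurable_space[OF trans that] h h_bound])
  show "\<bar>drift v g h z\<bar> \<le> B + H + \<bar>g\<bar> + H" if z: "z \<in> space N"
    using 2[OF z] v_bound[OF z] h_bound[of "fst z"] z
    by (auto simp: drift_def space_pair_measure)
qed

lemma state_integrable: "integrable law (\<lambda>\<omega>. h (fst (\<omega> t)))"
  by (rule integrable_coordinate[where f = "\<lambda>z. h (fst z)" and B = H])
    (auto simp: space_pair_measure h_bound intro: measurable_compose[OF measurable_fst h])

lemma expectation_telescope:
  "(\<integral>\<omega>. (\<Sum>t<T. v (\<omega> t)) \<partial>law)
    = real T * g + (\<Sum>t<T. \<integral>\<omega>. drift v g h (\<omega> t) \<partial>law)
      + (\<integral>\<omega>. h (fst (\<omega> 0)) \<partial>law) - (\<integral>\<omega>. h (fst (\<omega> T)) \<partial>law)"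
proof -
  have iv: "integrable law (\<lambda>\<omega>. v (\<omega> t))" for t by (rule integrable_coordinate[OF v v_bound])
  have in': "integrable law (\<lambda>\<omega>. integral\<^sup>L (trans M (\<omega> t)) h)" for t
    by (rule integrable_coordinate[where f = "\<lambda>z. integral\<^sup>L (trans M z) h", OF next_mean_measurable next_mean_bound])
  have "(\<integral>\<omega>. drift v g h (\<omega> t) \<partial>law)
      = (\<integral>\<omega>. v (\<omega> t) \<partial>law) + (\<integral>\<omega>. h (fst (\<omega> (Suc t))) \<partial>law) - g - (\<integral>\<omega>. h (fst (\<omega> t)) \<partial>law)" for t
    unfolding drift_def using iv in' state_integrable expectation_next_state[OF h h_bound, of t]
    by (simp add: law.prob_space)
  then have "(\<Sum>t<T. \<integral>\<omega>. v (\<omega> t) \<partial>law) = (\<Sum>t<T. g + (\<integral>\<omega>. drift v g h (\<omega> t) \<partial>law)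
      - ((\<integral>\<omega>. h (fst (\<omega> (Suc t))) \<partial>law) - (\<integral>\<omega>. h (fst (\<omega> t)) \<partial>law)))"
    by (intro sum.cong refl) simp
  also have "\<dots> = real T * g + (\<Sum>t<T. \<integral>\<omega>. drift v g h (\<omega> t) \<partial>law)
      + (\<integral>\<omega>. h (fst (\<omega> 0)) \<partial>law) - (\<integral>\<omega>. h (fst (\<omega> T)) \<partial>law)"
    using sum_lessThan_telescope[of "\<lambda>t. \<integral>\<omega>. h (fst (\<omega> t)) \<partial>law" T]
    by (simp add: sum_subtractf sum.distrib)
  finally show ?thesis
    using iv by (simp add: Bochner_Integration.integral_sum)
qed

lemma state_mean_bound: "\<bar>\<integral>\<omega>. h (fst (\<omega> t)) \<partial>law\<bar> \<le> H"
proof (rule integral_prob_algebra_bound[where N = law])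
  show "law \<in> space (prob_algebra law)" by (simp add: space_prob_algebra prob_space_law)
  show "(\<lambda>\<omega>. h (fst (\<omega> t))) \<in> borel_measurable law"
    by (rule measurable_compose[OF coordinate_measurable measurable_compose[OF measurable_fst h]])
  show "\<bar>h (fst (\<omega> t))\<bar> \<le> H" if "\<omega> \<in> space law" for \<omega>
    using measurable_space[OF coordinate_measurable that, of t] by (intro h_bound) (auto simp: space_pair_measure)
qed

lemma mean_cost_drift:
  assumes "0 < T"
  shows "\<bar>mean_cost v T - g - (\<Sum>t<T. \<integral>\<omega>. drift v g h (\<omega> t) \<partial>law) / real T\<bar> \<le> 2 * H / real T"
proof -
  have "\<bar>(\<integral>\<omega>. h (fst (\<omega> 0)) \<partial>law) - (\<integral>\<omega>. h (fst (\<omega> T)) \<partial>law)\<bar> \<le> 2 * H"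
    using state_mean_bound[of 0] state_mean_bound[of T] by linarith
  moreover have "mean_cost v T - g - (\<Sum>t<T. \<integral>\<omega>. drift v g h (\<omega> t) \<partial>law) / real T
    = ((\<integral>\<omega>. h (fst (\<omega> 0)) \<partial>law) - (\<integral>\<omega>. h (fst (\<omega> T)) \<partial>law)) / real T"
    unfolding mean_cost_def expectation_telescope[of T g] using assms by (simp add: field_simps)
  ultimately show ?thesis
    using assms by (simp add: divide_right_mono)
qed

lemma mean_cost_ge:
  assumes T: "0 < T" and D: "\<And>z. z \<in> space N \<Longrightarrow> - e \<le> drift v g h z"
  shows "g - e - 2 * H / real T \<le> mean_cost v T"
proof -
  have "- e \<le> (\<integral>\<omega>. drift v g h (\<omega> t) \<partial>law)" for t
    using integrable_coordinate[OF drift_measurable drift_bound] measurable_space[OF coordinate_measurable, of _ t]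
    by (intro law.integral_ge_const) (auto intro!: D)
  then have "(\<Sum>t<T. - e) \<le> (\<Sum>t<T. \<integral>\<omega>. drift v g h (\<omega> t) \<partial>law)"
    by (intro sum_mono)
  then have "- e \<le> (\<Sum>t<T. \<integral>\<omega>. drift v g h (\<omega> t) \<partial>law) / real T"
    using T by (simp add: field_simps)
  with mean_cost_drift[OF T, of g] show ?thesis by linarith
qed

lemma mean_cost_stationary:
  assumes T: "0 < T" and \<pi>: "\<pi> = stationary \<phi>" and \<phi>: "\<phi> \<in> stationary_kernels (states M)"
    and D: "\<And>x. x \<in> space (states M) \<Longrightarrow> \<bar>\<integral>a. drift v g h (x, a) \<partial>\<phi> x\<bar> \<le> e"
  shows "\<bar>mean_cost v T - g\<bar> \<le> e + 2 * H / real T"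
proof -
  have \<phi>m: "\<phi> \<in> states M \<rightarrow>\<^sub>M prob_algebra borel"
    using \<phi> by (simp add: stationary_kernels_def)
  have m: "(\<lambda>x. \<integral>a. drift v g h (x, a) \<partial>\<phi> x) \<in> borel_measurable (states M)"
    by (rule integral_prob_algebra_measurable[OF \<phi>m]) (use drift_measurable in simp)
  have "\<bar>\<integral>\<omega>. drift v g h (\<omega> t) \<partial>law\<bar> \<le> e" for t
  proof -
    have "\<bar>\<integral>\<omega>. (\<integral>a. drift v g h (fst (\<omega> t), a) \<partial>\<phi> (fst (\<omega> t))) \<partial>law\<bar> \<le> e"
    proof (rule integral_prob_algebra_bound[where N = law])
      show "law \<in> space (prob_algebra law)" by (simp add: space_prob_algebra prob_space_law)
      show "(\<lambda>\<omega>. \<integral>a. drift v g h (fst (\<omega> t), a) \<partial>\<phi> (fst (\<omega> t))) \<in> borel_measurable law"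
        by (rule measurable_compose[OF coordinate_measurable measurable_compose[OF measurable_fst m]])
      show "\<bar>\<integral>a. drift v g h (fst (\<omega> t), a) \<partial>\<phi> (fst (\<omega> t))\<bar> \<le> e" if "\<omega> \<in> space law" for \<omega>
        using measurable_space[OF coordinate_measurable that, of t] by (intro D) (auto simp: space_pair_measure)
    qed
    then show ?thesis
      using expectation_stationary[where f = "drift v g h", OF \<pi> \<phi> drift_measurable drift_bound] by simp
  qed
  then have "\<bar>\<Sum>t<T. \<integral>\<omega>. drift v g h (\<omega> t) \<partial>law\<bar> \<le> (\<Sum>t<T. e)"
    by (intro order_trans[OF sum_abs sum_mono])
  then have "\<bar>(\<Sum>t<T. \<integral>\<omega>. drift v g h (\<omega> t) \<partial>law) / real T\<bar> \<le> e"
    using T by (simp add: field_simps)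
  with mean_cost_drift[OF T, of g] show ?thesis by linarith
qed

end

end

end

lemma (in controlled_process) avg_cost_bounds:
  assumes v: "v \<in> borel_measurable N" and b: "\<And>z. z \<in> space N \<Longrightarrow> 0 \<le> v z \<and> v z \<le> B"
  shows "0 \<le> avg_cost M v \<pi>" "avg_cost M v \<pi> \<le> ereal B"
proof -
  have b': "\<bar>v z\<bar> \<le> B" if "z \<in> space N" for z using b[OF that] by simp
  have le: "mean_cost v T \<le> B" if "0 < T" for T
    using mean_cost_bound[OF v b' that] by simp
  have ge: "0 \<le> mean_cost v T" for T
    unfolding mean_cost_def using measurable_space[OF coordinate_measurable] b
    by (intro mult_nonneg_nonneg integral_nonneg_AE AE_I2 sum_nonneg) auto
  have "0 \<le> liminf (\<lambda>T. ereal (mean_cost v T))"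
    by (rule Liminf_bounded) (simp add: ge)
  also have "\<dots> \<le> avg_cost M v \<pi>" unfolding avg_cost_eq by (rule Liminf_le_Limsup) simp
  finally show "0 \<le> avg_cost M v \<pi>" .
  show "avg_cost M v \<pi> \<le> ereal B"
    unfolding avg_cost_eq
    by (rule Limsup_bounded, rule eventually_mono[OF eventually_gt_at_top[of 0]]) (simp add: le)
qed

section \<open>Achievable performance vectors of the finite model\<close>

text \<open>If \<open>z0\<close> violates no supporting half-space of \<open>K\<close> by more than \<open>e\<close>, then \<open>z0\<close> is within \<open>e\<close> of \<open>K\<close>: test the
  hypothesis in the direction from \<open>z0\<close> to its closest point.\<close>

lemma near_point_of_support:
  fixes K :: "'v::euclidean_space set"
  assumes K: "convex K" "closed K" "K \<noteq> {}" and e: "0 \<le> e"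
    and supp: "\<And>u. \<exists>k\<in>K. u \<bullet> k - e * norm u \<le> u \<bullet> z0"
  obtains z where "z \<in> K" "norm (z - z0) \<le> e"
proof -
  define z where "z = closest_point K z0"
  have z: "z \<in> K" unfolding z_def by (rule closest_point_in_set[OF K(2,3)])
  define u where "u = z - z0"
  obtain k where k: "k \<in> K" "u \<bullet> k - e * norm u \<le> u \<bullet> z0" using supp by blast
  have "(z0 - z) \<bullet> (k - z) \<le> 0"
    unfolding z_def by (rule closest_point_dot[OF K(1,2) k(1)])
  then have "u \<bullet> z \<le> u \<bullet> k" by (simp add: u_def inner_diff_left inner_diff_right)
  with k(2) have "u \<bullet> (z - z0) \<le> e * norm u" by (simp add: inner_diff_right)
  then have "norm u * norm u \<le> e * norm u"
    by (simp add: u_def[symmetric] dot_square_norm power2_eq_square)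
  with e have "norm u \<le> e" by (cases "norm u = 0") auto
  with z show thesis by (intro that) (simp_all add: u_def)
qed

definition mix :: "real \<Rightarrow> 'a::topological_space measure \<Rightarrow> 'a measure \<Rightarrow> 'a measure"
  where "mix w M N = measure_pmf (bernoulli_pmf w) \<bind> (\<lambda>b. if b then N else M)"

lemma
  fixes f :: "'a::topological_space \<Rightarrow> real"
  assumes M: "M \<in> space (prob_algebra borel)" and N: "N \<in> space (prob_algebra borel)"
    and w: "0 \<le> w" "w \<le> 1"
  shows mix_prob: "mix w M N \<in> space (prob_algebra borel)"
    and integral_mix: "f \<in> borel_measurable borel \<Longrightarrow> (\<And>a. \<bar>f a\<bar> \<le> B) \<Longrightarrow>
      integral\<^sup>L (mix w M N) f = (1 - w) * integral\<^sup>L M f + w * integral\<^sup>L N f"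
proof -
  have b: "measure_pmf (bernoulli_pmf w) \<in> space (prob_algebra (count_space UNIV))"
    by (simp add: space_prob_algebra prob_space_measure_pmf)
  have k: "(\<lambda>b. if b then N else M) \<in> count_space UNIV \<rightarrow>\<^sub>M prob_algebra borel"
    using M N by simp
  show "mix w M N \<in> space (prob_algebra borel)"
    using prob_space_bind'[OF b k] sets_bind'[OF b k] by (simp add: mix_def space_prob_algebra)
  assume f: "f \<in> borel_measurable borel" "\<And>a. \<bar>f a\<bar> \<le> B"
  show "integral\<^sup>L (mix w M N) f = (1 - w) * integral\<^sup>L M f + w * integral\<^sup>L N f"
    unfolding mix_def using w
    by (subst integral_bind_bounded[OF b k f]) simp_all
qed

locale finite_model = doeblin Y m \<alpha> for Y :: "'x set" and m and \<alpha> +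
  fixes P :: "'x \<Rightarrow> 'a::topological_space \<Rightarrow> 'x \<Rightarrow> real" and C :: "'i::finite \<Rightarrow> 'x \<times> 'a \<Rightarrow> real" and B :: real
  assumes compact_actions: "compact (UNIV :: 'a set)"
    and P_minorized: "\<And>y a. y \<in> Y \<Longrightarrow> minorized (P y a)"
    and P_cont: "\<And>y y'. y \<in> Y \<Longrightarrow> y' \<in> Y \<Longrightarrow> continuous_on UNIV (\<lambda>a. P y a y')"
    and C_cont: "\<And>i y. y \<in> Y \<Longrightarrow> continuous_on UNIV (\<lambda>a. C i (y, a))"
    and C_bound: "\<And>i y a. y \<in> Y \<Longrightarrow> \<bar>C i (y, a)\<bar> \<le> B"
begin

abbreviation kernels :: "('x \<Rightarrow> 'a measure) set"
  where "kernels \<equiv> stationary_kernels (count_space Y)"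

definition avg_P :: "('x \<Rightarrow> 'a measure) \<Rightarrow> 'x \<Rightarrow> 'x \<Rightarrow> real"
  where "avg_P \<phi> y y' = (\<integral>a. P y a y' \<partial>\<phi> y)"

definition avg_C :: "('x \<Rightarrow> 'a measure) \<Rightarrow> 'i \<Rightarrow> 'x \<Rightarrow> real"
  where "avg_C \<phi> i y = (\<integral>a. C i (y, a) \<partial>\<phi> y)"

definition perf :: "('x \<Rightarrow> 'a measure) \<Rightarrow> real ^ 'i"
  where "perf \<phi> = (\<chi> i. gain Y (avg_P \<phi>) (avg_C \<phi> i))"

lemma kernels_prob: "\<phi> \<in> kernels \<longleftrightarrow> (\<forall>y\<in>Y. \<phi> y \<in> space (prob_algebra borel))"
  by (auto simp: stationary_kernels_def)

lemma P_measurable: "y \<in> Y \<Longrightarrow> y' \<in> Y \<Longrightarrow> (\<lambda>a. P y a y') \<in> borel_measurable borel"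
  by (rule borel_measurable_continuous_onI[OF P_cont])

lemma C_measurable: "y \<in> Y \<Longrightarrow> (\<lambda>a. C i (y, a)) \<in> borel_measurable borel"
  by (rule borel_measurable_continuous_onI[OF C_cont])

lemma minorized_le_1: "minorized r \<Longrightarrow> y \<in> Y \<Longrightarrow> \<bar>r y\<bar> \<le> 1"
  using member_le_sum[of y Y r] finite_Y minorized_nonneg[of r]
  by (simp add: minorized_def[of r])

lemma P_bound: "y \<in> Y \<Longrightarrow> y' \<in> Y \<Longrightarrow> \<bar>P y a y'\<bar> \<le> 1"
  by (rule minorized_le_1[OF P_minorized])

lemma P_integrable: "\<phi> \<in> kernels \<Longrightarrow> y \<in> Y \<Longrightarrow> y' \<in> Y \<Longrightarrow> integrable (\<phi> y) (\<lambda>a. P y a y')"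
  by (rule integrable_prob_algebra[OF _ P_measurable P_bound]) (auto simp: kernels_prob)

lemma C_integrable: "\<phi> \<in> kernels \<Longrightarrow> y \<in> Y \<Longrightarrow> integrable (\<phi> y) (\<lambda>a. C i (y, a))"
  by (rule integrable_prob_algebra[OF _ C_measurable C_bound]) (auto simp: kernels_prob)

lemma avg_P_doeblin:
  assumes \<phi>: "\<phi> \<in> kernels"
  shows "doeblin_kernel (avg_P \<phi>)"
  unfolding doeblin_kernel_def minorized_def
proof (intro ballI conjI)
  fix y assume y: "y \<in> Y"
  interpret prob_space "\<phi> y" using \<phi> y by (simp add: kernels_prob space_prob_algebra)
  have "(\<Sum>y'\<in>Y. avg_P \<phi> y y') = (\<integral>a. (\<Sum>y'\<in>Y. P y a y') \<partial>\<phi> y)"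
    unfolding avg_P_def by (rule Bochner_Integration.integral_sum[symmetric]) (rule P_integrable[OF \<phi> y])
  then show "sum (avg_P \<phi> y) Y = 1"
    using P_minorized[OF y] by (simp add: minorized_def prob_space)
  show "(1 - \<alpha>) * m y' \<le> avg_P \<phi> y y'" if "y' \<in> Y" for y'
    unfolding avg_P_def using P_integrable[OF \<phi> y that] P_minorized[OF y] that
    by (intro integral_ge_const) (auto simp: minorized_def)
qed

lemma avg_C_bound: "\<phi> \<in> kernels \<Longrightarrow> \<forall>y\<in>Y. \<bar>avg_C \<phi> i y\<bar> \<le> B"
  unfolding avg_C_def
  by (auto intro!: integral_prob_algebra_bound[OF _ C_measurable C_bound] simp: kernels_prob)

text \<open>If \<open>\<rho>1\<close> and \<open>\<rho>2\<close> are the invariant distributions of two kernels, the mixture should spend the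
  fraction \<open>\<sigma> y = (1 - \<theta>) * \<rho>1 y + \<theta> * \<rho>2 y\<close> of its time in \<open>y\<close>. Hence it has to use the second
  kernel at \<open>y\<close> with the conditional probability \<open>w y = \<theta> * \<rho>2 y / \<sigma> y\<close>; then \<open>\<sigma>\<close> is indeed
  invariant, and occupation times, and with them all costs, mix linearly.\<close>

lemma convex_perf: "convex (perf ` kernels)"
  unfolding convex_alt
proof (intro ballI allI impI)
  fix z1 z2 and \<theta> :: real
  assume "z1 \<in> perf ` kernels" "z2 \<in> perf ` kernels" and "0 \<le> \<theta> \<and> \<theta> \<le> 1"
  then obtain \<phi>1 \<phi>2 where z: "z1 = perf \<phi>1" "z2 = perf \<phi>2" and \<phi>: "\<phi>1 \<in> kernels" "\<phi>2 \<in> kernels"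
    and \<theta>: "0 \<le> \<theta>" "\<theta> \<le> 1" by auto
  note R1 = avg_P_doeblin[OF \<phi>(1)] and R2 = avg_P_doeblin[OF \<phi>(2)]
  obtain \<rho>1 where \<rho>1: "invariant (avg_P \<phi>1) \<rho>1" using invariant_exists[OF R1] .
  obtain \<rho>2 where \<rho>2: "invariant (avg_P \<phi>2) \<rho>2" using invariant_exists[OF R2] .
  define \<sigma> where "\<sigma> y = (1 - \<theta>) * \<rho>1 y + \<theta> * \<rho>2 y" for y
  \<comment> \<open>Where \<open>\<sigma>\<close> vanishes, both summands vanish and division by zero gives weight \<open>0\<close>;
    the identities for \<open>\<sigma> y * w y\<close> hold there too.\<close>
  define w where "w y = \<theta> * \<rho>2 y / \<sigma> y" for y
  have pos: "0 \<le> (1 - \<theta>) * \<rho>1 y" "0 \<le> \<theta> * \<rho>2 y" if "y \<in> Y" for y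
    using that \<rho>1 \<rho>2 \<theta> by (auto simp: invariant_def)
  have w: "0 \<le> w y" "w y \<le> 1" and \<sigma>w: "\<sigma> y * w y = \<theta> * \<rho>2 y" "\<sigma> y * (1 - w y) = (1 - \<theta>) * \<rho>1 y"
    if "y \<in> Y" for y
  proof -
    note p = pos[OF that]
    show "0 \<le> w y" "w y \<le> 1"
      using p by (auto simp: w_def \<sigma>_def divide_le_eq_1)
    show "\<sigma> y * w y = \<theta> * \<rho>2 y"
    proof (cases "\<sigma> y = 0")
      case True
      with p have "\<theta> * \<rho>2 y = 0" unfolding \<sigma>_def by linarith
      with True show ?thesis by simp
    qed (simp add: w_def)
    then show "\<sigma> y * (1 - w y) = (1 - \<theta>) * \<rho>1 y"
      by (simp add: right_diff_distrib) (simp add: \<sigma>_def)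
  qed
  define \<phi> where "\<phi> y = mix (w y) (\<phi>1 y) (\<phi>2 y)" for y
  have \<phi>_k: "\<phi> \<in> kernels"
    using \<phi> w unfolding kernels_prob \<phi>_def by (auto intro: mix_prob)
  have aP: "avg_P \<phi> y y' = (1 - w y) * avg_P \<phi>1 y y' + w y * avg_P \<phi>2 y y'" if "y \<in> Y" "y' \<in> Y" for y y'
    unfolding avg_P_def \<phi>_def using \<phi> w that
    by (intro integral_mix[OF _ _ _ _ P_measurable P_bound]) (auto simp: kernels_prob)
  have aC: "avg_C \<phi> i y = (1 - w y) * avg_C \<phi>1 i y + w y * avg_C \<phi>2 i y" if "y \<in> Y" for i y
    unfolding avg_C_def \<phi>_def using \<phi> w that
    by (intro integral_mix[OF _ _ _ _ C_measurable C_bound]) (auto simp: kernels_prob)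
  have split: "(\<Sum>y\<in>Y. \<sigma> y * ((1 - w y) * a y + w y * b y))
      = (1 - \<theta>) * (\<Sum>y\<in>Y. \<rho>1 y * a y) + \<theta> * (\<Sum>y\<in>Y. \<rho>2 y * b y)" for a b
    unfolding sum_distrib_left sum.distrib[symmetric]
  proof (rule sum.cong[OF refl])
    fix y assume y: "y \<in> Y"
    have "\<sigma> y * ((1 - w y) * a y + w y * b y) = (\<sigma> y * (1 - w y)) * a y + (\<sigma> y * w y) * b y"
      by (simp add: algebra_simps)
    then show "\<sigma> y * ((1 - w y) * a y + w y * b y) = (1 - \<theta>) * (\<rho>1 y * a y) + \<theta> * (\<rho>2 y * b y)"
      unfolding \<sigma>w[OF y] by (simp add: algebra_simps)
  qed
  have "invariant (avg_P \<phi>) \<sigma>"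
    unfolding invariant_def
  proof (intro conjI ballI)
    show "0 \<le> \<sigma> y" if "y \<in> Y" for y using pos[OF that] by (simp add: \<sigma>_def)
    show "sum \<sigma> Y = 1"
      using \<rho>1 \<rho>2 by (simp add: \<sigma>_def sum.distrib sum_distrib_left[symmetric] invariant_def)
    fix y' assume y': "y' \<in> Y"
    have "(\<Sum>y\<in>Y. \<sigma> y * avg_P \<phi> y y')
        = (\<Sum>y\<in>Y. \<sigma> y * ((1 - w y) * avg_P \<phi>1 y y' + w y * avg_P \<phi>2 y y'))"
      using y' by (intro sum.cong refl) (simp add: aP)
    also have "\<dots> = \<sigma> y'"
      unfolding split using \<rho>1 \<rho>2 y' by (simp add: invariant_def \<sigma>_def)
    finally show "(\<Sum>y\<in>Y. \<sigma> y * avg_P \<phi> y y') = \<sigma> y'" .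
  qed
  then have "gain Y (avg_P \<phi>) (avg_C \<phi> i)
      = (1 - \<theta>) * gain Y (avg_P \<phi>1) (avg_C \<phi>1 i) + \<theta> * gain Y (avg_P \<phi>2) (avg_C \<phi>2 i)" for i
    unfolding gain_invariant[OF R1 \<rho>1] gain_invariant[OF R2 \<rho>2]
    by (subst gain_invariant[OF avg_P_doeblin[OF \<phi>_k]]) (simp_all add: aC split[symmetric] cong: sum.cong)
  then have "perf \<phi> = (1 - \<theta>) *\<^sub>R z1 + \<theta> *\<^sub>R z2"
    by (simp add: perf_def z vec_eq_iff)
  with \<phi>_k show "(1 - \<theta>) *\<^sub>R z1 + \<theta> *\<^sub>R z2 \<in> perf ` kernels" by (metis imageI)
qed

definition pure :: "('x \<Rightarrow> 'a) \<Rightarrow> 'x \<Rightarrow> 'a measure"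
  where "pure f y = return borel (f y)"

lemma pure_kernel: "pure f \<in> kernels"
  unfolding kernels_prob pure_def by (simp add: space_prob_algebra prob_space_return)

lemma avg_P_pure: "y \<in> Y \<Longrightarrow> y' \<in> Y \<Longrightarrow> avg_P (pure f) y y' = P y (f y) y'"
  unfolding avg_P_def pure_def by (subst integral_return) (auto intro: P_measurable)

lemma avg_C_pure: "y \<in> Y \<Longrightarrow> avg_C (pure f) i y = C i (y, f y)"
  unfolding avg_C_def pure_def by (subst integral_return) (auto intro: C_measurable)

text \<open>The solution \<open>h\<close> of the Poisson equation for the selector \<open>f\<close> solves the equation for \<open>f'\<close> up to an error
  \<open>E f'\<close> that depends continuously on \<open>f'\<close> in the product topology, because it involves only the
  finitely many values of \<open>f'\<close> on \<open>Y\<close>. The maximum principle turns the error in the equation into an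
  error in the gain.\<close>

lemma perf_pure_continuous: "continuous_on UNIV (\<lambda>f. perf (pure f))"
  unfolding continuous_on_def
proof
  fix f :: "'x \<Rightarrow> 'a"
  show "((\<lambda>f'. perf (pure f')) \<longlongrightarrow> perf (pure f)) (at f within UNIV)"
  proof (rule vec_tendstoI)
    fix i
    obtain h where h: "poisson_pair Y (avg_P (pure f)) (avg_C (pure f) i) (perf (pure f) $ i) h"
      and hb: "\<And>y. y \<in> Y \<Longrightarrow> \<bar>h y\<bar> \<le> B / (1 - \<alpha>)"
      using gain_poisson[OF avg_P_doeblin[OF pure_kernel[of f]] avg_C_bound[OF pure_kernel[of f], of i]]
      unfolding perf_def vec_lambda_beta by blast
    define E where "E f' = (\<Sum>y\<in>Y. \<bar>C i (y, f' y) - C i (y, f y)\<bar>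
      + (\<Sum>y'\<in>Y. \<bar>P y (f' y) y' - P y (f y) y'\<bar> * \<bar>h y'\<bar>))" for f'
    have "continuous_on UNIV E"
      unfolding E_def
      by (intro continuous_on_sum continuous_on_add continuous_on_mult continuous_on_rabs continuous_on_diff
          continuous_on_const continuous_on_compose2[OF C_cont continuous_on_product_coordinates]
          continuous_on_compose2[OF P_cont continuous_on_product_coordinates]) auto
    moreover have "E f = 0" by (simp add: E_def)
    ultimately have E0: "(E \<longlongrightarrow> 0) (at f within UNIV)"
      by (simp add: continuous_on_def) metis
    have "\<bar>perf (pure f') $ i - perf (pure f) $ i\<bar> \<le> E f'" for f'
    proof -
      obtain h' where h': "poisson_pair Y (avg_P (pure f')) (avg_C (pure f') i) (perf (pure f') $ i) h'"
        using gain_poisson[OF avg_P_doeblin[OF pure_kernel[of f']] avg_C_bound[OF pure_kernel[of f'], of i]]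
        unfolding perf_def vec_lambda_beta by blast
      have close: "\<bar>(avg_C (pure f) i y + (\<Sum>y'\<in>Y. avg_P (pure f) y y' * h y'))
        - (avg_C (pure f') i y + (\<Sum>y'\<in>Y. avg_P (pure f') y y' * h y'))\<bar> \<le> E f'" if y: "y \<in> Y" for y
      proof -
        have "\<bar>(avg_C (pure f) i y + (\<Sum>y'\<in>Y. avg_P (pure f) y y' * h y'))
            - (avg_C (pure f') i y + (\<Sum>y'\<in>Y. avg_P (pure f') y y' * h y'))\<bar>
          = \<bar>(C i (y, f' y) - C i (y, f y)) + (\<Sum>y'\<in>Y. (P y (f' y) y' - P y (f y) y') * h y')\<bar>"
          using y by (simp add: avg_C_pure avg_P_pure left_diff_distrib sum_subtractf)
        also have "\<dots> \<le> \<bar>C i (y, f' y) - C i (y, f y)\<bar> + (\<Sum>y'\<in>Y. \<bar>P y (f' y) y' - P y (f y) y'\<bar> * \<bar>h y'\<bar>)"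
          by (intro order_trans[OF abs_triangle_ineq] add_mono order_refl order_trans[OF sum_abs])
            (simp add: abs_mult)
        also have "\<dots> \<le> E f'"
          unfolding E_def using y finite_Y by (intro member_le_sum) (auto intro!: add_nonneg_nonneg sum_nonneg)
        finally show ?thesis .
      qed
      have "perf (pure f) $ i \<le> perf (pure f') $ i + E f'"
      proof (rule gain_compare[OF avg_P_doeblin[OF pure_kernel], where v = "avg_C (pure f') i" and h = h and h' = h'])
        show "perf (pure f) $ i + h y \<le> avg_C (pure f') i y + (\<Sum>y'\<in>Y. avg_P (pure f') y y' * h y') + E f'"
          if "y \<in> Y" for y using close[OF that] h[unfolded poisson_pair_def, rule_format, OF that] by linarith
      qed (use h' in \<open>simp add: poisson_pair_def\<close>)
      moreover have "perf (pure f') $ i \<le> (perf (pure f) $ i + E f') + 0"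
      proof (rule gain_compare[OF avg_P_doeblin[OF pure_kernel], where v = "avg_C (pure f') i" and h = h' and h' = h])
        show "avg_C (pure f') i y + (\<Sum>y'\<in>Y. avg_P (pure f') y y' * h y') \<le> perf (pure f) $ i + E f' + h y"
          if "y \<in> Y" for y using close[OF that] h[unfolded poisson_pair_def, rule_format, OF that] by linarith
      qed (use h' in \<open>simp add: poisson_pair_def\<close>)
      ultimately show ?thesis by linarith
    qed
    then have "((\<lambda>f'. perf (pure f') $ i - perf (pure f) $ i) \<longlongrightarrow> 0) (at f within UNIV)"
      by (intro Lim_null_comparison[OF _ E0]) simp
    then show "((\<lambda>f'. perf (pure f') $ i) \<longlongrightarrow> perf (pure f) $ i) (at f within UNIV)"
      by (simp add: LIM_zero_iff)
  qed
qed

lemma compact_perf_pure: "compact (range (\<lambda>f. perf (pure f)))"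
proof (rule compact_continuous_image[OF perf_pure_continuous])
  have "compact_space (product_topology (\<lambda>_::'x. euclidean :: 'a topology) UNIV)"
    unfolding compact_space_product_topology using compact_actions
    by (simp add: compact_space_def)
  then show "compact (UNIV :: ('x \<Rightarrow> 'a) set)"
    unfolding euclidean_product_topology compact_space_def by simp
qed

text \<open>The hull of the selectors is used in place of all of \<open>perf ` kernels\<close>: it is compact for elementary reasons,
  and by the optimality equation it is still large enough to dominate every policy.\<close>

definition achievable :: "(real ^ 'i) set"
  where "achievable = convex hull (range (\<lambda>f. perf (pure f)))"

lemma convex_achievable: "convex achievable"
  by (simp add: achievable_def convex_convex_hull)

lemma compact_achievable: "compact achievable"
  unfolding achievable_def by (rule compact_convex_hull[OF compact_perf_pure])

lemma pure_achievable: "perf (pure f) \<in> achievable"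
  unfolding achievable_def by (rule hull_inc) simp

lemma achievable_subset: "achievable \<subseteq> perf ` kernels"
  unfolding achievable_def by (rule hull_minimal) (auto intro: pure_kernel convex_perf)

text \<open>The average cost optimality equation for the scalar cost \<open>u \<bullet> C\<close>. The Bellman operator of the residual
  kernel is a contraction, minimizing actions exist by compactness, and a minimizing selector \<open>f\<close>
  attains equality, so that the constant of the equation is the gain \<open>u \<bullet> perf (pure f)\<close>.\<close>

lemma optimality_equation:
  fixes u :: "real ^ 'i"
  obtains h f where "\<And>y. y \<in> Y \<Longrightarrow> \<bar>h y\<bar> \<le> (\<Sum>i\<in>UNIV. \<bar>u $ i\<bar>) * B / (1 - \<alpha>)"
    "\<And>y a. y \<in> Y \<Longrightarrow> u \<bullet> perf (pure f) + h y \<le> (\<Sum>i\<in>UNIV. u $ i * C i (y, a)) + (\<Sum>y'\<in>Y. P y a y' * h y')"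
proof -
  define v where "v y a = (\<Sum>i\<in>UNIV. u $ i * C i (y, a))" for y a
  define G where "G h y a = v y a + (\<Sum>y'\<in>Y. (P y a y' - (1 - \<alpha>) * m y') * h y')" for h y a
  define A where "A h y = (SOME a. \<forall>b. G h y a \<le> G h y b)" for h y
  have A: "G h y (A h y) \<le> G h y b" if y: "y \<in> Y" for h y b
  proof -
    have "continuous_on UNIV (G h y)"
      unfolding G_def v_def using y
      by (intro continuous_on_sum continuous_on_add continuous_on_mult continuous_on_diff
          continuous_on_const C_cont P_cont)
    then have "\<exists>a. \<forall>b. G h y a \<le> G h y b"
      using continuous_attains_inf[OF compact_actions] by auto
    then have "\<forall>b. G h y (A h y) \<le> G h y b" unfolding A_def by (rule someI_ex)
    then show ?thesis by blast
  qed
  have v_bound: "\<bar>v y a\<bar> \<le> (\<Sum>i\<in>UNIV. \<bar>u $ i\<bar>) * B" if "y \<in> Y" for y a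
    unfolding v_def sum_distrib_right
    by (rule order_trans[OF sum_abs sum_mono]) (simp add: abs_mult mult_left_mono C_bound[OF that])
  define U where "U h y = G h y (A h y)" for h y
  obtain h where h: "\<And>y. y \<in> Y \<Longrightarrow> U h y = h y" and hb: "\<And>y. y \<in> Y \<Longrightarrow> \<bar>h y\<bar> \<le> (\<Sum>i\<in>UNIV. \<bar>u $ i\<bar>) * B / (1 - \<alpha>)"
  proof (rule contraction_fixpoint[where U = U, OF finite_Y less_imp_le[OF \<alpha>_pos] \<alpha>_less])
    fix h h' :: "'x \<Rightarrow> real" and e y
    assume hh: "\<And>y. y \<in> Y \<Longrightarrow> \<bar>h y - h' y\<bar> \<le> e" and y: "y \<in> Y"
    have G: "\<bar>G h y a - G h' y a\<bar> \<le> \<alpha> * e" for a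
    proof -
      have "G h y a - G h' y a = (\<Sum>y'\<in>Y. (P y a y' - (1 - \<alpha>) * m y') * (h y' - h' y'))"
        by (simp add: G_def sum_subtractf right_diff_distrib)
      then show ?thesis using residual_sum_le[OF P_minorized[OF y] hh] by simp
    qed
    show "\<bar>U h y - U h' y\<bar> \<le> \<alpha> * e"
      using G[of "A h y"] G[of "A h' y"] A[OF y, of h "A h' y"] A[OF y, of h' "A h y"]
      unfolding U_def by linarith
  qed (use v_bound in \<open>auto simp: U_def G_def\<close>)
  define f where "f y = A h y" for y
  define g where "g = (1 - \<alpha>) * (\<Sum>y\<in>Y. m y * h y)"
  have Gg: "G h y a = v y a + (\<Sum>y'\<in>Y. P y a y' * h y') - g" for y a
    by (simp add: G_def g_def left_diff_distrib sum_subtractf sum_distrib_left mult.assoc)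
  have eq: "g + h y = v y (f y) + (\<Sum>y'\<in>Y. P y (f y) y' * h y')" if "y \<in> Y" for y
    using h[OF that] Gg[of y "f y"] by (simp add: U_def f_def)
  have le: "g + h y \<le> v y a + (\<Sum>y'\<in>Y. P y a y' * h y')" if "y \<in> Y" for y a
    using h[OF that] Gg[of y a] A[OF that, of h a] by (simp add: U_def)
  have "u \<bullet> perf (pure f) = (\<Sum>i\<in>UNIV. u $ i * gain Y (avg_P (pure f)) (avg_C (pure f) i))"
    by (simp add: inner_vec_def perf_def)
  also have "\<dots> = gain Y (avg_P (pure f)) (\<lambda>y. \<Sum>i\<in>UNIV. u $ i * avg_C (pure f) i y)"
    by (rule gain_sum[OF avg_P_doeblin[OF pure_kernel], symmetric]) simp
  also have "\<dots> = g"
    by (rule gain_eqI[OF avg_P_doeblin[OF pure_kernel], where h = h])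
      (use eq in \<open>simp add: poisson_pair_def avg_P_pure avg_C_pure v_def\<close>)
  finally have "u \<bullet> perf (pure f) = g" .
  with le hb show thesis by (intro that[of h f]) (auto simp: v_def)
qed

end

section \<open>Models that approximate the finite model\<close>

lemma stationary_in_policies:
  fixes \<psi> :: "'x \<Rightarrow> 'a::topological_space measure"
  assumes "\<psi> \<in> stationary_kernels S"
  shows "stationary \<psi> \<in> policies S"
proof -
  have "(\<lambda>w :: (nat \<Rightarrow> 'x \<times> 'a) \<times> 'x. \<psi> (snd w)) \<in> hist_space S t \<rightarrow>\<^sub>M prob_algebra borel" for t
    unfolding hist_space_def
    by (rule measurable_compose[OF measurable_snd assms[unfolded stationary_kernels_def]])
  then show ?thesis
    by (simp add: policies_def stationary_def split_beta')
qed

text \<open>The model \<open>M\<close> looks, up to the errors \<open>e1\<close> and \<open>e2\<close>, like the finite model when its states are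
  observed through \<open>\<sigma>\<close>. Transitions are compared by their action on functions of the observed state, the only
  functions to which solutions of the finite equations give rise.\<close>

locale approximation = finite_model Y m \<alpha> P C B
  for Y :: "'x set" and m and \<alpha> and P :: "'x \<Rightarrow> 'a::topological_space \<Rightarrow> 'x \<Rightarrow> real"
    and C :: "'i::finite \<Rightarrow> 'x \<times> 'a \<Rightarrow> real" and B +
  fixes M :: "('x, 'a) mdp" and \<sigma> :: "'x \<Rightarrow> 'x" and G :: "'i \<Rightarrow> 'x \<times> 'a \<Rightarrow> real" and e1 e2 :: real
  assumes init: "initial M \<in> space (prob_algebra (states M))"
    and trans: "trans M \<in> states M \<Otimes>\<^sub>M borel \<rightarrow>\<^sub>M prob_algebra (states M)"
    and \<sigma>_measurable: "\<sigma> \<in> states M \<rightarrow>\<^sub>M count_space Y"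
    and G_measurable: "\<And>i. G i \<in> borel_measurable (states M \<Otimes>\<^sub>M borel)"
    and G_close: "\<And>i x a. x \<in> space (states M) \<Longrightarrow> \<bar>G i (x, a) - C i (\<sigma> x, a)\<bar> \<le> e1"
    and trans_close: "\<And>x a h H. x \<in> space (states M) \<Longrightarrow> \<forall>y\<in>Y. \<bar>h y\<bar> \<le> H \<Longrightarrow>
      \<bar>(\<integral>x'. h (\<sigma> x') \<partial>trans M (x, a)) - (\<Sum>y'\<in>Y. P (\<sigma> x) a y' * h y')\<bar> \<le> e2 * H"
    and e_nonneg: "0 \<le> e1" "0 \<le> e2"
begin

text \<open>The factor \<open>B / (1 - \<alpha>)\<close> bounds the solutions of the finite equations; the number of costs enters because
  the estimates are made in the Euclidean norm for linear combinations of all costs.\<close>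

definition \<eta> :: real
  where "\<eta> = real CARD('i) * (e1 + e2 * B / (1 - \<alpha>))"

lemma \<sigma>_in: "x \<in> space (states M) \<Longrightarrow> \<sigma> x \<in> Y"
  using measurable_space[OF \<sigma>_measurable] by simp

lemma B_nonneg: "0 \<le> B"
  using Y_nonempty C_bound by (metis abs_ge_zero all_not_in_conv order_trans)

lemma error_nonneg: "0 \<le> e1 + e2 * B / (1 - \<alpha>)"
  using e_nonneg B_nonneg \<alpha>_less by simp

lemma \<eta>_ge: "e1 + e2 * B / (1 - \<alpha>) \<le> \<eta>"
proof -
  have "1 * (e1 + e2 * B / (1 - \<alpha>)) \<le> \<eta>"
    unfolding \<eta>_def using error_nonneg
    by (intro mult_right_mono) (auto simp: Suc_le_eq)
  then show ?thesis by simp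
qed

lemma G_bound: "z \<in> space (states M \<Otimes>\<^sub>M borel) \<Longrightarrow> \<bar>G i z\<bar> \<le> B + e1"
  using G_close[of "fst z" i "snd z"] C_bound[OF \<sigma>_in, of "fst z" i "snd z"]
  by (auto simp: space_pair_measure)

lemma lift_measurable: "(\<lambda>x. h (\<sigma> x)) \<in> borel_measurable (states M)" for h :: "'x \<Rightarrow> real"
  by (rule measurable_compose[OF \<sigma>_measurable]) simp

text \<open>No policy, whatever its use of the past, beats \<open>achievable\<close> by more than \<open>\<eta>\<close>. Along a subsequence the
  vectors of time averages converge to some \<open>z0\<close>; the solution of the optimality equation in direction
  \<open>u\<close>, composed with \<open>\<sigma>\<close>, has drift at least \<open>- \<eta> * norm u\<close> in \<open>M\<close>, and Dynkin's formula shows that \<open>z0\<close> violates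
  the half-space with normal \<open>u\<close> by at most that much. The components of \<open>z0\<close>
  are bounded by the upper limits that define the average costs.\<close>

lemma averages_near_achievable:
  assumes \<pi>: "\<pi> \<in> policies (states M)"
  obtains z where "z \<in> achievable" "\<And>i. ereal (z $ i - \<eta>) \<le> avg_cost M (G i) \<pi>"
proof -
  interpret controlled_process M \<pi> by (rule controlled_process.intro[OF init trans \<pi>])
  define X where "X T = (\<chi> i. mean_cost (G i) (Suc T))" for T
  have X_bound: "\<bar>mean_cost (G i) (Suc T)\<bar> \<le> B + e1" for i T
    by (rule mean_cost_bound[OF G_measurable G_bound]) simp_all
  have "bounded (range X)"
  proof (rule boundedI)
    fix x assume "x \<in> range X"
    then obtain T where "x = X T" by blast
    then have "(\<Sum>i\<in>UNIV. \<bar>x $ i\<bar>) \<le> real CARD('i) * (B + e1)"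
      using X_bound by (intro sum_bounded_above) (simp add: X_def)
    then show "norm x \<le> real CARD('i) * (B + e1)"
      by (rule order_trans[OF norm_le_l1_cart])
  qed
  then obtain z0 r where r: "strict_mono r" and z0: "(X \<circ> r) \<longlonglongrightarrow> z0"
    using bounded_imp_convergent_subsequence by blast
  have "\<exists>k\<in>achievable. u \<bullet> k - \<eta> * norm u \<le> u \<bullet> z0" for u :: "real ^ 'i"
  proof -
    define U where "U = (\<Sum>i\<in>UNIV. \<bar>u $ i\<bar>)"
    define H where "H = U * B / (1 - \<alpha>)"
    obtain h f where h: "\<And>y. y \<in> Y \<Longrightarrow> \<bar>h y\<bar> \<le> H"
      and opt: "\<And>y a. y \<in> Y \<Longrightarrow> u \<bullet> perf (pure f) + h y
        \<le> (\<Sum>i\<in>UNIV. u $ i * C i (y, a)) + (\<Sum>y'\<in>Y. P y a y' * h y')"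
      using optimality_equation[of u] unfolding H_def U_def by blast
    have U: "U \<le> real CARD('i) * norm u" "0 \<le> U"
      using sum_bounded_above[of UNIV "\<lambda>i. \<bar>u $ i\<bar>" "norm u"] component_le_norm_cart
      by (auto simp: U_def intro: sum_nonneg)
    define v where "v z = (\<Sum>i\<in>UNIV. u $ i * G i z)" for z
    have v: "v \<in> borel_measurable N" unfolding v_def using G_measurable by measurable
    have v_bound: "\<bar>v z\<bar> \<le> U * (B + e1)" if "z \<in> space N" for z
      unfolding v_def U_def sum_distrib_right
      by (rule order_trans[OF sum_abs sum_mono]) (simp add: abs_mult mult_left_mono G_bound[OF that])
    have drift: "- (\<eta> * norm u) \<le> drift v (u \<bullet> perf (pure f)) (\<lambda>x. h (\<sigma> x)) z" if z: "z \<in> space N" for z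
    proof -
      obtain x a where za: "z = (x, a)" and x: "x \<in> space (states M)"
        using z by (cases z) (auto simp: space_pair_measure)
      have "\<bar>v (x, a) - (\<Sum>i\<in>UNIV. u $ i * C i (\<sigma> x, a))\<bar> = \<bar>\<Sum>i\<in>UNIV. u $ i * (G i (x, a) - C i (\<sigma> x, a))\<bar>"
        by (simp add: v_def right_diff_distrib sum_subtractf)
      also have "\<dots> \<le> U * e1"
        unfolding U_def sum_distrib_right
        by (rule order_trans[OF sum_abs sum_mono]) (simp add: abs_mult mult_left_mono G_close[OF x])
      finally have "\<bar>v (x, a) - (\<Sum>i\<in>UNIV. u $ i * C i (\<sigma> x, a))\<bar> \<le> U * e1" .
      moreover have "\<bar>(\<integral>x'. h (\<sigma> x') \<partial>trans M (x, a)) - (\<Sum>y'\<in>Y. P (\<sigma> x) a y' * h y')\<bar> \<le> e2 * H"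
        by (rule trans_close[OF x]) (use h in blast)
      moreover note opt[OF \<sigma>_in[OF x], of a]
      ultimately have "- (U * e1 + e2 * H) \<le> drift v (u \<bullet> perf (pure f)) (\<lambda>x. h (\<sigma> x)) z"
        unfolding drift_def za by simp
      moreover have "U * e1 + e2 * H = U * (e1 + e2 * B / (1 - \<alpha>))"
        by (simp add: H_def algebra_simps)
      moreover have "U * (e1 + e2 * B / (1 - \<alpha>)) \<le> \<eta> * norm u"
        using mult_right_mono[OF U(1) error_nonneg] by (simp add: \<eta>_def mult_ac)
      ultimately show ?thesis by linarith
    qed
    have mean: "mean_cost v T = (\<Sum>i\<in>UNIV. u $ i * mean_cost (G i) T)" for T
    proof -
      have int: "integrable law (\<lambda>\<omega>. G i (\<omega> t))" for i t
        by (rule integrable_coordinate[OF G_measurable G_bound])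
      have "(\<integral>\<omega>. (\<Sum>t<T. v (\<omega> t)) \<partial>law) = (\<integral>\<omega>. (\<Sum>i\<in>UNIV. u $ i * (\<Sum>t<T. G i (\<omega> t))) \<partial>law)"
        unfolding v_def sum_distrib_left by (subst sum.swap) simp
      also have "\<dots> = (\<Sum>i\<in>UNIV. u $ i * (\<integral>\<omega>. (\<Sum>t<T. G i (\<omega> t)) \<partial>law))"
        using int by simp
      finally show ?thesis
        by (simp add: mean_cost_def sum_distrib_left mult_ac)
    qed
    have lower: "u \<bullet> perf (pure f) - \<eta> * norm u - 2 * H / real (Suc (r T)) \<le> u \<bullet> (X \<circ> r) T" for T
    proof -
      have "u \<bullet> perf (pure f) - \<eta> * norm u - 2 * H / real (Suc (r T)) \<le> mean_cost v (Suc (r T))"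
        by (rule mean_cost_ge[where h = "\<lambda>x. h (\<sigma> x)", OF v v_bound lift_measurable h[OF \<sigma>_in] _ drift]) simp_all
      then show ?thesis by (simp add: mean X_def inner_vec_def)
    qed
    have "(\<lambda>T. 2 * H / real (Suc (r T))) \<longlonglongrightarrow> 0"
      using LIMSEQ_subseq_LIMSEQ[OF LIMSEQ_Suc[OF lim_const_over_n[of "2 * H"]] r] by (simp add: comp_def)
    then have "(\<lambda>T. u \<bullet> perf (pure f) - \<eta> * norm u - 2 * H / real (Suc (r T))) \<longlonglongrightarrow> u \<bullet> perf (pure f) - \<eta> * norm u - 0"
      by (intro tendsto_diff tendsto_const)
    moreover have "(\<lambda>T. u \<bullet> (X \<circ> r) T) \<longlonglongrightarrow> u \<bullet> z0"
      by (intro tendsto_inner tendsto_const z0)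
    ultimately have "u \<bullet> perf (pure f) - \<eta> * norm u - 0 \<le> u \<bullet> z0"
      by (rule LIMSEQ_le) (use lower in blast)
    then show ?thesis using pure_achievable[of f] by auto
  qed
  then obtain z where z: "z \<in> achievable" "norm (z - z0) \<le> \<eta>"
    using near_point_of_support[OF convex_achievable compact_imp_closed[OF compact_achievable], of \<eta> z0]
      pure_achievable \<eta>_ge error_nonneg by (metis empty_iff order_trans)
  have "ereal (z $ i - \<eta>) \<le> avg_cost M (G i) \<pi>" for i
  proof -
    have "z $ i - \<eta> \<le> z0 $ i"
      using component_le_norm_cart[of "z - z0" i] z(2) by simp
    then have "ereal (z $ i - \<eta>) \<le> ereal (z0 $ i)" by simp
    also have "\<dots> = limsup (\<lambda>T. ereal (mean_cost (G i) (Suc (r T))))"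
    proof (rule lim_imp_Limsup[symmetric])
      show "(\<lambda>T. ereal (mean_cost (G i) (Suc (r T)))) \<longlonglongrightarrow> ereal (z0 $ i)"
        using tendsto_vec_nth[OF z0, of i] by (simp add: X_def comp_def)
    qed simp
    also have "\<dots> \<le> avg_cost M (G i) \<pi>"
      using limsup_subseq_mono[of "Suc \<circ> r" "\<lambda>T. ereal (mean_cost (G i) T)"] r
      by (simp add: avg_cost_eq comp_def strict_mono_def)
    finally show ?thesis .
  qed
  with z(1) that show thesis by blast
qed

lemma lifted_kernel:
  assumes "\<phi> \<in> kernels"
  shows "\<phi> \<circ> \<sigma> \<in> stationary_kernels (states M)"
  using measurable_comp[OF \<sigma>_measurable assms[unfolded stationary_kernels_def]]
  by (simp add: stationary_kernels_def)

text \<open>For a stationary kernel the Poisson equation is an equality after averaging over the action, so the defect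
  in \<open>M\<close> is bounded on both sides, and the time averages stay within \<open>\<eta>\<close> of the gain.\<close>

lemma lifted_kernel_average:
  assumes \<phi>: "\<phi> \<in> kernels"
  shows "ereal (perf \<phi> $ i - \<eta>) \<le> avg_cost M (G i) (stationary (\<phi> \<circ> \<sigma>))"
    and "avg_cost M (G i) (stationary (\<phi> \<circ> \<sigma>)) \<le> ereal (perf \<phi> $ i + \<eta>)"
proof -
  note lift = lifted_kernel[OF \<phi>]
  interpret controlled_process M "stationary (\<phi> \<circ> \<sigma>)"
    by (rule controlled_process.intro[OF init trans stationary_in_policies[OF lift]])
  define H where "H = B / (1 - \<alpha>)"
  define g where "g = perf \<phi> $ i"
  obtain h where h: "poisson_pair Y (avg_P \<phi>) (avg_C \<phi> i) g h"
    and hb: "\<And>y. y \<in> Y \<Longrightarrow> \<bar>h y\<bar> \<le> H"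
    using gain_poisson[OF avg_P_doeblin[OF \<phi>] avg_C_bound[OF \<phi>, of i]]
    unfolding g_def perf_def vec_lambda_beta H_def by blast
  have hb': "\<bar>h (\<sigma> x)\<bar> \<le> H" if "x \<in> space (states M)" for x
    by (rule hb[OF \<sigma>_in[OF that]])
  have Gb: "\<bar>G i z\<bar> \<le> B + e1" if "z \<in> space N" for z
    by (rule G_bound[OF that])
  have lift_h: "(\<lambda>x. h (\<sigma> x)) \<in> borel_measurable (states M)"
    by (rule lift_measurable)
  have drift: "\<bar>\<integral>a. drift (G i) g (\<lambda>x. h (\<sigma> x)) (x, a) \<partial>(\<phi> \<circ> \<sigma>) x\<bar> \<le> e1 + e2 * H"
    if x: "x \<in> space (states M)" for x
  proof -
    define y where "y = \<sigma> x"
    have y: "y \<in> Y" unfolding y_def by (rule \<sigma>_in[OF x])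
    have \<phi>y: "\<phi> y \<in> space (prob_algebra borel)" using \<phi> y by (simp add: kernels_prob)
    then interpret A: prob_space "\<phi> y" by (simp add: space_prob_algebra)
    let ?D = "\<lambda>a. drift (G i) g (\<lambda>x. h (\<sigma> x)) (x, a)"
    let ?k = "\<lambda>a. C i (y, a) + (\<Sum>y'\<in>Y. P y a y' * h y') - g - h y"
    have Dm: "?D \<in> borel_measurable borel"
      using measurable_compose[OF measurable_Pair1'[OF x] drift_measurable[OF G_measurable Gb lift_h hb']] .
    have km: "?k \<in> borel_measurable borel"
      using C_measurable[OF y] P_measurable[OF y] by simp
    have D_int: "integrable (\<phi> y) ?D"
      by (rule integrable_prob_algebra[OF \<phi>y Dm])
        (rule drift_bound[OF G_measurable Gb lift_h hb'],
          simp_all add: space_pair_measure x)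
    have k_int: "integrable (\<phi> y) ?k"
      using C_integrable[OF \<phi> y] P_integrable[OF \<phi> y] by simp
    have "(\<integral>a. ?k a \<partial>\<phi> y) = avg_C \<phi> i y + (\<Sum>y'\<in>Y. avg_P \<phi> y y' * h y') - g - h y"
      using C_integrable[OF \<phi> y] P_integrable[OF \<phi> y]
      by (simp add: avg_C_def avg_P_def A.prob_space)
    then have "(\<integral>a. ?k a \<partial>\<phi> y) = 0"
      using h[unfolded poisson_pair_def, rule_format, OF y] by linarith
    then have "(\<integral>a. ?D a \<partial>\<phi> y) = (\<integral>a. ?D a - ?k a \<partial>\<phi> y)"
      using D_int k_int by simp
    also have "\<bar>\<dots>\<bar> \<le> e1 + e2 * H"
    proof (rule integral_prob_algebra_bound[OF \<phi>y])
      show "(\<lambda>a. ?D a - ?k a) \<in> borel_measurable borel" using Dm km by simp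
      show "\<bar>?D a - ?k a\<bar> \<le> e1 + e2 * H" for a
      proof -
        have "\<bar>(\<integral>x'. h (\<sigma> x') \<partial>trans M (x, a)) - (\<Sum>y'\<in>Y. P y a y' * h y')\<bar> \<le> e2 * H"
          unfolding y_def by (rule trans_close[OF x]) (use hb in blast)
        moreover have "\<bar>G i (x, a) - C i (y, a)\<bar> \<le> e1"
          unfolding y_def by (rule G_close[OF x])
        ultimately show ?thesis
          unfolding drift_def fst_conv y_def by linarith
      qed
    qed
    finally show ?thesis by (simp add: y_def)
  qed
  have near: "\<bar>mean_cost (G i) T - g\<bar> \<le> (e1 + e2 * H) + 2 * H / real T" if "0 < T" for T
    by (rule mean_cost_stationary[where h = "\<lambda>x. h (\<sigma> x)", OF G_measurable Gb lift_h hb' that refl lift drift])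
  have "e1 + e2 * H \<le> \<eta>" using \<eta>_ge by (simp add: H_def)
  then have close: "\<bar>mean_cost (G i) T - g\<bar> \<le> \<eta> + 2 * H / real T" if "0 < T" for T
    using near[OF that] by linarith
  have lim: "limsup (\<lambda>T. ereal (c + s * (2 * H / real T))) = ereal c" for c s
  proof (rule lim_imp_Limsup)
    have "(\<lambda>T. c + s * (2 * H / real T)) \<longlonglongrightarrow> c + s * 0"
      by (intro tendsto_intros lim_const_over_n)
    then show "(\<lambda>T. ereal (c + s * (2 * H / real T))) \<longlonglongrightarrow> ereal c" by simp
  qed simp
  have "limsup (\<lambda>T. ereal (g - \<eta> + (- 1) * (2 * H / real T))) \<le> limsup (\<lambda>T. ereal (mean_cost (G i) T))"
  proof (intro Limsup_mono eventually_mono[OF eventually_gt_at_top[of 0]])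
    fix T :: nat assume "0 < T"
    from close[OF this] show "ereal (g - \<eta> + (- 1) * (2 * H / real T)) \<le> ereal (mean_cost (G i) T)"
      unfolding ereal_less_eq by linarith
  qed
  then show "ereal (perf \<phi> $ i - \<eta>) \<le> avg_cost M (G i) (stationary (\<phi> \<circ> \<sigma>))"
    unfolding lim avg_cost_eq g_def .
  have "limsup (\<lambda>T. ereal (mean_cost (G i) T)) \<le> limsup (\<lambda>T. ereal (g + \<eta> + 1 * (2 * H / real T)))"
  proof (intro Limsup_mono eventually_mono[OF eventually_gt_at_top[of 0]])
    fix T :: nat assume "0 < T"
    from close[OF this] show "ereal (mean_cost (G i) T) \<le> ereal (g + \<eta> + 1 * (2 * H / real T))"
      unfolding ereal_less_eq by linarith
  qed
  then show "avg_cost M (G i) (stationary (\<phi> \<circ> \<sigma>)) \<le> ereal (perf \<phi> $ i + \<eta>)"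
    unfolding lim avg_cost_eq g_def .
qed

end

section \<open>Total variation and integrals over a partition\<close>

lemma abs_measure_diff_le_tv_dist:
  assumes M: "prob_space M" and N: "prob_space N" and E: "E \<in> sets M"
  shows "\<bar>measure M E - measure N E\<bar> \<le> tv_dist M N"
  unfolding tv_dist_def
proof (rule cSUP_upper[OF E])
  have "\<bar>measure M F - measure N F\<bar> \<le> 1" for F
    using prob_space.prob_le_1[OF M, of F] prob_space.prob_le_1[OF N, of F]
      measure_nonneg[of M F] measure_nonneg[of N F] by linarith
  then show "bdd_above ((\<lambda>F. \<bar>measure M F - measure N F\<bar>) ` sets M)"
    by (intro bdd_aboveI[of _ 1]) auto
qed

text \<open>Since all the measures have the same measurable sets, the distance at \<open>w\<close> is a supremum over an index set
  that does not depend on \<open>w\<close>, and it dominates the difference on each single set.\<close>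

lemma tv_continuous_kernel:
  fixes p :: "'z::topological_space \<Rightarrow> 'x::topological_space measure"
  assumes tv: "tv_continuous p" and p: "\<And>z. p z \<in> space (prob_algebra borel)"
  shows "((\<lambda>w. SUP E\<in>sets borel. \<bar>measure (p w) E - measure (p z) E\<bar>) \<longlongrightarrow> 0) (at z)"
    and "E \<in> sets borel \<Longrightarrow> \<bar>measure (p w) E - measure (p z) E\<bar> \<le> (SUP E\<in>sets borel. \<bar>measure (p w) E - measure (p z) E\<bar>)"
proof -
  have s: "sets (p w) = sets borel" "prob_space (p w)" for w using p[of w] by (auto simp: space_prob_algebra)
  have "(SUP E\<in>sets borel. \<bar>measure (p w) E - measure (p z) E\<bar>) = tv_dist (p w) (p z)" for w
    by (simp add: tv_dist_def s)
  with tv abs_measure_diff_le_tv_dist[OF s(2) s(2)]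
  show "((\<lambda>w. SUP E\<in>sets borel. \<bar>measure (p w) E - measure (p z) E\<bar>) \<longlongrightarrow> 0) (at z)"
    "E \<in> sets borel \<Longrightarrow> \<bar>measure (p w) E - measure (p z) E\<bar> \<le> (SUP E\<in>sets borel. \<bar>measure (p w) E - measure (p z) E\<bar>)"
    by (simp_all add: tv_continuous_def s)
qed

lemma tv_continuous_measure:
  fixes p :: "'z::topological_space \<Rightarrow> 'x::topological_space measure"
  assumes tv: "tv_continuous p" and p: "\<And>z. p z \<in> space (prob_algebra borel)" and E: "E \<in> sets borel"
  shows "continuous_on UNIV (\<lambda>z. measure (p z) E)"
  unfolding continuous_on_def
proof
  fix z
  have "((\<lambda>w. measure (p w) E - measure (p z) E) \<longlongrightarrow> 0) (at z)"
    by (rule Lim_null_comparison[OF _ tv_continuous_kernel(1)[OF tv p]])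
      (use tv_continuous_kernel(2)[OF tv p E] in auto)
  then show "((\<lambda>w. measure (p w) E) \<longlongrightarrow> measure (p z) E) (at z within UNIV)"
    by (simp add: LIM_zero_iff)
qed

text \<open>Continuity in total variation is equicontinuity of the family of functions \<open>\<lambda>z. measure (p z) E\<close>
  indexed by the Borel sets \<open>E\<close>; on a compact space it is uniform.\<close>

lemma tv_uniformly_continuous:
  fixes p :: "'z::metric_space \<Rightarrow> 'x::topological_space measure"
  assumes "compact (UNIV :: 'z set)" and tv: "tv_continuous p"
    and p: "\<And>z. p z \<in> space (prob_algebra borel)" and e: "0 < e"
  obtains \<delta> where "0 < \<delta>" "\<And>z w E. dist z w < \<delta> \<Longrightarrow> E \<in> sets borel \<Longrightarrow> \<bar>measure (p z) E - measure (p w) E\<bar> < e"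
proof -
  obtain \<delta> where \<delta>: "0 < \<delta>"
    "\<And>f x x'. f \<in> (\<lambda>E z. measure (p z) E) ` sets borel \<Longrightarrow> x \<in> UNIV \<Longrightarrow> x' \<in> UNIV \<Longrightarrow> dist x' x < \<delta> \<Longrightarrow> dist (f x') (f x) < e"
  proof (rule compact_uniformly_equicontinuous[OF assms(1) _ e, of "(\<lambda>E z. measure (p z) E) ` sets borel"])
    fix z and \<epsilon> :: real assume "0 < \<epsilon>"
    with tv_continuous_kernel(1)[OF tv p, of z]
    obtain \<delta> where \<delta>: "0 < \<delta>" "\<And>w. w \<noteq> z \<Longrightarrow> dist w z < \<delta> \<Longrightarrow>
        \<bar>SUP E\<in>sets borel. \<bar>measure (p w) E - measure (p z) E\<bar>\<bar> < \<epsilon>"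
      unfolding tendsto_iff eventually_at by (auto simp: dist_norm)
    have "\<bar>measure (p w) E - measure (p z) E\<bar> < \<epsilon>" if "dist w z < \<delta>" "E \<in> sets borel" for w E
    proof (cases "w = z")
      case False
      then show ?thesis
        using \<delta>(2)[OF False that(1)] tv_continuous_kernel(2)[OF tv p that(2), where w = w and z = z] by linarith
    qed (simp add: \<open>0 < \<epsilon>\<close>)
    with \<delta>(1) show "\<exists>\<delta>. 0 < \<delta> \<and> (\<forall>f\<in>(\<lambda>E z. measure (p z) E) ` sets borel. \<forall>x'\<in>UNIV. dist x' z < \<delta> \<longrightarrow> dist (f x') (f z) < \<epsilon>)"
      by (intro exI[of _ \<delta>]) (auto simp: dist_real_def)
  qed blast
  show thesis
  proof (rule that[OF \<delta>(1)])
    fix z w :: 'z and E assume "dist z w < \<delta>" "E \<in> sets (borel :: 'x measure)"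
    with \<delta>(2)[of "\<lambda>z. measure (p z) E" w z] show "\<bar>measure (p z) E - measure (p w) E\<bar> < e"
      by (simp add: dist_real_def)
  qed
qed

lemma continuous_integral_parameter:
  fixes g :: "'x::polish_space \<times> 'a::polish_space \<Rightarrow> real"
  assumes M: "M \<in> space (prob_algebra borel)" and g: "continuous_on UNIV g" and b: "\<And>z. \<bar>g z\<bar> \<le> B"
  shows "continuous_on UNIV (\<lambda>a. \<integral>z. g (z, a) \<partial>M)"
  unfolding continuous_on_sequentially
proof (intro allI ballI impI, elim conjE)
  fix X :: "nat \<Rightarrow> 'a" and a
  assume X: "X \<longlonglongrightarrow> a"
  have s: "sets M = sets borel" and "prob_space M" using M by (auto simp: space_prob_algebra)
  then interpret prob_space M by simp
  have m: "(\<lambda>z. g (z, a)) \<in> borel_measurable M" for a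
    unfolding measurable_cong_sets[OF s refl]
    by (intro borel_measurable_continuous_onI continuous_on_compose2[OF g] continuous_intros) auto
  have "(\<lambda>n. \<integral>z. g (z, X n) \<partial>M) \<longlonglongrightarrow> (\<integral>z. g (z, a) \<partial>M)"
  proof (rule integral_dominated_convergence[where w = "\<lambda>_. B"])
    show "AE z in M. (\<lambda>n. g (z, X n)) \<longlonglongrightarrow> g (z, a)"
    proof (rule AE_I2)
      fix z :: 'x
      have "(\<lambda>n. (z, X n)) \<longlonglongrightarrow> (z, a)" by (intro tendsto_intros X)
      then show "(\<lambda>n. g (z, X n)) \<longlonglongrightarrow> g (z, a)"
        using g by (metis UNIV_I continuous_on_tendsto_compose eventually_sequentiallyI)
    qed
  qed (use m b in auto)
  then show "((\<lambda>a. \<integral>z. g (z, a) \<partial>M) \<circ> X) \<longlonglongrightarrow> (\<integral>z. g (z, a) \<partial>M)"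
    by (simp add: comp_def)
qed

lemma integral_finite_range:
  fixes h :: "'x \<Rightarrow> real"
  assumes M: "M \<in> space (prob_algebra borel)" and Y: "finite Y" and Q: "\<And>x. Q x \<in> Y"
    and Qm: "\<And>y. y \<in> Y \<Longrightarrow> Q -` {y} \<in> sets borel"
  shows "(\<integral>x. h (Q x) \<partial>M) = (\<Sum>y\<in>Y. measure M (Q -` {y}) * h y)"
proof -
  have s: "sets M = sets borel" and "prob_space M" using M by (auto simp: space_prob_algebra)
  then interpret prob_space M by simp
  have "h (Q x) = (\<Sum>y\<in>Y. indicator (Q -` {y}) x * h y)" for x
    using Y Q[of x] by (simp add: indicator_def if_distrib cong: if_cong)
  then have "(\<integral>x. h (Q x) \<partial>M) = (\<integral>x. (\<Sum>y\<in>Y. indicator (Q -` {y}) x * h y) \<partial>M)" by simp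
  also have "\<dots> = (\<Sum>y\<in>Y. \<integral>x. indicator (Q -` {y}) x * h y \<partial>M)"
    using Qm s by (intro Bochner_Integration.integral_sum integrable_mult_left) (simp add: integrable_indicator_iff emeasure_eq_measure)
  also have "\<dots> = (\<Sum>y\<in>Y. measure M (Q -` {y}) * h y)"
    using Qm s by (intro sum.cong refl) (simp add: sets_eq_imp_space_eq[OF s])
  finally show ?thesis .
qed

text \<open>The cells on which the difference of the two measures is nonnegative, and the remaining ones, form two sets; each of
  them contributes at most \<open>e * H\<close>, independently of the number of cells.\<close>

lemma integral_diff_finite_range:
  fixes h :: "'x \<Rightarrow> real"
  assumes M: "M \<in> space (prob_algebra borel)" and N: "N \<in> space (prob_algebra borel)"
    and Y: "finite Y" and Q: "\<And>x. Q x \<in> Y" and Qm: "\<And>y. y \<in> Y \<Longrightarrow> Q -` {y} \<in> sets borel"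
    and e: "\<And>E. E \<in> sets borel \<Longrightarrow> \<bar>measure M E - measure N E\<bar> \<le> e"
    and h: "\<And>y. y \<in> Y \<Longrightarrow> \<bar>h y\<bar> \<le> H"
  shows "\<bar>(\<integral>x. h (Q x) \<partial>M) - (\<integral>x. h (Q x) \<partial>N)\<bar> \<le> 2 * e * H"
proof -
  have sM: "sets M = sets borel" "prob_space M" and sN: "sets N = sets borel" "prob_space N"
    using M N by (auto simp: space_prob_algebra)
  define \<Delta> where "\<Delta> E = measure M E - measure N E" for E
  have union: "(\<Sum>y\<in>S. \<Delta> (Q -` {y})) = \<Delta> (Q -` S)" if S: "S \<subseteq> Y" for S
  proof -
    have "finite S" using S Y by (rule finite_subset)
    then have "measure L (\<Union>y\<in>S. Q -` {y}) = (\<Sum>y\<in>S. measure L (Q -` {y}))"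
      if "sets L = sets borel" "prob_space L" for L
      using S Qm that
      by (intro finite_measure.finite_measure_finite_Union) (auto simp: prob_space.finite_measure disjoint_family_on_def)
    moreover have "(\<Union>y\<in>S. Q -` {y}) = Q -` S" by auto
    ultimately show ?thesis
      using sM sN by (simp add: \<Delta>_def sum_subtractf)
  qed
  have small: "\<bar>\<Delta> (Q -` S)\<bar> \<le> e" if S: "S \<subseteq> Y" for S
  proof -
    have "(\<Union>y\<in>S. Q -` {y}) \<in> sets borel"
      using S Y Qm by (intro sets.finite_UN) (auto intro: finite_subset)
    moreover have "(\<Union>y\<in>S. Q -` {y}) = Q -` S" by auto
    ultimately show ?thesis using e by (simp add: \<Delta>_def)
  qed
  obtain y0 where "y0 \<in> Y" using Q by blast
  then have H: "0 \<le> H" using h[of y0] by linarith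
  define S where "S = {y\<in>Y. 0 \<le> \<Delta> (Q -` {y})}"
  have S: "S \<subseteq> Y" by (auto simp: S_def)
  have "(\<integral>x. h (Q x) \<partial>M) - (\<integral>x. h (Q x) \<partial>N) = (\<Sum>y\<in>Y. \<Delta> (Q -` {y}) * h y)"
    using integral_finite_range[OF M Y Q Qm, of h] integral_finite_range[OF N Y Q Qm, of h]
    by (simp add: \<Delta>_def left_diff_distrib sum_subtractf)
  also have "\<bar>\<dots>\<bar> \<le> (\<Sum>y\<in>Y. \<bar>\<Delta> (Q -` {y})\<bar> * H)"
    by (rule order_trans[OF sum_abs sum_mono]) (simp add: abs_mult mult_left_mono h)
  also have "\<dots> = (\<Sum>y\<in>Y. \<bar>\<Delta> (Q -` {y})\<bar>) * H" by (simp add: sum_distrib_right)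
  also have "(\<Sum>y\<in>Y. \<bar>\<Delta> (Q -` {y})\<bar>) = (\<Sum>y\<in>S. \<bar>\<Delta> (Q -` {y})\<bar>) + (\<Sum>y\<in>Y - S. \<bar>\<Delta> (Q -` {y})\<bar>)"
    by (rule sum.subset_diff[OF S Y, THEN trans]) simp
  also have "(\<Sum>y\<in>S. \<bar>\<Delta> (Q -` {y})\<bar>) = (\<Sum>y\<in>S. \<Delta> (Q -` {y}))"
    by (intro sum.cong) (auto simp: S_def)
  also have "(\<Sum>y\<in>Y - S. \<bar>\<Delta> (Q -` {y})\<bar>) = - (\<Sum>y\<in>Y - S. \<Delta> (Q -` {y}))"
    unfolding sum_negf[symmetric] by (intro sum.cong) (auto simp: S_def)
  also have "((\<Sum>y\<in>S. \<Delta> (Q -` {y})) + - (\<Sum>y\<in>Y - S. \<Delta> (Q -` {y}))) * H \<le> 2 * e * H"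
    unfolding union[OF S] union[OF Diff_subset] using small[OF S] small[OF Diff_subset, of S] H
    by (intro mult_right_mono) linarith+
  finally show ?thesis .
qed

section \<open>Quantization of the state space\<close>

text \<open>One stage of the approximation. The mesh of the grid enters only through the oscillations \<open>e1\<close> and \<open>e2\<close> of the costs and of
  the kernel on a cell.\<close>

locale quantized_model =
  fixes p :: "'x::polish_space \<times> 'a::polish_space \<Rightarrow> 'x measure"
    and \<gamma> \<mu> \<nu> :: "'x measure" and Y :: "'x set" and Q :: "'x \<Rightarrow> 'x"
    and D :: "'i::finite \<Rightarrow> 'x \<times> 'a \<Rightarrow> real" and B \<alpha> e1 e2 :: real
  assumes compact_actions: "compact (UNIV :: 'a set)"
    and p: "p \<in> borel \<Otimes>\<^sub>M borel \<rightarrow>\<^sub>M prob_algebra borel"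
    and p_tv: "tv_continuous p"
    and D_cont: "\<And>i. continuous_on UNIV (D i)"
    and D_bound: "\<And>i z. \<bar>D i z\<bar> \<le> B"
    and \<gamma>: "\<gamma> \<in> space (prob_algebra borel)"
    and \<mu>: "\<mu> \<in> space (prob_algebra borel)"
    and \<alpha>: "0 < \<alpha>" "\<alpha> < 1"
    and minorization: "\<And>z E. E \<in> sets borel \<Longrightarrow> (1 - \<alpha>) * measure \<mu> E \<le> measure (p z) E"
    and finite_Y: "finite Y"
    and Q: "Q \<in> borel \<rightarrow>\<^sub>M borel" and Q_in: "\<And>x. Q x \<in> Y"
    and cell: "\<And>y. y \<in> Y \<Longrightarrow> cell_measure \<nu> Q y \<in> space (prob_algebra borel)"
    and \<nu>_sets: "sets \<nu> = sets borel"
    and D_close: "\<And>i x z a. Q x = Q z \<Longrightarrow> \<bar>D i (x, a) - D i (z, a)\<bar> \<le> e1"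
    and p_close: "\<And>x z a E. Q x = Q z \<Longrightarrow> E \<in> sets borel \<Longrightarrow>
      \<bar>measure (p (x, a)) E - measure (p (z, a)) E\<bar> \<le> e2"
begin

definition cell_weight :: "'x \<Rightarrow> real" where "cell_weight y = measure \<mu> (Q -` {y})"

definition P :: "'x \<Rightarrow> 'a \<Rightarrow> 'x \<Rightarrow> real"
  where "P y a y' = (\<integral>z. measure (p (z, a)) (Q -` {y'}) \<partial>cell_measure \<nu> Q y)"

definition C :: "'i \<Rightarrow> 'x \<times> 'a \<Rightarrow> real" where "C i = fin_cost Q \<nu> (D i)"

lemma C_eq: "C i (y, a) = (\<integral>z. D i (z, a) \<partial>cell_measure \<nu> Q y)"
  by (simp add: C_def fin_cost_def)

lemma cell_sets: "Q -` {y} \<in> sets borel"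
  using measurable_sets[OF Q, of "{y}"] by simp

lemma Q_count: "Q \<in> borel \<rightarrow>\<^sub>M count_space Y"
  using Q_in finite_Y by (subst measurable_count_space_eq2) (auto intro: cell_sets)

lemma p_prob: "p z \<in> space (prob_algebra borel)"
  by (rule measurable_space[OF p]) (simp add: space_pair_measure)

lemma kernel_slice: "(\<lambda>z. p (z, a)) \<in> borel \<rightarrow>\<^sub>M prob_algebra borel"
  by (rule measurable_compose[OF _ p]) simp

lemma section_measurable:
  fixes g :: "'x \<times> 'a \<Rightarrow> real"
  assumes "continuous_on UNIV g"
  shows "(\<lambda>z. g (z, a)) \<in> borel_measurable borel"
  by (intro borel_measurable_continuous_onI continuous_on_compose2[OF assms] continuous_intros) auto

lemma p_cont: "E \<in> sets borel \<Longrightarrow> continuous_on UNIV (\<lambda>z. measure (p z) E)"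
  by (rule tv_continuous_measure[OF p_tv p_prob])

lemma p_le_1: "\<bar>measure (p z) E\<bar> \<le> 1"
  using p_prob[of z] by (simp add: space_prob_algebra prob_space.prob_le_1)

lemma lift_measurable: "(\<lambda>x. h (Q x)) \<in> borel_measurable borel" for h :: "'x \<Rightarrow> real"
  by (rule measurable_compose[OF Q_count]) simp

definition next_mean :: "('x \<Rightarrow> real) \<Rightarrow> 'x \<times> 'a \<Rightarrow> real"
  where "next_mean h z = (\<integral>x'. h (Q x') \<partial>p z)"

lemma next_mean_eq: "next_mean h z = (\<Sum>y\<in>Y. measure (p z) (Q -` {y}) * h y)"
  unfolding next_mean_def by (rule integral_finite_range[OF p_prob finite_Y Q_in cell_sets])

lemma next_mean_measurable: "(\<lambda>z. next_mean h (z, a)) \<in> borel_measurable borel"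
  unfolding next_mean_eq by (intro borel_measurable_sum borel_measurable_times section_measurable[OF p_cont[OF cell_sets]]) simp

text \<open>One step of the finite chain is one step of \<open>p\<close> averaged over the starting cell. All three comparisons of a
  model with the finite data reduce to this.\<close>

lemma sum_P:
  assumes y: "y \<in> Y"
  shows "(\<Sum>y'\<in>Y. P y a y' * h y') = (\<integral>z. next_mean h (z, a) \<partial>cell_measure \<nu> Q y)"
  unfolding next_mean_eq P_def
  by (subst Bochner_Integration.integral_sum)
    (auto intro!: integrable_mult_left integrable_prob_algebra[OF cell[OF y] section_measurable[OF p_cont[OF cell_sets]] p_le_1])

lemma cell_average_close:
  fixes f :: "'x \<Rightarrow> real"
  assumes y: "y \<in> Y" and f: "f \<in> borel_measurable borel" and b: "\<And>z. \<bar>f z\<bar> \<le> K"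
    and close: "\<And>z. Q z = y \<Longrightarrow> \<bar>c - f z\<bar> \<le> e"
  shows "\<bar>c - (\<integral>z. f z \<partial>cell_measure \<nu> Q y)\<bar> \<le> e"
proof -
  have s: "sets (cell_measure \<nu> Q y) = sets borel" and "prob_space (cell_measure \<nu> Q y)"
    using cell[OF y] by (auto simp: space_prob_algebra)
  then interpret prob_space "cell_measure \<nu> Q y" by simp
  have int: "integrable (cell_measure \<nu> Q y) f"
    by (rule integrable_prob_algebra[OF cell[OF y] f b])
  have "AE z in cell_measure \<nu> Q y. \<bar>c - f z\<bar> \<le> e"
    unfolding cell_measure_def
    by (rule AE_uniform_measureI) (auto simp: \<nu>_sets cell_sets close)
  then have "(\<integral>z. \<bar>c - f z\<bar> \<partial>cell_measure \<nu> Q y) \<le> e"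
    using int by (intro integral_le_const) auto
  moreover have "c - (\<integral>z. f z \<partial>cell_measure \<nu> Q y) = (\<integral>z. c - f z \<partial>cell_measure \<nu> Q y)"
    using int by (simp add: prob_space)
  moreover have "\<bar>\<integral>z. c - f z \<partial>cell_measure \<nu> Q y\<bar> \<le> (\<integral>z. \<bar>c - f z\<bar> \<partial>cell_measure \<nu> Q y)"
    by (rule integral_abs_bound)
  ultimately show ?thesis by (simp only:)
qed

lemma finite_Q_sum: "N \<in> space (prob_algebra borel) \<Longrightarrow> (\<Sum>y\<in>Y. measure N (Q -` {y})) = 1"
  using integral_finite_range[OF _ finite_Y Q_in cell_sets, of N "\<lambda>_. 1"]
  by (auto simp: space_prob_algebra prob_space.prob_space)

sublocale doeblin Y cell_weight \<alpha>
  by unfold_locales (use \<alpha> finite_Y finite_Q_sum[OF \<mu>] in \<open>auto simp: cell_weight_def\<close>)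

sublocale finite_model Y cell_weight \<alpha> P C B
proof
  show "compact (UNIV :: 'a set)" by (rule compact_actions)
  fix y assume y: "y \<in> Y"
  have cp: "prob_space (cell_measure \<nu> Q y)" using cell[OF y] by (simp add: space_prob_algebra)
  then interpret cp: prob_space "cell_measure \<nu> Q y" .
  show "minorized (P y a)" for a
    unfolding minorized_def
  proof (intro conjI ballI)
    have one: "next_mean (\<lambda>_. 1) z = 1" for z
      unfolding next_mean_eq using finite_Q_sum[OF p_prob] by simp
    show "sum (P y a) Y = 1"
      using sum_P[OF y, of a "\<lambda>_. 1"] cp by (simp add: one prob_space.prob_space)
    show "(1 - \<alpha>) * cell_weight y' \<le> P y a y'" for y'
      unfolding P_def cell_weight_def
      by (intro cp.integral_ge_const integrable_prob_algebra[OF cell[OF y] section_measurable[OF p_cont[OF cell_sets]] p_le_1])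
        (auto intro: minorization cell_sets)
  qed
  show "continuous_on UNIV (\<lambda>a. P y a y')" for y'
    unfolding P_def
    by (rule continuous_integral_parameter[where g = "\<lambda>w. measure (p w) (Q -` {y'})", OF cell[OF y] p_cont[OF cell_sets] p_le_1])
  show "continuous_on UNIV (\<lambda>a. C i (y, a))" for i
    unfolding C_eq by (rule continuous_integral_parameter[OF cell[OF y] D_cont D_bound])
  show "\<bar>C i (y, a)\<bar> \<le> B" for i a
    unfolding C_eq by (rule integral_prob_algebra_bound[OF cell[OF y] section_measurable[OF D_cont] D_bound])
qed

lemma D_measurable: "D i \<in> borel_measurable (borel \<Otimes>\<^sub>M borel)"
  unfolding borel_prod by (rule borel_measurable_continuous_onI[OF D_cont])

lemma next_mean_bound:
  assumes "\<And>y. y \<in> Y \<Longrightarrow> \<bar>h y\<bar> \<le> H" shows "\<bar>next_mean h z\<bar> \<le> H"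
  unfolding next_mean_def
  by (rule integral_prob_algebra_bound[OF p_prob]) (auto intro: lift_measurable assms Q_in)

lemma e_nonneg: "0 \<le> e1" "0 \<le> e2"
proof -
  show "0 \<le> e1" using D_close[of undefined undefined undefined] by fastforce
  show "0 \<le> e2" using p_close[of undefined undefined "{}" undefined] by simp
qed

sublocale orig: approximation Y cell_weight \<alpha> P C B "orig_mdp p \<gamma>" Q D e1 "2 * e2"
proof
  show "\<bar>D i (x, a) - C i (Q x, a)\<bar> \<le> e1" for i x a
    unfolding C_eq by (rule cell_average_close[OF Q_in section_measurable[OF D_cont] D_bound]) (rule D_close, simp)
  fix x a h and H :: real assume h: "\<forall>y\<in>Y. \<bar>h y\<bar> \<le> H"
  have "\<bar>next_mean h (x, a) - (\<integral>z. next_mean h (z, a) \<partial>cell_measure \<nu> Q (Q x))\<bar> \<le> 2 * e2 * H"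
  proof (rule cell_average_close[OF Q_in next_mean_measurable next_mean_bound])
    show "\<bar>h y\<bar> \<le> H" if "y \<in> Y" for y using h that by blast
    fix z assume "Q z = Q x"
    then show "\<bar>next_mean h (x, a) - next_mean h (z, a)\<bar> \<le> 2 * e2 * H"
      unfolding next_mean_def using h
      by (intro integral_diff_finite_range[OF p_prob p_prob finite_Y Q_in cell_sets p_close]) auto
  qed
  then show "\<bar>(\<integral>x'. h (Q x') \<partial>trans (orig_mdp p \<gamma>) (x, a)) - (\<Sum>y'\<in>Y. P (Q x) a y' * h y')\<bar> \<le> 2 * e2 * H"
    unfolding sum_P[OF Q_in] by (simp add: orig_mdp_def next_mean_def)
qed (use p \<gamma> Q_count D_measurable e_nonneg in \<open>auto simp: orig_mdp_def\<close>)

sublocale bar: approximation Y cell_weight \<alpha> P C B "bar_mdp Q \<nu> p \<gamma>" Q "\<lambda>i. bar_cost Q \<nu> (D i)" 0 0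
proof
  have eq: "bar_cost Q \<nu> (D i) (x, a) = C i (Q x, a)" for i x a
    by (simp add: bar_cost_def C_eq)
  show "\<bar>bar_cost Q \<nu> (D i) (x, a) - C i (Q x, a)\<bar> \<le> 0" for i x a by (simp add: eq)
  have "(\<lambda>(y, a). C i (y, a)) \<in> borel_measurable (count_space Y \<Otimes>\<^sub>M borel)" for i
    by (rule measurable_pair_measure_countable1) (auto simp: finite_Y countable_finite intro: C_measurable)
  from measurable_compose[OF measurable_Pair[OF measurable_compose[OF measurable_fst Q_count] measurable_snd] this]
  have "(\<lambda>w. C i (Q (fst w), snd w)) \<in> borel_measurable (borel \<Otimes>\<^sub>M borel)" for i
    by simp
  then show "bar_cost Q \<nu> (D i) \<in> borel_measurable (states (bar_mdp Q \<nu> p \<gamma>) \<Otimes>\<^sub>M borel)" for i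
    by (simp add: bar_mdp_def eq[symmetric])
  show "trans (bar_mdp Q \<nu> p \<gamma>) \<in> states (bar_mdp Q \<nu> p \<gamma>) \<Otimes>\<^sub>M borel \<rightarrow>\<^sub>M prob_algebra (states (bar_mdp Q \<nu> p \<gamma>))"
    using bar_mdp_trans[OF p Q Q_in finite_Y cell] by (simp add: bar_mdp_def)
  fix x a h and H :: real assume h: "\<forall>y\<in>Y. \<bar>h y\<bar> \<le> H"
  have "(\<integral>x'. h (Q x') \<partial>trans (bar_mdp Q \<nu> p \<gamma>) (x, a)) = (\<integral>z. next_mean h (z, a) \<partial>cell_measure \<nu> Q (Q x))"
    unfolding next_mean_def bar_mdp_def mdp.simps prod.case
    by (rule integral_bind_bounded[OF cell[OF Q_in] kernel_slice, where B = H])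
      (use h Q_in in \<open>auto intro: lift_measurable\<close>)
  then show "\<bar>(\<integral>x'. h (Q x') \<partial>trans (bar_mdp Q \<nu> p \<gamma>) (x, a)) - (\<Sum>y'\<in>Y. P (Q x) a y' * h y')\<bar> \<le> 0 * H"
    unfolding sum_P[OF Q_in] by simp
qed (use \<gamma> Q_count in \<open>auto simp: bar_mdp_def\<close>)

sublocale fin: approximation Y cell_weight \<alpha> P C B "fin_mdp Y Q \<nu> p \<gamma>" "\<lambda>y. y" C 0 0
proof
  have "(\<lambda>(y, a). C i (y, a)) \<in> borel_measurable (count_space Y \<Otimes>\<^sub>M borel)" for i
    by (rule measurable_pair_measure_countable1) (auto simp: finite_Y countable_finite intro: C_measurable)
  then show "C i \<in> borel_measurable (states (fin_mdp Y Q \<nu> p \<gamma>) \<Otimes>\<^sub>M borel)" for i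
    by (simp add: fin_mdp_def)
  show "trans (fin_mdp Y Q \<nu> p \<gamma>) \<in> states (fin_mdp Y Q \<nu> p \<gamma>) \<Otimes>\<^sub>M borel \<rightarrow>\<^sub>M prob_algebra (states (fin_mdp Y Q \<nu> p \<gamma>))"
    using fin_mdp_trans[OF p Q Q_in finite_Y cell] by (simp add: fin_mdp_def)
  show "initial (fin_mdp Y Q \<nu> p \<gamma>) \<in> space (prob_algebra (states (fin_mdp Y Q \<nu> p \<gamma>)))"
    using measurable_space[OF measurable_distr_prob_space[OF Q_count] \<gamma>] by (simp add: fin_mdp_def)
  fix x a h and H :: real assume x: "x \<in> space (states (fin_mdp Y Q \<nu> p \<gamma>))"
  then have x': "x \<in> Y" by (simp add: fin_mdp_def)
  have "(\<integral>x'. h x' \<partial>trans (fin_mdp Y Q \<nu> p \<gamma>) (x, a)) = (\<Sum>y'\<in>Y. P x a y' * h y')"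
    unfolding fin_mdp_def mdp.simps prod.case P_def[symmetric]
    using minorized_nonneg[OF P_minorized[OF x']]
    by (subst lebesgue_integral_point_measure_finite) (auto simp: finite_Y)
  then show "\<bar>(\<integral>x'. h x' \<partial>trans (fin_mdp Y Q \<nu> p \<gamma>) (x, a)) - (\<Sum>y'\<in>Y. P x a y' * h y')\<bar> \<le> 0 * H"
    by simp
qed (auto simp: fin_mdp_def)

end

section \<open>Optimality and near-optimality of the quantized policies\<close>

text \<open>When the model agrees exactly with the finite data, averages of policies are dominated by points of
  \<open>achievable\<close> without error, so a stationary kernel that is best among these points is optimal among
  all policies. The objective is the coordinate \<open>None\<close>, the constraints are the coordinates \<open>Some l\<close>.\<close>

lemma stationary_optimal_if_exact:
  fixes C :: "'q::finite option \<Rightarrow> 'x \<times> 'a::topological_space \<Rightarrow> real"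
  assumes approx: "approximation Y w \<alpha> P C B M \<sigma> G 0 0"
    and \<phi>: "\<phi> \<in> stationary_kernels (count_space Y)"
    and feas: "\<And>l. finite_model.perf Y P C \<phi> $ Some l \<le> m $ l"
    and best: "\<And>z. z \<in> finite_model.achievable Y P C \<Longrightarrow> (\<And>l. z $ Some l \<le> m $ l) \<Longrightarrow>
      finite_model.perf Y P C \<phi> $ None \<le> z $ None"
  shows "optimal_policy M (G None) (\<lambda>l. G (Some l)) m (stationary (\<phi> \<circ> \<sigma>))"
proof -
  interpret approximation Y w \<alpha> P C B M \<sigma> G 0 0 by (rule approx)
  have \<eta>: "\<eta> = 0" by (simp add: \<eta>_def)
  have avg: "avg_cost M (G i) (stationary (\<phi> \<circ> \<sigma>)) \<le> ereal (perf \<phi> $ i)" for i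
    using lifted_kernel_average(2)[OF \<phi>, of i] by (simp add: \<eta>)
  have "feasible M (\<lambda>l. G (Some l)) m (stationary (\<phi> \<circ> \<sigma>))"
    unfolding feasible_def
    using stationary_in_policies[OF lifted_kernel[OF \<phi>]] order_trans[OF avg] feas by auto
  moreover have "avg_cost M (G None) (stationary (\<phi> \<circ> \<sigma>)) \<le> avg_cost M (G None) \<pi>"
    if \<pi>: "feasible M (\<lambda>l. G (Some l)) m \<pi>" for \<pi>
  proof -
    obtain z where z: "z \<in> achievable" "\<And>i. ereal (z $ i) \<le> avg_cost M (G i) \<pi>"
      using averages_near_achievable[of \<pi>] \<pi> by (auto simp: feasible_def \<eta>)
    have "ereal (z $ Some l) \<le> ereal (m $ l)" for l
      using z(2)[of "Some l"] \<pi> unfolding feasible_def by (blast intro: order_trans)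
    then have "perf \<phi> $ None \<le> z $ None" using best[OF z(1)] by simp
    then have "avg_cost M (G None) (stationary (\<phi> \<circ> \<sigma>)) \<le> ereal (z $ None)"
      using avg[of None] by (meson ereal_less_eq(3) order_trans)
    then show ?thesis using z(2)[of None] by (rule order_trans)
  qed
  ultimately show ?thesis by (simp add: optimal_policy_def)
qed

theorem theorem6:
  fixes p :: "'x::polish_space \<times> 'a::polish_space \<Rightarrow> 'x measure"
    and c :: "'x \<times> 'a \<Rightarrow> real"
    and d :: "'q::finite \<Rightarrow> 'x \<times> 'a \<Rightarrow> real"
    and k :: "real ^ 'q"
    and \<gamma> \<mu> :: "'x measure"
    and Xn :: "nat \<Rightarrow> 'x set"
    and Q :: "nat \<Rightarrow> 'x \<Rightarrow> 'x"
    and \<nu> :: "nat \<Rightarrow> 'x measure"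
    and \<phi> :: "'x \<times> 'a \<Rightarrow> real"
    and \<alpha> \<kappa> :: real
  assumes compact_X: "compact (UNIV :: 'x set)"
    and compact_A: "compact (UNIV :: 'a set)"
    and p_kernel: "p \<in> borel \<Otimes>\<^sub>M borel \<rightarrow>\<^sub>M prob_algebra borel"
    and c_cont: "continuous_on UNIV c"
    and c_nonneg: "\<And>z. 0 \<le> c z"
    and d_cont: "\<And>l. continuous_on UNIV (d l)"
    and d_nonneg: "\<And>l z. 0 \<le> d l z"
    and k_nonneg: "\<And>l. 0 \<le> k $ l"
    and \<gamma>_prob: "\<gamma> \<in> space (prob_algebra borel)"
    and slater: "\<exists>\<pi> \<in> policies borel. \<forall>l. avg_cost (orig_mdp p \<gamma>) (d l) \<pi> < ereal (k $ l)"
    and Xn_finite: "\<And>n. n \<ge> 1 \<Longrightarrow> finite (Xn n)"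
    and Xn_net: "\<And>n x. n \<ge> 1 \<Longrightarrow> \<exists>y \<in> Xn n. dist x y < 1 / real n"
    and Q_measurable: "\<And>n. n \<ge> 1 \<Longrightarrow> Q n \<in> borel \<rightarrow>\<^sub>M borel"
    and Q_in: "\<And>n x. n \<ge> 1 \<Longrightarrow> Q n x \<in> Xn n"
    and Q_nearest: "\<And>n x y. n \<ge> 1 \<Longrightarrow> y \<in> Xn n \<Longrightarrow> dist x (Q n x) \<le> dist x y"
    and \<nu>_sets: "\<And>n. n \<ge> 1 \<Longrightarrow> sets (\<nu> n) = sets borel"
    and \<nu>_finite: "\<And>n. n \<ge> 1 \<Longrightarrow> finite_measure (\<nu> n)"
    and \<nu>_pos: "\<And>n y. n \<ge> 1 \<Longrightarrow> y \<in> Xn n \<Longrightarrow> measure (\<nu> n) (Q n -` {y}) > 0"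
    and p_tv: "tv_continuous p"
    and \<mu>_prob: "\<mu> \<in> space (prob_algebra borel)"
    and \<alpha>: "0 < \<alpha>" "\<alpha> < 1"
    and \<phi>_measurable: "\<phi> \<in> borel_measurable (borel \<Otimes>\<^sub>M borel)"
    and \<phi>_bounded: "bounded (range \<phi>)"
    and minorization: "\<And>z D. D \<in> sets borel \<Longrightarrow> measure (p z) D \<ge> measure \<mu> D * \<phi> z"
    and \<phi>_lower: "\<And>z. 1 - \<alpha> \<le> \<phi> z"
    and \<kappa>: "\<kappa> > 0"
  shows "\<exists>\<epsilon>>0. \<exists>n\<ge>1.
    let m = k - \<epsilon> *\<^sub>R 1;
        Opt = {\<phi>n \<in> stationary_kernels (count_space (Xn n)).
          optimal_policy (fin_mdp (Xn n) (Q n) (\<nu> n) p \<gamma>)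
            (fin_cost (Q n) (\<nu> n) c) (\<lambda>l. fin_cost (Q n) (\<nu> n) (d l)) m (stationary \<phi>n) \<and>
          optimal_policy (bar_mdp (Q n) (\<nu> n) p \<gamma>)
            (bar_cost (Q n) (\<nu> n) c) (\<lambda>l. bar_cost (Q n) (\<nu> n) (d l)) m (stationary (\<phi>n \<circ> Q n))}
    in Opt \<noteq> {} \<and>
       (\<forall>\<phi>n \<in> Opt.
          \<phi>n \<circ> Q n \<in> stationary_kernels borel \<and>
          feasible (orig_mdp p \<gamma>) d k (stationary (\<phi>n \<circ> Q n)) \<and>
          \<bar>avg_cost (orig_mdp p \<gamma>) c (stationary (\<phi>n \<circ> Q n))
            - optimal_value (orig_mdp p \<gamma>) c d k\<bar> \<le> ereal \<kappa>)"
proof -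
  let ?O = "orig_mdp p \<gamma>"
  define D where "D i = (case i of None \<Rightarrow> c | Some l \<Rightarrow> d l)" for i :: "'q option"
  have D_simps [simp]: "D None = c" "D (Some l) = d l" for l by (simp_all add: D_def)
  have D_cont: "continuous_on UNIV (D i)" for i
    using c_cont d_cont by (cases i) simp_all
  have D_nonneg: "0 \<le> D i z" for i z
    using c_nonneg d_nonneg by (cases i) simp_all
  have compact_XA: "compact (UNIV :: ('x \<times> 'a) set)"
    using compact_Times[OF compact_X compact_A] by simp
  have "\<exists>b. \<forall>z. \<bar>D i z\<bar> \<le> b" for i
    using compact_imp_bounded[OF compact_continuous_image[OF D_cont compact_XA]]
    by (auto simp: bounded_iff)
  then obtain b where b: "\<And>i z. \<bar>D i z\<bar> \<le> b i" by metis
  define B where "B = (\<Sum>i\<in>UNIV. \<bar>b i\<bar>)"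
  have D_bound: "\<bar>D i z\<bar> \<le> B" for i z
  proof -
    have "\<bar>D i z\<bar> \<le> \<bar>b i\<bar>" using b[of i z] by simp
    also have "\<dots> \<le> B" unfolding B_def by (rule member_le_sum) auto
    finally show ?thesis .
  qed
  have B: "0 \<le> B" unfolding B_def by (rule sum_nonneg) simp
  have avg_bounds: "0 \<le> avg_cost ?O (D i) \<pi> \<and> avg_cost ?O (D i) \<pi> \<le> ereal B" if "\<pi> \<in> policies borel" for \<pi> i
  proof -
    interpret controlled_process ?O \<pi>
      by (rule controlled_process.intro) (use \<gamma>_prob p_kernel that in \<open>auto simp: orig_mdp_def\<close>)
    have "D i \<in> borel_measurable N"
      using borel_measurable_continuous_onI[OF D_cont[of i]] by (simp add: orig_mdp_def borel_prod)
    then show ?thesis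
      using avg_cost_bounds[of "D i" B] D_nonneg[of i] D_bound[of i] by (simp add: abs_le_iff)
  qed
  obtain \<pi>0 where \<pi>0: "\<pi>0 \<in> policies borel" and strict: "\<And>l. avg_cost ?O (d l) \<pi>0 < ereal (k $ l)"
    using slater by blast
  obtain s where s: "0 < s" "\<And>l. avg_cost ?O (d l) \<pi>0 \<le> ereal (k $ l - s)"
  proof -
    have "\<exists>r. avg_cost ?O (d l) \<pi>0 < ereal r \<and> r < k $ l" for l
      using ereal_dense2[OF strict[of l]] by auto
    then obtain r where r: "\<And>l. avg_cost ?O (d l) \<pi>0 < ereal (r l)" "\<And>l. r l < k $ l" by metis
    define s where "s = Min (range (\<lambda>l. k $ l - r l))"
    have "0 < s" unfolding s_def using r(2) by (subst Min_gr_iff) auto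
    moreover have "s \<le> k $ l - r l" for l unfolding s_def by (rule Min_le) auto
    then have "avg_cost ?O (d l) \<pi>0 \<le> ereal (k $ l - s)" for l
      using r(1)[of l] by (smt (verit) ereal_less_eq(3) less_imp_le order_trans)
    ultimately show thesis using that by blast
  qed
  have feas0: "feasible ?O d k \<pi>0"
    using \<pi>0 strict by (auto simp: feasible_def orig_mdp_def less_imp_le)
  have val_bounds: "0 \<le> optimal_value ?O c d k" "optimal_value ?O c d k \<le> ereal B"
  proof -
    show "0 \<le> optimal_value ?O c d k"
      unfolding optimal_value_def using avg_bounds[of _ None]
      by (intro INF_greatest) (auto simp: feasible_def orig_mdp_def)
    have "optimal_value ?O c d k \<le> avg_cost ?O c \<pi>0"
      unfolding optimal_value_def by (rule INF_lower) (simp add: feas0)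
    also have "\<dots> \<le> ereal B" using avg_bounds[OF \<pi>0, of None] by simp
    finally show "optimal_value ?O c d k \<le> ereal B" .
  qed
  then obtain v where v: "optimal_value ?O c d k = ereal v"
    by (cases "optimal_value ?O c d k") auto
  have v_nonneg: "0 \<le> v" using val_bounds v by simp
  have "optimal_value ?O c d k < ereal (v + \<kappa> / 4)" using v \<kappa> by simp
  then obtain \<pi>1 where feas1: "feasible ?O d k \<pi>1" and near: "avg_cost ?O c \<pi>1 < ereal (v + \<kappa> / 4)"
    unfolding optimal_value_def by (auto simp: INF_less_iff)
  have \<pi>1: "\<pi>1 \<in> policies borel" using feas1 by (simp add: feasible_def orig_mdp_def)

  \<comment> \<open>The weight of the Slater point. Its objective is at most \<open>B\<close>, so that it costs at most \<open>\<kappa> / 4\<close>;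
    with \<open>\<epsilon> = \<theta> * s / 2\<close>, half of the gain \<open>\<theta> * s\<close> in each constraint goes into the tightening
    and the other half covers the discretization error \<open>\<eta>0\<close>.\<close>
  define \<theta> where "\<theta> = min 1 (\<kappa> / (4 * (B + 1)))"
  have \<theta>: "0 < \<theta>" "\<theta> \<le> 1" "\<theta> * B \<le> \<kappa> / 4"
  proof -
    show "0 < \<theta>" "\<theta> \<le> 1" using \<kappa> B by (simp_all add: \<theta>_def)
    have "\<theta> * B \<le> \<theta> * (B + 1)" using \<open>0 < \<theta>\<close> by simp
    also have "\<dots> \<le> \<kappa> / (4 * (B + 1)) * (B + 1)" using B by (intro mult_right_mono) (simp_all add: \<theta>_def)
    also have "\<dots> = \<kappa> / 4" using B by (simp add: field_simps)
    finally show "\<theta> * B \<le> \<kappa> / 4" .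
  qed
  define \<epsilon> where "\<epsilon> = \<theta> * s / 2"
  have \<epsilon>: "0 < \<epsilon>" using \<theta> s by (simp add: \<epsilon>_def)
  define \<eta>0 where "\<eta>0 = min \<epsilon> (\<kappa> / 4)"
  have \<eta>0: "0 < \<eta>0" using \<epsilon> \<kappa> by (simp add: \<eta>0_def)
  \<comment> \<open>The discretization error is \<open>A * e\<close> when \<open>e\<close> bounds both oscillations on the cells.\<close>
  define A where "A = real CARD('q option) * (1 + 2 * B / (1 - \<alpha>))"
  have A: "0 < A" unfolding A_def using B \<alpha> by (intro mult_pos_pos add_pos_nonneg) auto
  define e where "e = \<eta>0 / A"
  have e: "0 < e" using \<eta>0 A by (simp add: e_def)

  have p_prob: "p z \<in> space (prob_algebra borel)" for z
    using measurable_space[OF p_kernel, of z] by (simp add: space_pair_measure)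
  obtain \<delta>1 where \<delta>1: "0 < \<delta>1"
    "\<And>z w E. dist z w < \<delta>1 \<Longrightarrow> E \<in> sets borel \<Longrightarrow> \<bar>measure (p z) E - measure (p w) E\<bar> < e"
    using tv_uniformly_continuous[OF compact_XA p_tv p_prob e] by blast
  have "\<exists>\<delta>>0. \<forall>z w. dist z w < \<delta> \<longrightarrow> \<bar>D i z - D i w\<bar> < e" for i
    using compact_uniformly_continuous[OF D_cont compact_XA, of i] e
    unfolding uniformly_continuous_on_def by (force simp: dist_real_def)
  then obtain \<delta>D where \<delta>D: "\<And>i. 0 < \<delta>D i" "\<And>i z w. dist z w < \<delta>D i \<Longrightarrow> \<bar>D i z - D i w\<bar> < e" by metis
  define \<delta> where "\<delta> = min \<delta>1 (Min (range \<delta>D))"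
  have \<delta>: "0 < \<delta>" "\<delta> \<le> \<delta>1" "\<delta> \<le> \<delta>D i" for i
    using \<delta>1(1) \<delta>D(1) by (auto simp: \<delta>_def intro: min.coboundedI2)
  \<comment> \<open>A cell has diameter less than \<open>2 / n\<close>.\<close>
  obtain n :: nat where n: "2 / \<delta> < real n" using reals_Archimedean2 by blast
  have n1: "1 \<le> n"
  proof -
    have "0 < real n" using n \<delta>(1) by (meson divide_pos_pos less_trans zero_less_numeral)
    then show ?thesis by simp
  qed
  have diam: "dist (x, a) (z, a) < \<delta>" if "Q n x = Q n z" for x z and a :: 'a
  proof -
    have near: "dist x (Q n x) < 1 / real n" for x
      using Xn_net[OF n1, of x] Q_nearest[OF n1, of _ x] by (meson order_le_less_trans)
    have "dist (x, a) (z, a) = dist x z" by (simp add: dist_Pair_Pair)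
    also have "\<dots> \<le> dist x (Q n x) + dist z (Q n z)"
      using dist_triangle2[of x z "Q n x"] that by simp
    also have "\<dots> < 2 / real n" using near[of x] near[of z] by simp
    also have "\<dots> < \<delta>" using n n1 \<delta>(1) by (simp add: field_simps)
    finally show ?thesis .
  qed
  interpret quantized_model p \<gamma> \<mu> "\<nu> n" "Xn n" "Q n" D B \<alpha> e e
  proof
    show "(1 - \<alpha>) * measure \<mu> E \<le> measure (p z) E" if "E \<in> sets borel" for z E
      using minorization[OF that, of z] mult_left_mono[OF \<phi>_lower[of z], of "measure \<mu> E"]
      by (simp add: mult.commute)
    show "cell_measure (\<nu> n) (Q n) y \<in> space (prob_algebra borel)" if "y \<in> Xn n" for y
      by (rule cell_measure_prob[OF \<nu>_sets[OF n1] \<nu>_finite[OF n1] \<nu>_pos[OF n1 that]])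
    show "\<bar>D i (x, a) - D i (z, a)\<bar> \<le> e" if "Q n x = Q n z" for i x z a
      using \<delta>D(2)[of "(x, a)" "(z, a)" i] diam[OF that, of a] \<delta>(3)[of i] by linarith
    show "\<bar>measure (p (x, a)) E - measure (p (z, a)) E\<bar> \<le> e" if "Q n x = Q n z" "E \<in> sets borel" for x z a E
      using \<delta>1(2)[of "(x, a)" "(z, a)" E] diam[OF that(1), of a] \<delta>(2) that(2) by linarith
  qed (fact compact_A p_kernel p_tv D_cont D_bound \<gamma>_prob \<mu>_prob \<alpha> Xn_finite[OF n1] Q_measurable[OF n1]
      Q_in[OF n1] \<nu>_sets[OF n1])+
  have \<eta>_orig: "orig.\<eta> = \<eta>0"
  proof -
    have "orig.\<eta> = A * e" unfolding orig.\<eta>_def A_def by (simp add: algebra_simps)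
    then show ?thesis using A by (simp add: e_def)
  qed
  have pol_O: "policies (states ?O) = policies borel" by (simp add: orig_mdp_def)
  define m where "m = k - \<epsilon> *\<^sub>R (1 :: real ^ 'q)"
  have m_l: "m $ l = k $ l - \<epsilon>" for l by (simp add: m_def)

  \<comment> \<open>Points of the finite problem that are, up to \<open>\<eta>0\<close>, no worse than the nearly optimal policy and the Slater policy.\<close>
  obtain z1 where z1: "z1 \<in> achievable" "\<And>i. ereal (z1 $ i - \<eta>0) \<le> avg_cost ?O (D i) \<pi>1"
    using orig.averages_near_achievable[of \<pi>1] \<pi>1 by (auto simp: pol_O \<eta>_orig)
  obtain z0 where z0: "z0 \<in> achievable" "\<And>i. ereal (z0 $ i - \<eta>0) \<le> avg_cost ?O (D i) \<pi>0"
    using orig.averages_near_achievable[of \<pi>0] \<pi>0 by (auto simp: pol_O \<eta>_orig)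
  define y where "y = (1 - \<theta>) *\<^sub>R z1 + \<theta> *\<^sub>R z0"
  have y: "y \<in> achievable"
    unfolding y_def using convex_achievable z1(1) z0(1) \<theta> by (simp add: convex_alt)
  have y_coord: "y $ i = (1 - \<theta>) * z1 $ i + \<theta> * z0 $ i" for i
    by (simp add: y_def)
  have y_feas: "y $ Some l \<le> m $ l" for l
  proof -
    have "ereal (z1 $ Some l - \<eta>0) \<le> ereal (k $ l)"
      using z1(2)[of "Some l"] feas1 unfolding feasible_def D_simps by (blast intro: order_trans)
    then have a: "z1 $ Some l \<le> k $ l + \<eta>0" by simp
    have "ereal (z0 $ Some l - \<eta>0) \<le> ereal (k $ l - s)"
      using z0(2)[of "Some l"] s(2)[of l] unfolding D_simps by (rule order_trans)
    then have b: "z0 $ Some l \<le> k $ l + \<eta>0 - s" by simp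
    have "y $ Some l \<le> (1 - \<theta>) * (k $ l + \<eta>0) + \<theta> * (k $ l + \<eta>0 - s)"
      unfolding y_coord using \<theta> a b by (intro add_mono mult_left_mono) auto
    also have "\<dots> = k $ l + \<eta>0 - 2 * \<epsilon>" by (simp add: \<epsilon>_def algebra_simps)
    also have "\<dots> \<le> m $ l" by (simp add: m_l \<eta>0_def)
    finally show ?thesis .
  qed
  have y_cost: "y $ None \<le> v + 3 * (\<kappa> / 4)"
  proof -
    have "ereal (z1 $ None - \<eta>0) \<le> ereal (v + \<kappa> / 4)"
      using z1(2)[of None] less_imp_le[OF near] unfolding D_simps by (rule order_trans)
    then have a: "z1 $ None \<le> v + \<kappa> / 4 + \<eta>0" by simp
    have "ereal (z0 $ None - \<eta>0) \<le> ereal B"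
      using z0(2)[of None] avg_bounds[OF \<pi>0, of None] by (blast intro: order_trans)
    then have b: "z0 $ None \<le> B + \<eta>0" by simp
    have "y $ None \<le> (1 - \<theta>) * (v + \<kappa> / 4 + \<eta>0) + \<theta> * (B + \<eta>0)"
      unfolding y_coord using \<theta> a b by (intro add_mono mult_left_mono) auto
    also have "\<dots> = v + \<kappa> / 4 + \<eta>0 + \<theta> * B - \<theta> * (v + \<kappa> / 4)" by (simp add: field_simps)
    also have "\<dots> \<le> v + 3 * (\<kappa> / 4)"
    proof -
      have "0 \<le> \<theta> * (v + \<kappa> / 4)" using \<theta>(1) v_nonneg \<kappa> by simp
      then show ?thesis using \<theta>(3) by (simp add: \<eta>0_def)
    qed
    finally show ?thesis .
  qed

  let ?F = "fin_mdp (Xn n) (Q n) (\<nu> n) p \<gamma>" and ?bar = "bar_mdp (Q n) (\<nu> n) p \<gamma>"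
  let ?Opt = "{\<phi>n \<in> stationary_kernels (count_space (Xn n)).
    optimal_policy ?F (fin_cost (Q n) (\<nu> n) c) (\<lambda>l. fin_cost (Q n) (\<nu> n) (d l)) m (stationary \<phi>n) \<and>
    optimal_policy ?bar (bar_cost (Q n) (\<nu> n) c) (\<lambda>l. bar_cost (Q n) (\<nu> n) (d l)) m (stationary (\<phi>n \<circ> Q n))}"
  have fin_avg: "avg_cost ?F (C i) (stationary \<psi>) = ereal (perf \<psi> $ i)" if "\<psi> \<in> kernels" for \<psi> i
    using fin.lifted_kernel_average[OF that, of i] by (simp add: fin.\<eta>_def comp_def)

  have "?Opt \<noteq> {}"
  proof -
    define S where "S = achievable \<inter> (\<Inter>l. {z. z $ Some l \<le> m $ l})"
    have "compact S"
      unfolding S_def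
      by (intro compact_Int_closed compact_achievable closed_INT ballI closed_Collect_le continuous_intros)
    moreover have "y \<in> S" using y y_feas by (simp add: S_def)
    moreover have "continuous_on S (\<lambda>z. z $ None)" by (intro continuous_intros)
    ultimately obtain z where z: "z \<in> S" "\<And>z'. z' \<in> S \<Longrightarrow> z $ None \<le> z' $ None"
      using continuous_attains_inf[of S "\<lambda>z. z $ None"] by blast
    then obtain \<psi> where \<psi>: "\<psi> \<in> kernels" "z = perf \<psi>"
      using achievable_subset by (auto simp: S_def)
    have feas: "perf \<psi> $ Some l \<le> m $ l" for l using z(1) \<psi>(2) by (simp add: S_def)
    have best: "perf \<psi> $ None \<le> z' $ None" if "z' \<in> achievable" "\<And>l. z' $ Some l \<le> m $ l" for z'
      using z(2)[of z'] that \<psi>(2) by (simp add: S_def)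
    have "optimal_policy ?F (C None) (\<lambda>l. C (Some l)) m (stationary (\<psi> \<circ> (\<lambda>y. y)))"
      by (rule stationary_optimal_if_exact[OF fin.approximation_axioms \<psi>(1) feas best])
    moreover have "optimal_policy ?bar (bar_cost (Q n) (\<nu> n) (D None)) (\<lambda>l. bar_cost (Q n) (\<nu> n) (D (Some l))) m
        (stationary (\<psi> \<circ> Q n))"
      by (rule stationary_optimal_if_exact[where G = "\<lambda>i. bar_cost (Q n) (\<nu> n) (D i)",
          OF bar.approximation_axioms \<psi>(1) feas best])
    ultimately have "\<psi> \<in> ?Opt" using \<psi>(1) by (simp add: C_def comp_def)
    then show ?thesis by blast
  qed
  moreover have "\<phi>n \<circ> Q n \<in> stationary_kernels borel \<and> feasible ?O d k (stationary (\<phi>n \<circ> Q n)) \<and>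
      \<bar>avg_cost ?O c (stationary (\<phi>n \<circ> Q n)) - optimal_value ?O c d k\<bar> \<le> ereal \<kappa>"
    if "\<phi>n \<in> ?Opt" for \<phi>n
  proof -
    have \<phi>n: "\<phi>n \<in> kernels"
      and opt: "optimal_policy ?F (C None) (\<lambda>l. C (Some l)) m (stationary \<phi>n)"
      using that by (auto simp: C_def)
    have lift: "\<phi>n \<circ> Q n \<in> stationary_kernels borel"
      using orig.lifted_kernel[OF \<phi>n] by (simp add: orig_mdp_def)
    have upper: "avg_cost ?O (D i) (stationary (\<phi>n \<circ> Q n)) \<le> ereal (perf \<phi>n $ i + \<eta>0)" for i
      using orig.lifted_kernel_average(2)[OF \<phi>n, of i] by (simp add: \<eta>_orig)
    have perf_feas: "perf \<phi>n $ Some l \<le> m $ l" for l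
    proof -
      have "avg_cost ?F (C (Some l)) (stationary \<phi>n) \<le> ereal (m $ l)"
        using opt unfolding optimal_policy_def feasible_def by blast
      then show ?thesis by (simp add: fin_avg[OF \<phi>n])
    qed
    have "avg_cost ?O (d l) (stationary (\<phi>n \<circ> Q n)) \<le> ereal (k $ l)" for l
    proof -
      have "avg_cost ?O (d l) (stationary (\<phi>n \<circ> Q n)) \<le> ereal (perf \<phi>n $ Some l + \<eta>0)"
        using upper[of "Some l"] by simp
      also have "\<dots> \<le> ereal (k $ l)"
        using perf_feas[of l] by (simp add: m_l \<eta>0_def)
      finally show ?thesis .
    qed
    then have feas: "feasible ?O d k (stationary (\<phi>n \<circ> Q n))"
      unfolding feasible_def pol_O using stationary_in_policies[OF lift] by blast
    \<comment> \<open>A kernel that realizes the mixture competes with \<open>\<phi>n\<close> in the tightened problem.\<close>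
    obtain \<psi> where \<psi>: "\<psi> \<in> kernels" "y = perf \<psi>" using achievable_subset y by blast
    have "feasible ?F (\<lambda>l. C (Some l)) m (stationary \<psi>)"
      using stationary_in_policies[OF \<psi>(1)] y_feas \<psi>(2)
      by (simp add: feasible_def fin_avg[OF \<psi>(1)]) (simp add: fin_mdp_def)
    then have "avg_cost ?F (C None) (stationary \<phi>n) \<le> avg_cost ?F (C None) (stationary \<psi>)"
      using opt unfolding optimal_policy_def by blast
    then have "perf \<phi>n $ None \<le> y $ None"
      by (simp add: fin_avg[OF \<phi>n] fin_avg[OF \<psi>(1)] \<psi>(2))
    then have "perf \<phi>n $ None + \<eta>0 \<le> v + \<kappa>" using y_cost by (simp add: \<eta>0_def)
    with upper[of None] have le: "avg_cost ?O c (stationary (\<phi>n \<circ> Q n)) \<le> ereal (v + \<kappa>)"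
      by (simp) (meson ereal_less_eq(3) order_trans)
    moreover have ge: "ereal v \<le> avg_cost ?O c (stationary (\<phi>n \<circ> Q n))"
      unfolding v[symmetric] optimal_value_def by (rule INF_lower) (simp add: feas)
    ultimately have "\<bar>avg_cost ?O c (stationary (\<phi>n \<circ> Q n)) - optimal_value ?O c d k\<bar> \<le> ereal \<kappa>"
      unfolding v by (cases "avg_cost ?O c (stationary (\<phi>n \<circ> Q n))") auto
    with lift feas show ?thesis by blast
  qed
  ultimately show ?thesis
    using \<epsilon> n1 by (intro exI[of _ \<epsilon>] conjI exI[of _ n]) (simp_all add: Let_def m_def)
qed

end
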